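(* Let $\omega\in\Omega$ be a finite real orbit with $m:=|B_\omega|>0$, let $j\in\mathbb Z_m$ and let $w\in\mathbf D$. Then $V(\omega,j,w)^\sharp\simeq V(\omega,j,w^\dagger)$ as $A$-modules. In particular, $V(\omega,j,w)$ is pseudo-unitarizable if and only if $w=\varepsilon$, the empty word, which is equivalent to $V(\omega,j,w)$ being simple.
   Context: Setup. $R$ is a commutative ring with $1$; $*:R\to R$ is a ring automorphism of order $1$ or $2$; $\sigma:R\to R$ is a ring automorphism commuting with $*$; $t\in R$ satisfies $t^*=t$. The generalized Weyl algebra $A=R(\sigma,t)$ is the ring generated by $R\cup\{X,Y\}$ such that $R$ is a subring and $YX=t$, $XY=\sigma(t)$, $Xr=\sigma(r)X$, $Yr=\sigma^{-1}(r)Y$ for all $r\in R$. It is $\mathbb Z$-graded with $\deg X=1$, $\deg Y=-1$, $\deg r=0$ for $r\in R$. The map $*$ extends to an involution of $A$ (additive, $(ab)^*=b^*a^*$, $a^{**}=a$) with $X^*=Y$, $Y^*=X$. $\Omega$ is the set of orbits of $\sigma$ acting on $\mathrm{Max}(R)$. An orbit $\omega$ is real if $\mathfrak m^*=\mathfrak m$ for all $\mathfrak m\in\omega$. $B_\omega=\{\mathfrak m\in\omega:t\in\mathfrak m\}$ is the set of breaks. $\mathbb K_{\mathfrak m}=R/\mathfrak m$, and $r_{\mathfrak m}=r+\mathfrak m$. $\sigma$ induces isomorphisms $R/\mathfrak m\to R/\sigma(\mathfrak m)$ and an additive map $\sigma:R_\omega\to R_\omega$ on $R_\omega=\bigoplus_{\mathfrak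 m\in\omega}R/\mathfrak m$. A weight module is an $A$-module $V=\bigoplus_{\mathfrak m\in\mathrm{Max}(R)}V_{\mathfrak m}$ with $V_{\mathfrak m}=\{v:\mathfrak m v=0\}$; $\mathrm{Supp}(V)=\{\mathfrak m:V_{\mathfrak m}\ne0\}$. For a weight module $V$ with $\mathrm{Supp}(V)\subseteq\omega$: an admissible form on $V$ is a map $F:V\times V\to R_\omega$, additive in each argument, with $F(rv,w)=rF(v,w)$ for $r\in R$ and $F(av,w)=\sigma^{\deg a}(F(v,a^*w))$ for homogeneous $a\in A$. It is non-degenerate if for any nonzero $v$ there are $w_1,w_2$ with $F(w_1,v)\ne0\ne F(v,w_2)$. $V$ is pseudo-unitarizable if it has a non-degenerate admissible form. The finitistic dual $V^\sharp$ is the set of additive maps $\varphi:V\to R_\omega$ with $\varphi(rv)=r^*\varphi(v)$ and $\varphi(V_{\mathfrak m})=0$ for all but finitely many $\mathfrak m\in\omega$, an $A$-module via $(r\varphi)(v)=\varphi(r^*v)$, $(X\varphi)(v)=\sigma(\varphi(Yv))$, $(Y\varphi)(v)=\sigma^{-1}(\varphi(Xv))$. Words. $\mathbf D$ is the free monoid on letters $x,y$, with empty word $\varepsilon$; $\dagger:\mathbf D\to\mathbf D$ is the monoid automorphism with $x^\dagger=y$, $y^\dagger=x$. Breaks. Let $|\omega|<\infty$ and $m=|B_\omega|>0$. Fix a break $\mathfrak m_0\in B_\omega$ and enumerate the breaks cyclically as $\mathfrak m_i$, $i\in\mathbb Z_m=\mathbb Z/m\mathbb Z$, so that $\mathfrak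 m_i$ is the first break among $\sigma(\mathfrak m_{i-1}),\sigma^2(\mathfrak m_{i-1}),\dots$. For $\mathfrak m\in\omega$, $j(\mathfrak m)\in\mathbb Z_m$ is the index such that $\mathfrak m_{j(\mathfrak m)}$ is the first break among $\mathfrak m,\sigma(\mathfrak m),\sigma^2(\mathfrak m),\dots$. The module $V(\omega,i,w)$, for $i\in\mathbb Z_m$ and $w=z_1z_2\cdots z_n\in\mathbf D$ ($z_k\in\{x,y\}$, $n\ge0$): take symbols $e_0,e_1,\dots,e_n$; for $\mathfrak m\in\omega$ let $V_{\mathfrak m}$ be the $\mathbb K_{\mathfrak m}$-vector space with basis all pairs $[\mathfrak m,e_k]$ ($0\le k\le n$) with $i+k=j(\mathfrak m)$ in $\mathbb Z_m$; $V(\omega,i,w)=\bigoplus_{\mathfrak m\in\omega}V_{\mathfrak m}$. $X$ and $Y$ are additive, $X(\lambda v)=\sigma(\lambda)Xv$ and $Y(\lambda v)=\sigma^{-1}(\lambda)Yv$ for $\lambda\in\mathbb K_{\mathfrak m}$, $v\in V_{\mathfrak m}$, and on basis vectors: $X[\mathfrak m,e_k]=\sigma(t_{\mathfrak m})[\sigma(\mathfrak m),e_k]$ if $\mathfrak m\notin B_\omega$; $X[\mathfrak m,e_k]=[\sigma(\mathfrak m),e_{k+1}]$ if $\mathfrak m\in B_\omega$, $k<n$ and $z_{k+1}=x$; $X[\mathfrak m,e_k]=0$ otherwise. $Y[\mathfrak m,e_k]=[\sigma^{-1}(\mathfrak m),e_k]$ if $\sigma^{-1}(\mathfrak m)\notin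 B_\omega$; $Y[\mathfrak m,e_k]=[\sigma^{-1}(\mathfrak m),e_{k-1}]$ if $\sigma^{-1}(\mathfrak m)\in B_\omega$, $k\ge1$ and $z_k=y$; $Y[\mathfrak m,e_k]=0$ otherwise. *)

theory Defs
  imports "HOL-Algebra.Algebra" "HOL-Number_Theory.Cong"
begin

section \<open>Left modules over a not necessarily commutative ring\<close>

text \<open>The library locale \<^locale>\<open>module\<close> requires a commutative ring of scalars, but its record type
  and the locale \<^locale>\<open>submodule\<close> do not.\<close>

locale left_module = A?: ring A + M?: abelian_group M for A :: "('c, 'k) ring_scheme" (structure)
    and M :: "('c, 'v, 'l) module_scheme" (structure) +
  assumes smult_closed: "\<lbrakk>a \<in> carrier A; v \<in> carrier M\<rbrakk> \<Longrightarrow> a \<odot>\<^bsub>M\<^esub> v \<in> carrier M"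
    and smult_l_distr: "\<lbrakk>a \<in> carrier A; b \<in> carrier A; v \<in> carrier M\<rbrakk>
      \<Longrightarrow> (a \<oplus>\<^bsub>A\<^esub> b) \<odot>\<^bsub>M\<^esub> v = a \<odot>\<^bsub>M\<^esub> v \<oplus>\<^bsub>M\<^esub> b \<odot>\<^bsub>M\<^esub> v"
    and smult_r_distr: "\<lbrakk>a \<in> carrier A; v \<in> carrier M; w \<in> carrier M\<rbrakk>
      \<Longrightarrow> a \<odot>\<^bsub>M\<^esub> (v \<oplus>\<^bsub>M\<^esub> w) = a \<odot>\<^bsub>M\<^esub> v \<oplus>\<^bsub>M\<^esub> a \<odot>\<^bsub>M\<^esub> w"
    and smult_assoc: "\<lbrakk>a \<in> carrier A; b \<in> carrier A; v \<in> carrier M\<rbrakk>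
      \<Longrightarrow> (a \<otimes>\<^bsub>A\<^esub> b) \<odot>\<^bsub>M\<^esub> v = a \<odot>\<^bsub>M\<^esub> (b \<odot>\<^bsub>M\<^esub> v)"
    and smult_one: "v \<in> carrier M \<Longrightarrow> \<one>\<^bsub>A\<^esub> \<odot>\<^bsub>M\<^esub> v = v"

definition isomorphic_modules ::
    "('c, 'k) ring_scheme \<Rightarrow> ('c, 'u) module \<Rightarrow> ('c, 'v) module \<Rightarrow> bool" where
  "isomorphic_modules A M N \<longleftrightarrow> left_module A M \<and> left_module A N \<and>
     (\<exists>f \<in> iso (add_monoid M) (add_monoid N).
        \<forall>a \<in> carrier A. \<forall>v \<in> carrier M. f (a \<odot>\<^bsub>M\<^esub> v) = a \<odot>\<^bsub>N\<^esub> f v)"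

definition simple_module :: "('c, 'k) ring_scheme \<Rightarrow> ('c, 'v) module \<Rightarrow> bool" where
  "simple_module A M \<longleftrightarrow> left_module A M \<and> carrier M \<noteq> {\<zero>\<^bsub>M\<^esub>} \<and>
     (\<forall>H. submodule H A M \<longrightarrow> H = {\<zero>\<^bsub>M\<^esub>} \<or> H = carrier M)"


section \<open>Automorphisms, maximal ideals and orbits\<close>

definition aut_inv :: "('a, 'm) ring_scheme \<Rightarrow> ('a \<Rightarrow> 'a) \<Rightarrow> 'a \<Rightarrow> 'a" where
  "aut_inv R \<sigma> = inv_into (carrier R) \<sigma>"

definition aut_pow :: "('a, 'm) ring_scheme \<Rightarrow> ('a \<Rightarrow> 'a) \<Rightarrow> int \<Rightarrow> 'a \<Rightarrow> 'a" where
  "aut_pow R \<sigma> n = (if 0 \<le> n then \<sigma> ^^ nat n else aut_inv R \<sigma> ^^ nat (- n))"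

definition Max_ideals :: "('a, 'm) ring_scheme \<Rightarrow> 'a set set" where
  "Max_ideals R = {\<mm>. maximalideal \<mm> R}"

definition ideal_orbits :: "('a, 'm) ring_scheme \<Rightarrow> ('a \<Rightarrow> 'a) \<Rightarrow> 'a set set set" where
  "ideal_orbits R \<sigma> = orbits integer_group (Max_ideals R) (\<lambda>n \<mm>. aut_pow R \<sigma> n ` \<mm>)"

definition real_orbit :: "('a \<Rightarrow> 'a) \<Rightarrow> 'a set set \<Rightarrow> bool" where
  "real_orbit star \<omega> \<longleftrightarrow> (\<forall>\<mm> \<in> \<omega>. star ` \<mm> = \<mm>)"

definition breaks :: "'a \<Rightarrow> 'a set set \<Rightarrow> 'a set set" where
  "breaks t \<omega> = {\<mm> \<in> \<omega>. t \<in> \<mm>}"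


section \<open>The generalized Weyl algebra\<close>

text \<open>The ring generated by \<open>R \<union> {X, Y}\<close> subject to the defining relations is taken literally: formal
  ring expressions in the generators modulo the smallest congruence containing the ring axioms, the
  ring operations of \<open>R\<close> and the four relations. (It is a classical fact that \<open>R\<close> embeds.)\<close>

datatype 'a gterm =
    Scal 'a
  | GX
  | GY
  | GNeg "'a gterm"
  | GAdd "'a gterm" "'a gterm"
  | GMul "'a gterm" "'a gterm"

inductive_set gterms :: "('a, 'm) ring_scheme \<Rightarrow> 'a gterm set" for R where
  "r \<in> carrier R \<Longrightarrow> Scal r \<in> gterms R"
| "GX \<in> gterms R"
| "GY \<in> gterms R"
| "a \<in> gterms R \<Longrightarrow> GNeg a \<in> gterms R"
| "\<lbrakk>a \<in> gterms R; b \<in> gterms R\<rbrakk> \<Longrightarrow> GAdd a b \<in> gterms R"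
| "\<lbrakk>a \<in> gterms R; b \<in> gterms R\<rbrakk> \<Longrightarrow> GMul a b \<in> gterms R"

inductive gwa_eq :: "('a, 'm) ring_scheme \<Rightarrow> ('a \<Rightarrow> 'a) \<Rightarrow> 'a \<Rightarrow> 'a gterm \<Rightarrow> 'a gterm \<Rightarrow> bool"
  for R \<sigma> t where
  gwa_refl: "a \<in> gterms R \<Longrightarrow> gwa_eq R \<sigma> t a a"
| gwa_sym: "gwa_eq R \<sigma> t a b \<Longrightarrow> gwa_eq R \<sigma> t b a"
| gwa_trans: "\<lbrakk>gwa_eq R \<sigma> t a b; gwa_eq R \<sigma> t b c\<rbrakk> \<Longrightarrow> gwa_eq R \<sigma> t a c"
| gwa_cong_neg: "gwa_eq R \<sigma> t a a' \<Longrightarrow> gwa_eq R \<sigma> t (GNeg a) (GNeg a')"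
| gwa_cong_add: "\<lbrakk>gwa_eq R \<sigma> t a a'; gwa_eq R \<sigma> t b b'\<rbrakk> \<Longrightarrow> gwa_eq R \<sigma> t (GAdd a b) (GAdd a' b')"
| gwa_cong_mul: "\<lbrakk>gwa_eq R \<sigma> t a a'; gwa_eq R \<sigma> t b b'\<rbrakk> \<Longrightarrow> gwa_eq R \<sigma> t (GMul a b) (GMul a' b')"
| gwa_add_assoc: "\<lbrakk>a \<in> gterms R; b \<in> gterms R; c \<in> gterms R\<rbrakk>
    \<Longrightarrow> gwa_eq R \<sigma> t (GAdd (GAdd a b) c) (GAdd a (GAdd b c))"
| gwa_add_comm: "\<lbrakk>a \<in> gterms R; b \<in> gterms R\<rbrakk> \<Longrightarrow> gwa_eq R \<sigma> t (GAdd a b) (GAdd b a)"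
| gwa_add_zero: "a \<in> gterms R \<Longrightarrow> gwa_eq R \<sigma> t (GAdd (Scal \<zero>\<^bsub>R\<^esub>) a) a"
| gwa_add_neg: "a \<in> gterms R \<Longrightarrow> gwa_eq R \<sigma> t (GAdd (GNeg a) a) (Scal \<zero>\<^bsub>R\<^esub>)"
| gwa_mul_assoc: "\<lbrakk>a \<in> gterms R; b \<in> gterms R; c \<in> gterms R\<rbrakk>
    \<Longrightarrow> gwa_eq R \<sigma> t (GMul (GMul a b) c) (GMul a (GMul b c))"
| gwa_mul_one_l: "a \<in> gterms R \<Longrightarrow> gwa_eq R \<sigma> t (GMul (Scal \<one>\<^bsub>R\<^esub>) a) a"
| gwa_mul_one_r: "a \<in> gterms R \<Longrightarrow> gwa_eq R \<sigma> t (GMul a (Scal \<one>\<^bsub>R\<^esub>)) a"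
| gwa_distrib_l: "\<lbrakk>a \<in> gterms R; b \<in> gterms R; c \<in> gterms R\<rbrakk>
    \<Longrightarrow> gwa_eq R \<sigma> t (GMul a (GAdd b c)) (GAdd (GMul a b) (GMul a c))"
| gwa_distrib_r: "\<lbrakk>a \<in> gterms R; b \<in> gterms R; c \<in> gterms R\<rbrakk>
    \<Longrightarrow> gwa_eq R \<sigma> t (GMul (GAdd a b) c) (GAdd (GMul a c) (GMul b c))"
| gwa_scal_add: "\<lbrakk>r \<in> carrier R; s \<in> carrier R\<rbrakk>
    \<Longrightarrow> gwa_eq R \<sigma> t (GAdd (Scal r) (Scal s)) (Scal (r \<oplus>\<^bsub>R\<^esub> s))"
| gwa_scal_mul: "\<lbrakk>r \<in> carrier R; s \<in> carrier R\<rbrakk>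
    \<Longrightarrow> gwa_eq R \<sigma> t (GMul (Scal r) (Scal s)) (Scal (r \<otimes>\<^bsub>R\<^esub> s))"
| gwa_YX: "gwa_eq R \<sigma> t (GMul GY GX) (Scal t)"
| gwa_XY: "gwa_eq R \<sigma> t (GMul GX GY) (Scal (\<sigma> t))"
| gwa_X_scal: "r \<in> carrier R \<Longrightarrow> gwa_eq R \<sigma> t (GMul GX (Scal r)) (GMul (Scal (\<sigma> r)) GX)"
| gwa_Y_scal: "r \<in> carrier R
    \<Longrightarrow> gwa_eq R \<sigma> t (GMul GY (Scal r)) (GMul (Scal (aut_inv R \<sigma> r)) GY)"

definition gwa_class :: "('a, 'm) ring_scheme \<Rightarrow> ('a \<Rightarrow> 'a) \<Rightarrow> 'a \<Rightarrow> 'a gterm \<Rightarrow> 'a gterm set" where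
  "gwa_class R \<sigma> t a = {b. gwa_eq R \<sigma> t a b}"

definition gwa :: "('a, 'm) ring_scheme \<Rightarrow> ('a \<Rightarrow> 'a) \<Rightarrow> 'a \<Rightarrow> 'a gterm set ring" where
  "gwa R \<sigma> t = \<lparr>carrier = gwa_class R \<sigma> t ` gterms R,
     monoid.mult = (\<lambda>C D. \<Union>a \<in> C. \<Union>b \<in> D. gwa_class R \<sigma> t (GMul a b)),
     monoid.one = gwa_class R \<sigma> t (Scal \<one>\<^bsub>R\<^esub>),
     ring.zero = gwa_class R \<sigma> t (Scal \<zero>\<^bsub>R\<^esub>),
     ring.add = (\<lambda>C D. \<Union>a \<in> C. \<Union>b \<in> D. gwa_class R \<sigma> t (GAdd a b))\<rparr>"

inductive gterm_homogeneous :: "('a, 'm) ring_scheme \<Rightarrow> 'a gterm \<Rightarrow> int \<Rightarrow> bool" for R where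
  "r \<in> carrier R \<Longrightarrow> gterm_homogeneous R (Scal r) 0"
| "gterm_homogeneous R GX 1"
| "gterm_homogeneous R GY (- 1)"
| "gterm_homogeneous R a d \<Longrightarrow> gterm_homogeneous R (GNeg a) d"
| "\<lbrakk>gterm_homogeneous R a d; gterm_homogeneous R b d\<rbrakk> \<Longrightarrow> gterm_homogeneous R (GAdd a b) d"
| "\<lbrakk>gterm_homogeneous R a d; gterm_homogeneous R b e\<rbrakk> \<Longrightarrow> gterm_homogeneous R (GMul a b) (d + e)"

definition gwa_component ::
    "('a, 'm) ring_scheme \<Rightarrow> ('a \<Rightarrow> 'a) \<Rightarrow> 'a \<Rightarrow> int \<Rightarrow> 'a gterm set set" where
  "gwa_component R \<sigma> t d = gwa_class R \<sigma> t ` {a. gterm_homogeneous R a d}"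

primrec gterm_star :: "('a \<Rightarrow> 'a) \<Rightarrow> 'a gterm \<Rightarrow> 'a gterm" where
  "gterm_star star (Scal r) = Scal (star r)"
| "gterm_star star GX = GY"
| "gterm_star star GY = GX"
| "gterm_star star (GNeg a) = GNeg (gterm_star star a)"
| "gterm_star star (GAdd a b) = GAdd (gterm_star star a) (gterm_star star b)"
| "gterm_star star (GMul a b) = GMul (gterm_star star b) (gterm_star star a)"

definition gwa_star ::
    "('a, 'm) ring_scheme \<Rightarrow> ('a \<Rightarrow> 'a) \<Rightarrow> ('a \<Rightarrow> 'a) \<Rightarrow> 'a \<Rightarrow> 'a gterm set \<Rightarrow> 'a gterm set" where
  "gwa_star R star \<sigma> t C = (\<Union>a \<in> C. gwa_class R \<sigma> t (gterm_star star a))"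


section \<open>Modules given by the action of the generators\<close>

text \<open>Abelian groups \<open>G\<close> are multiplicative records, as in the library's direct sums
  \<^const>\<open>sum_group\<close>.\<close>

primrec gterm_act ::
    "('v, 'k) monoid_scheme \<Rightarrow> ('a \<Rightarrow> 'v \<Rightarrow> 'v) \<Rightarrow> ('v \<Rightarrow> 'v) \<Rightarrow> ('v \<Rightarrow> 'v) \<Rightarrow> 'a gterm \<Rightarrow> 'v \<Rightarrow> 'v" where
  "gterm_act G \<rho> fX fY (Scal r) = \<rho> r"
| "gterm_act G \<rho> fX fY GX = fX"
| "gterm_act G \<rho> fX fY GY = fY"
| "gterm_act G \<rho> fX fY (GNeg a) = (\<lambda>v. inv\<^bsub>G\<^esub> gterm_act G \<rho> fX fY a v)"
| "gterm_act G \<rho> fX fY (GAdd a b) = (\<lambda>v. gterm_act G \<rho> fX fY a v \<otimes>\<^bsub>G\<^esub> gterm_act G \<rho> fX fY b v)"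
| "gterm_act G \<rho> fX fY (GMul a b) = (\<lambda>v. gterm_act G \<rho> fX fY a (gterm_act G \<rho> fX fY b v))"

text \<open>The action of a class is the action of any representative; the choice is immaterial when the
  operators \<open>\<rho> r\<close>, \<open>fX\<close>, \<open>fY\<close> satisfy the defining relations. The ring multiplication of the
  \<^typ>\<open>('c, 'v) module\<close> record plays no role.\<close>

definition gwa_module ::
    "('v, 'k) monoid_scheme \<Rightarrow> ('a \<Rightarrow> 'v \<Rightarrow> 'v) \<Rightarrow> ('v \<Rightarrow> 'v) \<Rightarrow> ('v \<Rightarrow> 'v) \<Rightarrow> ('a gterm set, 'v) module" where
  "gwa_module G \<rho> fX fY = \<lparr>carrier = carrier G, monoid.mult = undefined, monoid.one = undefined,
     ring.zero = \<one>\<^bsub>G\<^esub>, ring.add = monoid.mult G,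
     smult = (\<lambda>C. gterm_act G \<rho> fX fY (SOME a. a \<in> C))\<rparr>"


section \<open>The additive group \<open>R\<^sub>\<omega>\<close>\<close>

definition R_orb :: "('a, 'm) ring_scheme \<Rightarrow> 'a set set \<Rightarrow> ('a set \<Rightarrow> 'a set) monoid" where
  "R_orb R \<omega> = sum_group \<omega> (\<lambda>\<mm>. add_monoid (R Quot \<mm>))"

definition R_orb_smult ::
    "('a, 'm) ring_scheme \<Rightarrow> 'a set set \<Rightarrow> 'a \<Rightarrow> ('a set \<Rightarrow> 'a set) \<Rightarrow> 'a set \<Rightarrow> 'a set" where
  "R_orb_smult R \<omega> r f = (\<lambda>\<mm> \<in> \<omega>. (\<mm> +>\<^bsub>R\<^esub> r) \<otimes>\<^bsub>R Quot \<mm>\<^esub> f \<mm>)"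

text \<open>The map \<open>\<sigma>\<^sup>d : R\<^sub>\<omega> \<rightarrow> R\<^sub>\<omega>\<close>. The induced isomorphism \<open>R/\<mm> \<rightarrow> R/\<sigma>(\<mm>)\<close> sends the coset
  \<open>r + \<mm>\<close> to its image \<open>\<sigma>(r + \<mm>) = \<sigma>(r) + \<sigma>(\<mm>)\<close>.\<close>

definition R_orb_shift ::
    "('a, 'm) ring_scheme \<Rightarrow> ('a \<Rightarrow> 'a) \<Rightarrow> 'a set set \<Rightarrow> int \<Rightarrow> ('a set \<Rightarrow> 'a set) \<Rightarrow> 'a set \<Rightarrow> 'a set" where
  "R_orb_shift R \<sigma> \<omega> d f = (\<lambda>\<mm> \<in> \<omega>. aut_pow R \<sigma> d ` f (aut_pow R \<sigma> (- d) ` \<mm>))"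


section \<open>Weight modules, admissible forms and the finitistic dual\<close>

definition weight_space ::
    "('a, 'm) ring_scheme \<Rightarrow> ('a \<Rightarrow> 'a) \<Rightarrow> 'a \<Rightarrow> ('a gterm set, 'v) module \<Rightarrow> 'a set \<Rightarrow> 'v set" where
  "weight_space R \<sigma> t V \<mm> =
     {v \<in> carrier V. \<forall>r \<in> \<mm>. gwa_class R \<sigma> t (Scal r) \<odot>\<^bsub>V\<^esub> v = \<zero>\<^bsub>V\<^esub>}"

text \<open>\<open>V\<close> is the internal direct sum of its weight spaces: every vector is in a unique way a finitely
  supported sum of weight vectors.\<close>

definition weight_module ::
    "('a, 'm) ring_scheme \<Rightarrow> ('a \<Rightarrow> 'a) \<Rightarrow> 'a \<Rightarrow> ('a gterm set, 'v) module \<Rightarrow> bool" where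
  "weight_module R \<sigma> t V \<longleftrightarrow> left_module (gwa R \<sigma> t) V \<and>
     (\<forall>v \<in> carrier V. \<exists>!f. f \<in> (\<Pi>\<^sub>E \<mm> \<in> Max_ideals R. weight_space R \<sigma> t V \<mm>) \<and>
        finite {\<mm> \<in> Max_ideals R. f \<mm> \<noteq> \<zero>\<^bsub>V\<^esub>} \<and>
        v = finsum V f {\<mm> \<in> Max_ideals R. f \<mm> \<noteq> \<zero>\<^bsub>V\<^esub>})"

definition weight_support ::
    "('a, 'm) ring_scheme \<Rightarrow> ('a \<Rightarrow> 'a) \<Rightarrow> 'a \<Rightarrow> ('a gterm set, 'v) module \<Rightarrow> 'a set set" where
  "weight_support R \<sigma> t V = {\<mm> \<in> Max_ideals R. weight_space R \<sigma> t V \<mm> \<noteq> {\<zero>\<^bsub>V\<^esub>}}"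

definition admissible_form ::
    "('a, 'm) ring_scheme \<Rightarrow> ('a \<Rightarrow> 'a) \<Rightarrow> ('a \<Rightarrow> 'a) \<Rightarrow> 'a \<Rightarrow> 'a set set \<Rightarrow> ('a gterm set, 'v) module
      \<Rightarrow> ('v \<Rightarrow> 'v \<Rightarrow> 'a set \<Rightarrow> 'a set) \<Rightarrow> bool" where
  "admissible_form R star \<sigma> t \<omega> V F \<longleftrightarrow>
     (\<forall>w \<in> carrier V. (\<lambda>v. F v w) \<in> hom (add_monoid V) (R_orb R \<omega>)) \<and>
     (\<forall>v \<in> carrier V. (\<lambda>w. F v w) \<in> hom (add_monoid V) (R_orb R \<omega>)) \<and>
     (\<forall>r \<in> carrier R. \<forall>v \<in> carrier V. \<forall>w \<in> carrier V.
        F (gwa_class R \<sigma> t (Scal r) \<odot>\<^bsub>V\<^esub> v) w = R_orb_smult R \<omega> r (F v w)) \<and>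
     (\<forall>d. \<forall>a \<in> gwa_component R \<sigma> t d. \<forall>v \<in> carrier V. \<forall>w \<in> carrier V.
        F (a \<odot>\<^bsub>V\<^esub> v) w = R_orb_shift R \<sigma> \<omega> d (F v (gwa_star R star \<sigma> t a \<odot>\<^bsub>V\<^esub> w)))"

definition nondegenerate_form ::
    "('a, 'm) ring_scheme \<Rightarrow> 'a set set \<Rightarrow> ('c, 'v) module \<Rightarrow> ('v \<Rightarrow> 'v \<Rightarrow> 'a set \<Rightarrow> 'a set) \<Rightarrow> bool" where
  "nondegenerate_form R \<omega> V F \<longleftrightarrow>
     (\<forall>v \<in> carrier V. v \<noteq> \<zero>\<^bsub>V\<^esub> \<longrightarrow>
        (\<exists>w1 \<in> carrier V. \<exists>w2 \<in> carrier V. F w1 v \<noteq> \<one>\<^bsub>R_orb R \<omega>\<^esub> \<and> F v w2 \<noteq> \<one>\<^bsub>R_orb R \<omega>\<^esub>))"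

definition pseudo_unitarizable ::
    "('a, 'm) ring_scheme \<Rightarrow> ('a \<Rightarrow> 'a) \<Rightarrow> ('a \<Rightarrow> 'a) \<Rightarrow> 'a \<Rightarrow> 'a set set \<Rightarrow> ('a gterm set, 'v) module
      \<Rightarrow> bool" where
  "pseudo_unitarizable R star \<sigma> t \<omega> V \<longleftrightarrow>
     weight_module R \<sigma> t V \<and> weight_support R \<sigma> t V \<subseteq> \<omega> \<and>
     (\<exists>F. admissible_form R star \<sigma> t \<omega> V F \<and> nondegenerate_form R \<omega> V F)"

definition dual_group ::
    "('a, 'm) ring_scheme \<Rightarrow> ('a \<Rightarrow> 'a) \<Rightarrow> ('a \<Rightarrow> 'a) \<Rightarrow> 'a \<Rightarrow> 'a set set \<Rightarrow> ('a gterm set, 'v) module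
      \<Rightarrow> ('v \<Rightarrow> 'a set \<Rightarrow> 'a set) monoid" where
  "dual_group R star \<sigma> t \<omega> V = \<lparr>carrier = {\<phi> \<in> hom (add_monoid V) (R_orb R \<omega>).
       \<phi> \<in> extensional (carrier V) \<and>
       (\<forall>r \<in> carrier R. \<forall>v \<in> carrier V.
          \<phi> (gwa_class R \<sigma> t (Scal r) \<odot>\<^bsub>V\<^esub> v) = R_orb_smult R \<omega> (star r) (\<phi> v)) \<and>
       finite {\<mm> \<in> \<omega>. \<exists>v \<in> weight_space R \<sigma> t V \<mm>. \<phi> v \<noteq> \<one>\<^bsub>R_orb R \<omega>\<^esub>}},
     monoid.mult = (\<lambda>\<phi> \<psi>. \<lambda>v \<in> carrier V. \<phi> v \<otimes>\<^bsub>R_orb R \<omega>\<^esub> \<psi> v),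
     monoid.one = (\<lambda>v \<in> carrier V. \<one>\<^bsub>R_orb R \<omega>\<^esub>)\<rparr>"

definition finitistic_dual ::
    "('a, 'm) ring_scheme \<Rightarrow> ('a \<Rightarrow> 'a) \<Rightarrow> ('a \<Rightarrow> 'a) \<Rightarrow> 'a \<Rightarrow> 'a set set \<Rightarrow> ('a gterm set, 'v) module
      \<Rightarrow> ('a gterm set, 'v \<Rightarrow> 'a set \<Rightarrow> 'a set) module" where
  "finitistic_dual R star \<sigma> t \<omega> V = gwa_module (dual_group R star \<sigma> t \<omega> V)
     (\<lambda>r \<phi>. \<lambda>v \<in> carrier V. \<phi> (gwa_class R \<sigma> t (Scal (star r)) \<odot>\<^bsub>V\<^esub> v))
     (\<lambda>\<phi>. \<lambda>v \<in> carrier V. R_orb_shift R \<sigma> \<omega> 1 (\<phi> (gwa_class R \<sigma> t GY \<odot>\<^bsub>V\<^esub> v)))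
     (\<lambda>\<phi>. \<lambda>v \<in> carrier V. R_orb_shift R \<sigma> \<omega> (- 1) (\<phi> (gwa_class R \<sigma> t GX \<odot>\<^bsub>V\<^esub> v)))"


section \<open>Words and the cyclic enumeration of the breaks\<close>

datatype letter = Lx | Ly

primrec letter_dagger :: "letter \<Rightarrow> letter" where
  "letter_dagger Lx = Ly"
| "letter_dagger Ly = Lx"

definition dagger :: "letter list \<Rightarrow> letter list" where
  "dagger w = map letter_dagger w"

text \<open>The first break among \<open>\<mm>, \<sigma>(\<mm>), \<sigma>\<^sup>2(\<mm>), \<dots>\<close> (meaningful when the orbit of \<open>\<mm>\<close> is finite and
  contains a break).\<close>

definition first_break :: "('a \<Rightarrow> 'a) \<Rightarrow> 'a \<Rightarrow> 'a set \<Rightarrow> 'a set" where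
  "first_break \<sigma> t \<mm> = ((`) \<sigma> ^^ (LEAST k. t \<in> ((`) \<sigma> ^^ k) \<mm>)) \<mm>"

text \<open>\<open>break_seq \<sigma> t \<mm>\<^sub>0 i\<close> is the break \<open>\<mm>\<^sub>i\<close>; it depends on \<open>i\<close> only modulo the number \<open>m\<close> of breaks.
  Elements of \<open>\<int>/m\<close> are represented by natural numbers, and \<open>break_index\<close> takes its values in
  \<open>{0..<m}\<close>.\<close>

primrec break_seq :: "('a \<Rightarrow> 'a) \<Rightarrow> 'a \<Rightarrow> 'a set \<Rightarrow> nat \<Rightarrow> 'a set" where
  "break_seq \<sigma> t \<mm>0 0 = \<mm>0"
| "break_seq \<sigma> t \<mm>0 (Suc i) = first_break \<sigma> t (\<sigma> ` break_seq \<sigma> t \<mm>0 i)"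

definition break_index :: "('a \<Rightarrow> 'a) \<Rightarrow> 'a \<Rightarrow> 'a set \<Rightarrow> 'a set \<Rightarrow> nat" where
  "break_index \<sigma> t \<mm>0 \<mm> = (LEAST i. break_seq \<sigma> t \<mm>0 i = first_break \<sigma> t \<mm>)"


section \<open>The module \<open>V(\<omega>, i, w)\<close>\<close>

text \<open>The basis vector \<open>[\<mm>, e\<^sub>k]\<close> is indexed by the pair \<open>(\<mm>, k)\<close>. A vector is the family of its
  coordinates, the one at \<open>(\<mm>, k)\<close> lying in \<open>R/\<mm>\<close>.\<close>

definition V_basis ::
    "('a \<Rightarrow> 'a) \<Rightarrow> 'a \<Rightarrow> 'a set set \<Rightarrow> 'a set \<Rightarrow> nat \<Rightarrow> letter list \<Rightarrow> ('a set \<times> nat) set" where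
  "V_basis \<sigma> t \<omega> \<mm>0 i w = {(\<mm>, k). \<mm> \<in> \<omega> \<and> k \<le> length w \<and>
     [i + k = break_index \<sigma> t \<mm>0 \<mm>] (mod card (breaks t \<omega>))}"

definition V_group ::
    "('a, 'm) ring_scheme \<Rightarrow> ('a \<Rightarrow> 'a) \<Rightarrow> 'a \<Rightarrow> 'a set set \<Rightarrow> 'a set \<Rightarrow> nat \<Rightarrow> letter list
      \<Rightarrow> ('a set \<times> nat \<Rightarrow> 'a set) monoid" where
  "V_group R \<sigma> t \<omega> \<mm>0 i w =
     sum_group (V_basis \<sigma> t \<omega> \<mm>0 i w) (\<lambda>(\<mm>, k). add_monoid (R Quot \<mm>))"

text \<open>The vector \<open>c[\<mm>, e\<^sub>k]\<close> for \<open>c \<in> R/\<mm>\<close>; the zero of \<open>R/\<nn>\<close> is the coset \<open>\<nn>\<close>.\<close>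

definition V_single ::
    "('a, 'm) ring_scheme \<Rightarrow> ('a \<Rightarrow> 'a) \<Rightarrow> 'a \<Rightarrow> 'a set set \<Rightarrow> 'a set \<Rightarrow> nat \<Rightarrow> letter list
      \<Rightarrow> 'a set \<Rightarrow> 'a set \<Rightarrow> nat \<Rightarrow> 'a set \<times> nat \<Rightarrow> 'a set" where
  "V_single R \<sigma> t \<omega> \<mm>0 i w c \<mm> k =
     (\<lambda>(\<nn>, l) \<in> V_basis \<sigma> t \<omega> \<mm>0 i w. if \<nn> = \<mm> \<and> l = k then c else \<zero>\<^bsub>R Quot \<nn>\<^esub>)"

text \<open>\<open>X(c[\<mm>, e\<^sub>k]) = \<sigma>(c) X[\<mm>, e\<^sub>k]\<close> and \<open>Y(c[\<mm>, e\<^sub>k]) = \<sigma>\<^sup>-\<^sup>1(c) Y[\<mm>, e\<^sub>k]\<close>. Lists are indexed from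
  \<open>0\<close>, so the letter \<open>z\<^sub>k\<close> of the word \<open>w = z\<^sub>1 \<dots> z\<^sub>n\<close> is \<open>w ! (k - 1)\<close>.\<close>

definition V_X_single ::
    "('a, 'm) ring_scheme \<Rightarrow> ('a \<Rightarrow> 'a) \<Rightarrow> 'a \<Rightarrow> 'a set set \<Rightarrow> 'a set \<Rightarrow> nat \<Rightarrow> letter list
      \<Rightarrow> 'a set \<Rightarrow> 'a set \<Rightarrow> nat \<Rightarrow> 'a set \<times> nat \<Rightarrow> 'a set" where
  "V_X_single R \<sigma> t \<omega> \<mm>0 i w c \<mm> k =
     (if \<mm> \<notin> breaks t \<omega> then
        V_single R \<sigma> t \<omega> \<mm>0 i w (\<sigma> ` c \<otimes>\<^bsub>R Quot (\<sigma> ` \<mm>)\<^esub> \<sigma> ` (\<mm> +>\<^bsub>R\<^esub> t)) (\<sigma> ` \<mm>) k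
      else if k < length w \<and> w ! k = Lx then
        V_single R \<sigma> t \<omega> \<mm>0 i w (\<sigma> ` c) (\<sigma> ` \<mm>) (k + 1)
      else \<one>\<^bsub>V_group R \<sigma> t \<omega> \<mm>0 i w\<^esub>)"

definition V_Y_single ::
    "('a, 'm) ring_scheme \<Rightarrow> ('a \<Rightarrow> 'a) \<Rightarrow> 'a \<Rightarrow> 'a set set \<Rightarrow> 'a set \<Rightarrow> nat \<Rightarrow> letter list
      \<Rightarrow> 'a set \<Rightarrow> 'a set \<Rightarrow> nat \<Rightarrow> 'a set \<times> nat \<Rightarrow> 'a set" where
  "V_Y_single R \<sigma> t \<omega> \<mm>0 i w c \<mm> k =
     (let \<nn> = aut_inv R \<sigma> ` \<mm>; c' = aut_inv R \<sigma> ` c in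
      if \<nn> \<notin> breaks t \<omega> then V_single R \<sigma> t \<omega> \<mm>0 i w c' \<nn> k
      else if 1 \<le> k \<and> w ! (k - 1) = Ly then V_single R \<sigma> t \<omega> \<mm>0 i w c' \<nn> (k - 1)
      else \<one>\<^bsub>V_group R \<sigma> t \<omega> \<mm>0 i w\<^esub>)"

definition V_mod ::
    "('a, 'm) ring_scheme \<Rightarrow> ('a \<Rightarrow> 'a) \<Rightarrow> 'a \<Rightarrow> 'a set set \<Rightarrow> 'a set \<Rightarrow> nat \<Rightarrow> letter list
      \<Rightarrow> ('a gterm set, 'a set \<times> nat \<Rightarrow> 'a set) module" where
  "V_mod R \<sigma> t \<omega> \<mm>0 i w =
     (let B = V_basis \<sigma> t \<omega> \<mm>0 i w; G = V_group R \<sigma> t \<omega> \<mm>0 i w in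
      gwa_module G
        (\<lambda>r v. \<lambda>(\<mm>, k) \<in> B. (\<mm> +>\<^bsub>R\<^esub> r) \<otimes>\<^bsub>R Quot \<mm>\<^esub> v (\<mm>, k))
        (\<lambda>v. gfinprod G (\<lambda>(\<mm>, k). V_X_single R \<sigma> t \<omega> \<mm>0 i w (v (\<mm>, k)) \<mm> k) B)
        (\<lambda>v. gfinprod G (\<lambda>(\<mm>, k). V_Y_single R \<sigma> t \<omega> \<mm>0 i w (v (\<mm>, k)) \<mm> k) B))"

end

theory Submission
  imports Defs
begin

text \<open>The basis vectors \<open>[\<mm>, e\<^sub>k]\<close> form a single string: applying \<open>\<sigma>\<close> to \<open>\<mm>\<close>, and raising \<open>k\<close> at each
  break, leads from the unique start \<open>[\<sigma>(\<mm>\<^sub>i\<^sub>-\<^sub>1), e\<^sub>0]\<close> to the unique end \<open>[\<mm>\<^sub>i\<^sub>+\<^sub>n, e\<^sub>n]\<close>, \<open>X\<close> and \<open>Y\<close>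
  moving forward and backward along it with certain scalars. For a real orbit a functional in the
  finitistic dual is given by its values on the basis, and passing to the dual basis
  interchanges the roles of \<open>X\<close> and \<open>Y\<close> at the breaks. Away from the breaks the scalars disagree by
  factors \<open>t\<close>, which a rescaling along the string absorbs; hence the dual belongs to the dagger word.

  For the empty word this isomorphism is a form. Conversely, a non-degenerate form embeds
  \<open>V(\<omega>, i, w)\<close> into its dual, that is into \<open>V(\<omega>, i, w\<^sup>\<dagger>)\<close>, and the embedding is onto by a length
  argument. If \<open>w\<close> is not empty this contradicts the fact that the first letter of a word is an
  isomorphism invariant. A non-empty word also gives a proper submodule, spanned by the \<open>[\<mm>, e\<^sub>k]\<close> with
  \<open>k > 0\<close> or by those with \<open>k = 0\<close> according to its first letter; for the empty word powers of \<open>Y\<close> and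
  then of \<open>X\<close> isolate every basis vector from any nonzero vector.\<close>

section \<open>The generalized Weyl algebra and its modules\<close>

text \<open>No normal form of elements of A is used: modules are checked on the defining relations,
  isomorphisms on R and the two generators. Rescaling is possible because the basis is a string and
  not a cycle: each scalar t met away from a break is a unit of the residue field, the factors are
  multiplied up from the start, and no closing condition arises. Reality of the orbit enters where a
  functional, known only to be star-semilinear, has to map the weight space of \<mm> into the
  summand R/\<mm>. Since the residue fields vary with the ideal, there is no dimension over one
  field to make the injective map induced by a form bijective; the last nonzero positions of
  vectors, in the order of the string, take its place. The dagger changes every letter, so the first
  one alone separates the two modules. It is read off by comparing X^(q+1)(ker Y) with X^(q+2)V,
  where q is the position of the first break on the string: the former lies in the latter exactly
  when the first letter of the nonempty word is y.\<close>

locale gwa_data = R?: cring R for R :: "('a, 'm) ring_scheme" (structure) and \<sigma> :: "'a \<Rightarrow> 'a" and t :: 'a +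
  assumes sigma_iso: "\<sigma> \<in> ring_iso R R" and t_closed: "t \<in> carrier R"
begin

abbreviation tau where "tau \<equiv> aut_inv R \<sigma>"
abbreviation A where "A \<equiv> gwa R \<sigma> t"
abbreviation cls where "cls \<equiv> gwa_class R \<sigma> t"

lemma tau_iso: "tau \<in> ring_iso R R"
  unfolding aut_inv_def by (rule ring_iso_set_sym[OF R.ring_axioms sigma_iso])

lemmas sigma_simps [simp] = ring_iso_memE(1-4)[OF sigma_iso]
lemmas tau_simps [simp] = ring_iso_memE(1-4)[OF tau_iso]

lemma tau_sigma [simp]: "r \<in> carrier R \<Longrightarrow> tau (\<sigma> r) = r"
  using ring_iso_memE(5)[OF sigma_iso] by (simp add: aut_inv_def bij_betw_inv_into_left)

lemma sigma_tau [simp]: "r \<in> carrier R \<Longrightarrow> \<sigma> (tau r) = r"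
  using ring_iso_memE(5)[OF sigma_iso] by (simp add: aut_inv_def bij_betw_inv_into_right)

lemma gwa_eq_gterms: "gwa_eq R \<sigma> t a b \<Longrightarrow> a \<in> gterms R \<and> b \<in> gterms R"
  by (induction rule: gwa_eq.induct) (simp_all add: gterms.intros t_closed)

lemma gterm_homogeneous_gterms: "gterm_homogeneous R a d \<Longrightarrow> a \<in> gterms R"
  by (induction rule: gterm_homogeneous.induct) (auto intro: gterms.intros)

lemma cls_eq_iff: "a \<in> gterms R \<Longrightarrow> cls a = cls b \<longleftrightarrow> gwa_eq R \<sigma> t a b"
  unfolding gwa_class_def
  by (auto intro: gwa_refl gwa_trans dest: gwa_sym gwa_trans)

lemma cls_eqI: "gwa_eq R \<sigma> t a b \<Longrightarrow> cls a = cls b"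
  using cls_eq_iff gwa_eq_gterms by blast

text \<open>The operations of \<open>gwa\<close> are unions over representatives. For a constructor
  that respects the congruence all united classes coincide; the lemma serves \<open>GAdd\<close> and
  \<open>GMul\<close> alike.\<close>

lemma Union_cls2:
  assumes "a \<in> gterms R" "b \<in> gterms R"
    and "\<And>a' b'. gwa_eq R \<sigma> t a a' \<Longrightarrow> gwa_eq R \<sigma> t b b' \<Longrightarrow> gwa_eq R \<sigma> t (f a b) (f a' b')"
  shows "(\<Union>a' \<in> cls a. \<Union>b' \<in> cls b. cls (f a' b')) = cls (f a b)"
proof -
  have "cls (f a' b') = cls (f a b)" if "a' \<in> cls a" "b' \<in> cls b" for a' b'
    using that assms(3) by (metis cls_eqI gwa_class_def mem_Collect_eq)
  moreover have "a \<in> cls a" "b \<in> cls b"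
    using assms by (auto simp: gwa_class_def gwa_refl)
  ultimately show ?thesis by blast
qed

lemma carrier_gwa: "carrier A = cls ` gterms R"
  by (simp add: gwa_def)

lemma gwa_mult: "a \<in> gterms R \<Longrightarrow> b \<in> gterms R \<Longrightarrow> cls a \<otimes>\<^bsub>A\<^esub> cls b = cls (GMul a b)"
  by (simp add: gwa_def Union_cls2 gwa_cong_mul)

lemma gwa_add: "a \<in> gterms R \<Longrightarrow> b \<in> gterms R \<Longrightarrow> cls a \<oplus>\<^bsub>A\<^esub> cls b = cls (GAdd a b)"
  by (simp add: gwa_def Union_cls2 gwa_cong_add)

lemma gwa_one: "\<one>\<^bsub>A\<^esub> = cls (Scal \<one>)"
  by (simp add: gwa_def)

lemma gwa_zero: "\<zero>\<^bsub>A\<^esub> = cls (Scal \<zero>)"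
  by (simp add: gwa_def)

lemma ring_gwa: "ring A"
proof (intro ringI abelian_groupI monoidI)
  fix x assume "x \<in> carrier A"
  then obtain a where a: "a \<in> gterms R" "x = cls a" by (auto simp: carrier_gwa)
  have "cls (GNeg a) \<oplus>\<^bsub>A\<^esub> x = \<zero>\<^bsub>A\<^esub>"
    using a by (simp add: gwa_add gwa_zero gterms.intros cls_eqI gwa_add_neg)
  then show "\<exists>y\<in>carrier A. y \<oplus>\<^bsub>A\<^esub> x = \<zero>\<^bsub>A\<^esub>"
    using a by (auto simp: carrier_gwa intro: gterms.intros)
qed (auto simp: carrier_gwa gwa_mult gwa_add gwa_one gwa_zero gterms.intros cls_eq_iff
    del: equalityI intro!: imageI intro: gwa_add_assoc gwa_add_comm gwa_add_zero gwa_mul_assoc gwa_mul_one_l gwa_mul_one_r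
    gwa_distrib_l gwa_distrib_r)

end

section \<open>From operators satisfying the defining relations to modules over the algebra\<close>

lemma carrier_gwa_module [simp]: "carrier (gwa_module G \<rho> fX fY) = carrier G"
  and zero_gwa_module [simp]: "\<zero>\<^bsub>gwa_module G \<rho> fX fY\<^esub> = \<one>\<^bsub>G\<^esub>"
  and add_gwa_module [simp]: "x \<oplus>\<^bsub>gwa_module G \<rho> fX fY\<^esub> y = x \<otimes>\<^bsub>G\<^esub> y"
  by (simp_all add: gwa_module_def)

lemma hom_add_monoid_gwa_module: "hom (add_monoid (gwa_module G \<rho> fX fY)) H = hom G H"
  by (simp add: hom_def gwa_module_def)

locale gwa_rep = gwa_data R \<sigma> t + G: comm_group G
  for R :: "('a, 'm) ring_scheme" (structure) and \<sigma> :: "'a \<Rightarrow> 'a" and t :: 'a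
    and G :: "'v monoid" +
  fixes \<rho> :: "'a \<Rightarrow> 'v \<Rightarrow> 'v" and fX fY :: "'v \<Rightarrow> 'v"
  assumes rho_hom: "r \<in> carrier R \<Longrightarrow> \<rho> r \<in> hom G G"
    and X_hom: "fX \<in> hom G G" and Y_hom: "fY \<in> hom G G"
    and rho_add: "\<lbrakk>r \<in> carrier R; s \<in> carrier R; v \<in> carrier G\<rbrakk> \<Longrightarrow> \<rho> (r \<oplus>\<^bsub>R\<^esub> s) v = \<rho> r v \<otimes>\<^bsub>G\<^esub> \<rho> s v"
    and rho_mult: "\<lbrakk>r \<in> carrier R; s \<in> carrier R; v \<in> carrier G\<rbrakk> \<Longrightarrow> \<rho> (r \<otimes>\<^bsub>R\<^esub> s) v = \<rho> r (\<rho> s v)"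
    and rho_one: "v \<in> carrier G \<Longrightarrow> \<rho> \<one>\<^bsub>R\<^esub> v = v"
    and YX: "v \<in> carrier G \<Longrightarrow> fY (fX v) = \<rho> t v"
    and XY: "v \<in> carrier G \<Longrightarrow> fX (fY v) = \<rho> (\<sigma> t) v"
    and X_rho: "\<lbrakk>r \<in> carrier R; v \<in> carrier G\<rbrakk> \<Longrightarrow> fX (\<rho> r v) = \<rho> (\<sigma> r) (fX v)"
    and Y_rho: "\<lbrakk>r \<in> carrier R; v \<in> carrier G\<rbrakk> \<Longrightarrow> fY (\<rho> r v) = \<rho> (aut_inv R \<sigma> r) (fY v)"
begin

abbreviation M where "M \<equiv> gwa_module G \<rho> fX fY"
abbreviation act where "act \<equiv> gterm_act G \<rho> fX fY"

lemma act_hom: "a \<in> gterms R \<Longrightarrow> act a \<in> hom G G"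
proof (induction rule: gterms.induct)
  case (4 a)
  then show ?case
    by (auto simp: hom_def Pi_iff G.inv_mult)
next
  case (5 a b)
  then show ?case
    by (auto simp: hom_def Pi_iff G.m_ac)
next
  case (6 a b)
  then show ?case by (auto simp: hom_def Pi_iff)
qed (auto simp: rho_hom X_hom Y_hom)

lemma act_closed [simp]: "a \<in> gterms R \<Longrightarrow> v \<in> carrier G \<Longrightarrow> act a v \<in> carrier G"
  using act_hom by (auto simp: hom_def Pi_iff)

lemma act_mult: "a \<in> gterms R \<Longrightarrow> v \<in> carrier G \<Longrightarrow> w \<in> carrier G
    \<Longrightarrow> act a (v \<otimes>\<^bsub>G\<^esub> w) = act a v \<otimes>\<^bsub>G\<^esub> act a w"
  using act_hom by (auto simp: hom_def)

lemma rho_closed [simp]: "r \<in> carrier R \<Longrightarrow> v \<in> carrier G \<Longrightarrow> \<rho> r v \<in> carrier G"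
  using rho_hom by (auto simp: hom_def Pi_iff)

lemma X_closed [simp]: "v \<in> carrier G \<Longrightarrow> fX v \<in> carrier G"
  using X_hom by (auto simp: hom_def Pi_iff)

lemma Y_closed [simp]: "v \<in> carrier G \<Longrightarrow> fY v \<in> carrier G"
  using Y_hom by (auto simp: hom_def Pi_iff)

lemma rho_zero: "v \<in> carrier G \<Longrightarrow> \<rho> \<zero> v = \<one>\<^bsub>G\<^esub>"
  using rho_add[of \<zero> \<zero> v] G.r_cancel_one'[of "\<rho> \<zero> v" "\<rho> \<zero> v"] by simp

text \<open>Makes the arbitrary choice of a representative in \<open>gwa_module\<close> harmless:
  the two sides of each generating rule act alike, and this passes through the congruence
  rules.\<close>

lemma act_cong: "gwa_eq R \<sigma> t a b \<Longrightarrow> v \<in> carrier G \<Longrightarrow> act a v = act b v"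
proof (induction arbitrary: v rule: gwa_eq.induct)
  case (gwa_cong_mul a a' b b')
  then show ?case using gwa_eq_gterms by force
next
  case (gwa_add_neg a)
  then show ?case by (simp add: rho_zero)
next
  case (gwa_distrib_l a b c)
  then show ?case by (simp add: act_mult)
next
  case (gwa_add_comm a b)
  then show ?case by (simp add: G.m_comm)
qed (auto simp: G.m_assoc rho_zero rho_one rho_add rho_mult YX XY X_rho Y_rho)

lemma smult_cls: "a \<in> gterms R \<Longrightarrow> v \<in> carrier G \<Longrightarrow> cls a \<odot>\<^bsub>M\<^esub> v = act a v"
proof -
  assume a: "a \<in> gterms R" "v \<in> carrier G"
  have "(SOME b. b \<in> cls a) \<in> cls a"
    by (rule someI[of _ a]) (simp add: gwa_class_def gwa_refl a)
  then have "act a v = act (SOME b. b \<in> cls a) v"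
    by (intro act_cong a) (simp add: gwa_class_def)
  then show ?thesis by (simp add: gwa_module_def)
qed

lemma smult_gen [simp]:
  assumes "v \<in> carrier G"
  shows "r \<in> carrier R \<Longrightarrow> cls (Scal r) \<odot>\<^bsub>M\<^esub> v = \<rho> r v"
    and "cls GX \<odot>\<^bsub>M\<^esub> v = fX v"
    and "cls GY \<odot>\<^bsub>M\<^esub> v = fY v"
  using assms by (simp_all add: smult_cls gterms.intros)

lemma left_module: "left_module A M"
proof -
  interpret ring A by (rule ring_gwa)
  have "comm_group (add_monoid M)"
    by (rule comm_groupI) (auto simp: G.m_ac intro: G.l_inv G.inv_closed)
  then have "abelian_group M" by (rule comm_group_abelian_groupI)
  then show ?thesis
    unfolding left_module_def left_module_axioms_def
    by (auto simp: ring_axioms carrier_gwa smult_cls gwa_add gwa_mult gwa_one gterms.intros act_mult rho_one)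
qed

end

text \<open>On \<open>H\<close> only closure is assumed. The group laws and the defining relations
  are pulled back along the bijection \<open>\<theta>\<close>, which spares a direct proof that the
  finitistic dual is an A-module.\<close>

locale gwa_rep_iso = G: gwa_rep R \<sigma> t G \<rho> fX fY
  for R :: "('a, 'm) ring_scheme" (structure) and \<sigma> :: "'a \<Rightarrow> 'a" and t :: 'a
    and G :: "'v monoid" and \<rho> fX fY +
  fixes H :: "'u monoid" and \<rho>' :: "'a \<Rightarrow> 'u \<Rightarrow> 'u" and gX gY :: "'u \<Rightarrow> 'u" and \<theta> :: "'u \<Rightarrow> 'v"
  assumes H_mult: "\<lbrakk>x \<in> carrier H; y \<in> carrier H\<rbrakk> \<Longrightarrow> x \<otimes>\<^bsub>H\<^esub> y \<in> carrier H"
    and H_one: "\<one>\<^bsub>H\<^esub> \<in> carrier H"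
    and H_rho: "\<lbrakk>r \<in> carrier R; x \<in> carrier H\<rbrakk> \<Longrightarrow> \<rho>' r x \<in> carrier H"
    and H_X: "x \<in> carrier H \<Longrightarrow> gX x \<in> carrier H"
    and H_Y: "x \<in> carrier H \<Longrightarrow> gY x \<in> carrier H"
    and theta_bij: "bij_betw \<theta> (carrier H) (carrier G)"
    and theta_mult: "\<lbrakk>x \<in> carrier H; y \<in> carrier H\<rbrakk> \<Longrightarrow> \<theta> (x \<otimes>\<^bsub>H\<^esub> y) = \<theta> x \<otimes>\<^bsub>G\<^esub> \<theta> y"
    and theta_rho: "\<lbrakk>r \<in> carrier R; x \<in> carrier H\<rbrakk> \<Longrightarrow> \<theta> (\<rho>' r x) = \<rho> r (\<theta> x)"
    and theta_X: "x \<in> carrier H \<Longrightarrow> \<theta> (gX x) = fX (\<theta> x)"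
    and theta_Y: "x \<in> carrier H \<Longrightarrow> \<theta> (gY x) = fY (\<theta> x)"
    and theta_one: "\<theta> \<one>\<^bsub>H\<^esub> = \<one>\<^bsub>G\<^esub>"
begin

lemma theta_closed [simp]: "x \<in> carrier H \<Longrightarrow> \<theta> x \<in> carrier G"
  using theta_bij by (auto simp: bij_betw_def)

lemma theta_inj: "x \<in> carrier H \<Longrightarrow> y \<in> carrier H \<Longrightarrow> \<theta> x = \<theta> y \<Longrightarrow> x = y"
  using theta_bij by (auto simp: bij_betw_def inj_on_def)

lemma theta_surj: "v \<in> carrier G \<Longrightarrow> \<exists>x \<in> carrier H. \<theta> x = v"
  using theta_bij by (force simp: bij_betw_def)

lemma gwa_rep_H: "gwa_rep R \<sigma> t H \<rho>' gX gY"
proof -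
  have cg: "comm_group H"
  proof (rule comm_groupI)
    fix x assume x: "x \<in> carrier H"
    then obtain y where "y \<in> carrier H" "\<theta> y = inv\<^bsub>G\<^esub> (\<theta> x)"
      using theta_surj by (meson G.G.inv_closed theta_closed)
    then show "\<exists>y\<in>carrier H. y \<otimes>\<^bsub>H\<^esub> x = \<one>\<^bsub>H\<^esub>"
      using x by (intro bexI[of _ y] theta_inj) (auto simp: theta_mult H_mult H_one theta_one)
  qed (auto intro!: theta_inj simp: theta_mult H_mult H_one theta_one G.G.m_ac)
  show ?thesis
    by (intro gwa_rep.intro gwa_rep_axioms.intro cg G.gwa_data_axioms)
      (auto simp: hom_def Pi_iff H_mult H_one H_rho H_X H_Y theta_mult theta_rho theta_X theta_Y
        G.rho_add G.rho_mult G.rho_one G.YX G.XY G.X_rho G.Y_rho G.t_closed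
        G.X_hom[unfolded hom_def, simplified] G.Y_hom[unfolded hom_def, simplified]
        G.rho_hom[unfolded hom_def, simplified]
        intro!: theta_inj)
qed

sublocale H: gwa_rep R \<sigma> t H \<rho>' gX gY
  by (rule gwa_rep_H)

lemma group_hom_theta: "group_hom H G \<theta>"
  by (intro group_hom.intro group_hom_axioms.intro homI) (auto simp: theta_mult)

lemma theta_act:
  "a \<in> gterms R \<Longrightarrow> x \<in> carrier H \<Longrightarrow> \<theta> (gterm_act H \<rho>' gX gY a x) = gterm_act G \<rho> fX fY a (\<theta> x)"
  by (induction arbitrary: x rule: gterms.induct)
    (auto simp: theta_mult theta_rho theta_X theta_Y group_hom.hom_inv[OF group_hom_theta])

lemma isomorphic: "isomorphic_modules G.A (gwa_module H \<rho>' gX gY) (gwa_module G \<rho> fX fY)"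
  unfolding isomorphic_modules_def
proof (intro conjI bexI[of _ \<theta>] ballI)
  fix a v assume "a \<in> carrier G.A" "v \<in> carrier (gwa_module H \<rho>' gX gY)"
  then show "\<theta> (a \<odot>\<^bsub>gwa_module H \<rho>' gX gY\<^esub> v) = a \<odot>\<^bsub>gwa_module G \<rho> fX fY\<^esub> \<theta> v"
    by (auto simp: G.carrier_gwa G.smult_cls H.smult_cls theta_act)
qed (auto simp: G.left_module H.left_module iso_def hom_def theta_mult theta_bij)

end

section \<open>Orbits of maximal ideals and their breaks\<close>

context ring
begin

lemma quot_rep: "c \<in> carrier (R Quot I) \<longleftrightarrow> (\<exists>r \<in> carrier R. c = I +> r)"
  by (auto simp: FactRing_def A_RCOSETS_def')

lemma quot_coset [simp]: "r \<in> carrier R \<Longrightarrow> I +> r \<in> carrier (R Quot I)"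
  using quot_rep by blast

lemma quot_simps:
  assumes "ideal I R" "r \<in> carrier R" "s \<in> carrier R"
  shows "(I +> r) \<otimes>\<^bsub>R Quot I\<^esub> (I +> s) = I +> (r \<otimes> s)"
    and "(I +> r) \<oplus>\<^bsub>R Quot I\<^esub> (I +> s) = I +> (r \<oplus> s)"
    and "\<one>\<^bsub>R Quot I\<^esub> = I +> \<one>"
    and "\<zero>\<^bsub>R Quot I\<^esub> = I +> \<zero>"
    and "\<zero>\<^bsub>R Quot I\<^esub> = I"
proof -
  interpret ideal I R by fact
  show "(I +> r) \<otimes>\<^bsub>R Quot I\<^esub> (I +> s) = I +> (r \<otimes> s)"
    and "(I +> r) \<oplus>\<^bsub>R Quot I\<^esub> (I +> s) = I +> (r \<oplus> s)"
    using ring_hom_mult[OF rcos_ring_hom assms(2,3)] ring_hom_add[OF rcos_ring_hom assms(2,3)] by auto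
  show "\<one>\<^bsub>R Quot I\<^esub> = I +> \<one>" "\<zero>\<^bsub>R Quot I\<^esub> = I"
    by (auto simp: FactRing_def)
  show "\<zero>\<^bsub>R Quot I\<^esub> = I +> \<zero>"
    by (simp add: FactRing_def a_coset_add_zero a_subset)
qed

lemma quot_coset_eq_zero:
  assumes "ideal I R" "r \<in> carrier R"
  shows "I +> r = \<zero>\<^bsub>R Quot I\<^esub> \<longleftrightarrow> r \<in> I"
proof -
  interpret ideal I R by fact
  show ?thesis
    using assms a_rcos_const a_rcos_self by (auto simp: FactRing_def)
qed

lemma image_coset:
  assumes "h \<in> ring_hom R R" "I \<subseteq> carrier R" "r \<in> carrier R"
  shows "h ` (I +> r) = h ` I +> h r"
proof -
  have "h (x \<oplus> r) = h x \<oplus> h r" if "x \<in> I" for x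
    using assms that by (intro ring_hom_add) auto
  then have "h ` ((\<lambda>x. x \<oplus> r) ` I) = (\<lambda>x. x \<oplus> h r) ` h ` I"
    unfolding image_image by (rule image_cong[OF refl])
  moreover have "J +> s = (\<lambda>x. x \<oplus> s) ` J" for J s
    by (auto simp: a_r_coset_def')
  ultimately show ?thesis by simp
qed

text \<open>One source for all induced maps between residue rings: those of \<sigma>, of its
  inverse, of its powers and of the involution.\<close>

lemma image_quot_hom:
  assumes "h \<in> ring_hom R R" "ideal I R" "ideal (h ` I) R"
  shows "(`) h \<in> ring_hom (R Quot I) (R Quot (h ` I))"
proof -
  have I: "I \<subseteq> carrier R"
    using assms(2) by (simp add: additive_subgroup.a_subset ideal_def)
  note hom = ring_hom_closed[OF assms(1)] ring_hom_mult[OF assms(1)] ring_hom_add[OF assms(1)]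
    ring_hom_one[OF assms(1)] image_coset[OF assms(1) I]
  show ?thesis
  proof (rule ring_hom_memI)
    fix c assume "c \<in> carrier (R Quot I)"
    then obtain r where r: "r \<in> carrier R" "c = I +> r" by (auto simp: quot_rep)
    then show "h ` c \<in> carrier (R Quot (h ` I))" by (simp add: hom)
    fix d assume "d \<in> carrier (R Quot I)"
    then obtain s where s: "s \<in> carrier R" "d = I +> s" by (auto simp: quot_rep)
    show "h ` (c \<otimes>\<^bsub>R Quot I\<^esub> d) = h ` c \<otimes>\<^bsub>R Quot (h ` I)\<^esub> h ` d"
      "h ` (c \<oplus>\<^bsub>R Quot I\<^esub> d) = h ` c \<oplus>\<^bsub>R Quot (h ` I)\<^esub> h ` d"
      using r s by (simp_all add: hom quot_simps[OF assms(2)] quot_simps[OF assms(3)])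
  next
    show "h ` \<one>\<^bsub>R Quot I\<^esub> = \<one>\<^bsub>R Quot (h ` I)\<^esub>"
      by (simp add: hom quot_simps(3)[OF assms(2) one_closed one_closed]
          quot_simps(3)[OF assms(3) one_closed one_closed])
  qed
qed

text \<open>As \<open>g\<close> inverts \<open>h\<close>, the image under \<open>h\<close> is a
  preimage under \<open>g\<close>, hence an ideal. A larger ideal \<open>J\<close> is pulled back
  along \<open>h\<close> and compared with \<open>I\<close> there.\<close>

lemma maximalideal_image:
  assumes hom: "h \<in> ring_hom R R" "g \<in> ring_hom R R"
    and inv: "\<And>r. r \<in> carrier R \<Longrightarrow> g (h r) = r" "\<And>r. r \<in> carrier R \<Longrightarrow> h (g r) = r"
    and max: "maximalideal I R"
  shows "maximalideal (h ` I) R"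
proof -
  interpret I: maximalideal I R by fact
  have vimage: "ideal {r \<in> carrier R. f r \<in> J} R" if "f \<in> ring_hom R R" "ideal J R" for f J
    using ring_hom_ring.ideal_vimage[OF ring_hom_ringI2[OF ring_axioms ring_axioms that(1)] that(2)]
    by simp
  note cl [simp] = ring_hom_closed[OF hom(1)] ring_hom_closed[OF hom(2)]
  have hI: "h ` I = {r \<in> carrier R. g r \<in> I}"
  proof
    show "{r \<in> carrier R. g r \<in> I} \<subseteq> h ` I"
    proof
      fix r assume "r \<in> {r \<in> carrier R. g r \<in> I}"
      then show "r \<in> h ` I" using inv(2)[of r] by (intro image_eqI[of _ _ "g r"]) auto
    qed
    show "h ` I \<subseteq> {r \<in> carrier R. g r \<in> I}"
      using inv(1) I.a_subset by auto
  qed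
  show ?thesis
  proof (rule maximalidealI)
    show "ideal (h ` I) R"
      unfolding hI by (rule vimage[OF hom(2) I.is_ideal])
    show "carrier R \<noteq> h ` I"
    proof
      assume "carrier R = h ` I"
      then have "g (h r) \<in> I" if "r \<in> carrier R" for r
        using that cl hI by blast
      then show False
        using I.I_notcarr I.a_subset inv by auto
    qed
    fix J assume J: "ideal J R" "h ` I \<subseteq> J" "J \<subseteq> carrier R"
    have "I \<subseteq> {r \<in> carrier R. h r \<in> J}"
      using J I.a_subset by auto
    with I.I_maximal[OF vimage[OF hom(1) J(1)]]
    have "{r \<in> carrier R. h r \<in> J} = I \<or> {r \<in> carrier R. h r \<in> J} = carrier R" by auto
    moreover have "J = h ` {r \<in> carrier R. h r \<in> J}"
    proof
      show "J \<subseteq> h ` {r \<in> carrier R. h r \<in> J}"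
      proof
        fix r assume "r \<in> J"
        then show "r \<in> h ` {r \<in> carrier R. h r \<in> J}"
          using J(3) inv(2)[of r] by (intro image_eqI[of _ _ "g r"]) auto
      qed
    qed auto
    moreover have "h ` carrier R = carrier R"
    proof
      show "carrier R \<subseteq> h ` carrier R"
      proof
        fix r assume "r \<in> carrier R"
        then show "r \<in> h ` carrier R" using inv(2)[of r] by (intro image_eqI[of _ _ "g r"]) auto
      qed
    qed auto
    ultimately show "J = h ` I \<or> J = carrier R" by metis
  qed
qed

end

section \<open>Integer powers of the automorphism\<close>

context gwa_data
begin

lemma aut_pow_closed [simp]: "r \<in> carrier R \<Longrightarrow> aut_pow R \<sigma> d r \<in> carrier R"
proof -
  have "(\<sigma> ^^ n) r \<in> carrier R" "(tau ^^ n) r \<in> carrier R" if "r \<in> carrier R" for n r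
    by (induction n) (auto simp: that)
  then show "r \<in> carrier R \<Longrightarrow> aut_pow R \<sigma> d r \<in> carrier R"
    by (simp add: aut_pow_def)
qed

lemma aut_pow_0 [simp]: "aut_pow R \<sigma> 0 r = r"
  and aut_pow_1 [simp]: "aut_pow R \<sigma> 1 r = \<sigma> r"
  and aut_pow_minus_1 [simp]: "aut_pow R \<sigma> (- 1) r = tau r"
  by (simp_all add: aut_pow_def)

lemma aut_pow_plus_1: "r \<in> carrier R \<Longrightarrow> aut_pow R \<sigma> (d + 1) r = \<sigma> (aut_pow R \<sigma> d r)"
proof (cases "0 \<le> d")
  case True
  then show ?thesis by (simp add: aut_pow_def nat_add_distrib)
next
  case False
  assume r: "r \<in> carrier R"
  \<comment> \<open>The exponent is negative here; one factor \<open>tau\<close> is split off for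
    \<sigma> to cancel.\<close>
  obtain n where n: "d = - int (Suc n)"
    using False by (intro that[of "nat (- d - 1)"]) simp
  have "(tau ^^ n) r = aut_pow R \<sigma> (- int n) r"
    by (cases "n = 0") (simp_all add: aut_pow_def)
  moreover from this have "(tau ^^ n) r \<in> carrier R" using r by simp
  moreover have "aut_pow R \<sigma> d r = tau ((tau ^^ n) r)"
  proof -
    have "nat (- d) = Suc n" using n by linarith
    then show ?thesis using False by (simp only: aut_pow_def) simp
  qed
  moreover have "d + 1 = - int n" using n by simp
  ultimately show ?thesis by simp
qed

lemma aut_pow_minus_1': "r \<in> carrier R \<Longrightarrow> aut_pow R \<sigma> (d - 1) r = tau (aut_pow R \<sigma> d r)"
  using aut_pow_plus_1[of r "d - 1"] by simp

lemma aut_pow_add: "r \<in> carrier R \<Longrightarrow> aut_pow R \<sigma> (d + e) r = aut_pow R \<sigma> d (aut_pow R \<sigma> e r)"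
proof (induction d rule: int_induct[where k = 0])
  case base then show ?case by simp
next
  case (step1 d)
  then show ?case
    using aut_pow_plus_1[of r "d + e"] aut_pow_plus_1[of "aut_pow R \<sigma> e r" d] by (simp add: algebra_simps)
next
  case (step2 d)
  then show ?case
    using aut_pow_minus_1'[of r "d + e"] aut_pow_minus_1'[of "aut_pow R \<sigma> e r" d] by (simp add: algebra_simps)
qed

lemma image_aut_pow_add:
  "S \<subseteq> carrier R \<Longrightarrow> aut_pow R \<sigma> (d + e) ` S = aut_pow R \<sigma> d ` aut_pow R \<sigma> e ` S"
  unfolding image_image by (rule image_cong) (auto simp: aut_pow_add)

lemma tau_image_sigma [simp]: "S \<subseteq> carrier R \<Longrightarrow> tau ` \<sigma> ` S = S"
  and sigma_image_tau [simp]: "S \<subseteq> carrier R \<Longrightarrow> \<sigma> ` tau ` S = S"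
proof -
  assume "S \<subseteq> carrier R"
  then have "tau (\<sigma> r) = r" "\<sigma> (tau r) = r" if "r \<in> S" for r using that by auto
  then show "tau ` \<sigma> ` S = S" "\<sigma> ` tau ` S = S" by (simp_all add: image_image)
qed

lemma sigma_hom: "\<sigma> \<in> ring_hom R R" and tau_hom: "tau \<in> ring_hom R R"
  using sigma_iso tau_iso by (auto simp: ring_iso_def)

lemma aut_pow_hom: "aut_pow R \<sigma> d \<in> ring_hom R R"
proof -
  have "(\<forall>r\<in>carrier R. \<forall>s\<in>carrier R.
      aut_pow R \<sigma> d (r \<otimes> s) = aut_pow R \<sigma> d r \<otimes> aut_pow R \<sigma> d s \<and>
      aut_pow R \<sigma> d (r \<oplus> s) = aut_pow R \<sigma> d r \<oplus> aut_pow R \<sigma> d s) \<and> aut_pow R \<sigma> d \<one> = \<one>"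
  proof (induction d rule: int_induct[where k = 0])
    case (step1 d)
    then show ?case by (simp add: aut_pow_plus_1)
  next
    case (step2 d)
    then show ?case by (simp add: aut_pow_minus_1')
  qed simp
  then show ?thesis by (intro ring_hom_memI) auto
qed

end

section \<open>A finite orbit with a break, traversed by positive powers\<close>

locale break_orbit = gwa_data +
  fixes \<omega> :: "'a set set" and \<mm>0 :: "'a set"
  assumes orbit: "\<omega> \<in> ideal_orbits R \<sigma>" and fin: "finite \<omega>" and m0: "\<mm>0 \<in> breaks t \<omega>"
begin

lemma m0_orbit: "\<mm>0 \<in> \<omega>"
  using m0 by (simp add: breaks_def)

lemma orbit_max_closed:
  assumes "\<mm> \<in> \<omega>"
  shows orbit_max: "maximalideal \<mm> R" and sigma_orbit: "\<sigma> ` \<mm> \<in> \<omega>" and tau_orbit: "tau ` \<mm> \<in> \<omega>"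
    and orbit_pow: "\<nn> \<in> \<omega> \<Longrightarrow> \<exists>d. \<nn> = aut_pow R \<sigma> d ` \<mm>"
proof -
  obtain x where x: "maximalideal x R" "\<omega> = {aut_pow R \<sigma> d ` x |d. True}"
    using orbit by (auto simp: ideal_orbits_def orbits_def orbit_def Max_ideals_def integer_group_def)
  have sub: "x \<subseteq> carrier R"
    using x(1) by (simp add: additive_subgroup.a_subset ideal_def maximalideal_def)
  have sub': "aut_pow R \<sigma> d ` x \<subseteq> carrier R" for d using sub by auto
  have plus: "\<sigma> ` aut_pow R \<sigma> d ` x = aut_pow R \<sigma> (d + 1) ` x" for d
    using image_aut_pow_add[OF sub, of 1 d] by (simp add: add.commute cong: image_cong_simp)
  have minus: "tau ` aut_pow R \<sigma> d ` x = aut_pow R \<sigma> (d - 1) ` x" for d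
    using image_aut_pow_add[OF sub, of "- 1" d] by (simp cong: image_cong_simp)
  have "maximalideal (aut_pow R \<sigma> d ` x) R" for d
  proof (induction d rule: int_induct[where k = 0])
    case base
    then show ?case using x(1) by (simp cong: image_cong_simp)
  next
    case (step1 d)
    then show ?case
      using maximalideal_image[OF sigma_hom tau_hom tau_sigma sigma_tau] by (simp flip: plus)
  next
    case (step2 d)
    then show ?case
      using maximalideal_image[OF tau_hom sigma_hom sigma_tau tau_sigma] by (simp flip: minus)
  qed
  then show "maximalideal \<mm> R" using assms x(2) by auto
  show "\<sigma> ` \<mm> \<in> \<omega>" "tau ` \<mm> \<in> \<omega>" using assms x(2) plus minus by blast+
  assume "\<nn> \<in> \<omega>"
  then obtain d e where "\<nn> = aut_pow R \<sigma> d ` x" "\<mm> = aut_pow R \<sigma> e ` x" using x(2) assms by auto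
  then have "\<nn> = aut_pow R \<sigma> (d - e) ` \<mm>"
    using image_aut_pow_add[OF sub, of "d - e" e] by simp
  then show "\<exists>d. \<nn> = aut_pow R \<sigma> d ` \<mm>" by blast
qed

lemma orbit_ideal: "\<mm> \<in> \<omega> \<Longrightarrow> ideal \<mm> R"
  using orbit_max by (simp add: maximalideal_def)

lemma orbit_subset: "\<mm> \<in> \<omega> \<Longrightarrow> \<mm> \<subseteq> carrier R"
  using orbit_ideal by (simp add: additive_subgroup.a_subset ideal_def)

lemma tau_sigma_orbit [simp]: "\<mm> \<in> \<omega> \<Longrightarrow> tau ` \<sigma> ` \<mm> = \<mm>"
  and sigma_tau_orbit [simp]: "\<mm> \<in> \<omega> \<Longrightarrow> \<sigma> ` tau ` \<mm> = \<mm>"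
  by (simp_all add: orbit_subset)

lemma aut_pow_orbit: "\<mm> \<in> \<omega> \<Longrightarrow> aut_pow R \<sigma> d ` \<mm> \<in> \<omega>"
proof (induction d rule: int_induct[where k = 0])
  case (step1 d)
  then show ?case
    using image_aut_pow_add[OF orbit_subset[OF step1.prems], of 1 d]
    by (simp add: add.commute sigma_orbit cong: image_cong_simp)
next
  case (step2 d)
  then show ?case
    using image_aut_pow_add[OF orbit_subset[OF step2.prems], of "- 1" d]
    by (simp add: tau_orbit cong: image_cong_simp)
qed (simp cong: image_cong_simp)

lemma breaks_iff: "\<mm> \<in> \<omega> \<Longrightarrow> \<mm> \<in> breaks t \<omega> \<longleftrightarrow> t \<in> \<mm>"
  by (simp add: breaks_def)

text \<open>Finiteness turns integer powers into positive ones: \<sigma> maps the finite set of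
  forward translates of \<open>\<mm>0\<close> injectively into itself, hence onto itself, so this
  set is stable under \<open>tau\<close> too. The exponent is positive so that \<open>\<mm>0\<close>
  itself acquires a period.\<close>

lemma orbit_forward:
  assumes "\<nn> \<in> \<omega>"
  shows "\<exists>k. \<nn> = ((`) \<sigma> ^^ Suc k) \<mm>0"
proof -
  define P where "P = {((`) \<sigma> ^^ k) \<mm>0 | k. True}"
  have P\<omega>: "P \<subseteq> \<omega>"
  proof -
    have "((`) \<sigma> ^^ k) \<mm>0 \<in> \<omega>" for k
      by (induction k) (auto simp: m0_orbit sigma_orbit)
    then show ?thesis by (auto simp: P_def)
  qed
  have inj: "inj_on ((`) \<sigma>) P"
    by (rule inj_on_inverseI[of _ "(`) tau"]) (use P\<omega> tau_sigma_orbit in blast)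
  have sub: "(`) \<sigma> ` P \<subseteq> P"
  proof
    fix J assume "J \<in> (`) \<sigma> ` P"
    then obtain k where "J = ((`) \<sigma> ^^ Suc k) \<mm>0" by (auto simp: P_def)
    then show "J \<in> P" unfolding P_def by blast
  qed
  have PP: "(`) \<sigma> ` P = P"
    using endo_inj_surj[OF finite_subset[OF P\<omega> fin] sub inj] .
  have "aut_pow R \<sigma> d ` \<mm>0 \<in> P" for d
  proof (induction d rule: int_induct[where k = 0])
    case base
    then show ?case by (auto simp: P_def intro: exI[of _ 0] cong: image_cong_simp)
  next
    case (step1 d)
    have "aut_pow R \<sigma> (d + 1) ` \<mm>0 = \<sigma> ` aut_pow R \<sigma> d ` \<mm>0"
      using image_aut_pow_add[OF orbit_subset[OF m0_orbit], of 1 d] by (simp add: add.commute cong: image_cong_simp)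
    then show ?case using sub step1 by auto
  next
    case (step2 d)
    obtain Q where Q: "Q \<in> P" "aut_pow R \<sigma> d ` \<mm>0 = \<sigma> ` Q"
      using step2 PP by (metis imageE)
    have "aut_pow R \<sigma> (d - 1) ` \<mm>0 = tau ` aut_pow R \<sigma> d ` \<mm>0"
      using image_aut_pow_add[OF orbit_subset[OF m0_orbit], of "- 1" d] by (simp cong: image_cong_simp)
    then show ?case using Q P\<omega> by auto
  qed
  then have "\<nn> \<in> P" using orbit_pow[OF m0_orbit assms] by auto
  then have "\<nn> \<in> (`) \<sigma> ` P" using PP by simp
  then show ?thesis by (auto simp: P_def)
qed

lemma pow_orbit: "\<mm> \<in> \<omega> \<Longrightarrow> ((`) \<sigma> ^^ k) \<mm> \<in> \<omega>"
  by (induction k) (auto simp: sigma_orbit)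

text \<open>Continuing along the orbit leads back to \<open>\<mm>0\<close>, which is a break. This
  gives the \<open>LEAST\<close> in \<open>first_break\<close> its meaning.\<close>

lemma break_ahead:
  assumes "\<mm> \<in> \<omega>"
  shows "\<exists>k. t \<in> ((`) \<sigma> ^^ k) \<mm>"
proof -
  define f where "f = (`) \<sigma>"
  obtain k where k: "\<mm> = (f ^^ k) \<mm>0" using orbit_forward[OF assms] f_def by metis
  obtain p where p: "(f ^^ Suc p) \<mm>0 = \<mm>0" using orbit_forward[OF m0_orbit] f_def by metis
  have per: "(f ^^ (Suc p * q)) \<mm>0 = \<mm>0" for q
    by (induction q) (use p in \<open>simp_all add: funpow_add\<close>)
  \<comment> \<open>Together with the \<open>k\<close> steps from \<open>\<mm>0\<close> these
    \<open>p * k\<close> steps make \<open>Suc p * k\<close>, a multiple of the period.\<close>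
  have "(f ^^ (p * k)) \<mm> = (f ^^ (p * k + k)) \<mm>0"
    by (simp add: k funpow_add)
  also have "\<dots> = \<mm>0" using per[of k] by (simp add: add.commute)
  finally show ?thesis using m0 f_def by (auto simp: breaks_def)
qed

section \<open>The first break ahead and the cyclic enumeration of the breaks\<close>

lemma first_break_break: "\<mm> \<in> \<omega> \<Longrightarrow> t \<in> \<mm> \<Longrightarrow> first_break \<sigma> t \<mm> = \<mm>"
  by (simp add: first_break_def)

lemma first_break_nonbreak:
  assumes "\<mm> \<in> \<omega>" "t \<notin> \<mm>"
  shows "first_break \<sigma> t (\<sigma> ` \<mm>) = first_break \<sigma> t \<mm>"
proof -
  obtain k where k: "t \<in> ((`) \<sigma> ^^ k) \<mm>" using break_ahead assms by blast
  have "(LEAST k. t \<in> ((`) \<sigma> ^^ k) \<mm>) = Suc (LEAST k. t \<in> ((`) \<sigma> ^^ Suc k) \<mm>)"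
    by (rule Least_Suc[of _ k]) (use assms k in auto)
  then show ?thesis
    by (simp add: first_break_def funpow_swap1)
qed

lemma first_break_breaks: "\<mm> \<in> \<omega> \<Longrightarrow> first_break \<sigma> t \<mm> \<in> breaks t \<omega>"
  using LeastI_ex[OF break_ahead] pow_orbit by (auto simp: first_break_def breaks_def)

lemma breaks_orbit: "\<mm> \<in> breaks t \<omega> \<Longrightarrow> \<mm> \<in> \<omega>"
  by (simp add: breaks_def)

lemma break_seq_breaks: "break_seq \<sigma> t \<mm>0 i \<in> breaks t \<omega>"
  by (induction i) (simp_all add: m0 first_break_breaks sigma_orbit breaks_orbit)

text \<open>On the way along the orbit the first break ahead is kept at a non-break and replaced by
  the next member of the sequence at a break. With \<open>orbit_forward\<close> it follows that the
  sequence misses no break.\<close>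

lemma first_break_Suc_ex: "\<exists>i. first_break \<sigma> t (((`) \<sigma> ^^ Suc k) \<mm>0) = break_seq \<sigma> t \<mm>0 (Suc i)"
proof (induction k)
  case 0
  show ?case by (rule exI[of _ 0]) simp
next
  case (Suc k)
  define \<nn> where "\<nn> = ((`) \<sigma> ^^ Suc k) \<mm>0"
  have n: "\<nn> \<in> \<omega>" unfolding \<nn>_def by (rule pow_orbit[OF m0_orbit])
  have e: "((`) \<sigma> ^^ Suc (Suc k)) \<mm>0 = \<sigma> ` \<nn>" by (simp add: \<nn>_def)
  obtain i where i: "first_break \<sigma> t \<nn> = break_seq \<sigma> t \<mm>0 (Suc i)" using Suc \<nn>_def by metis
  show ?case
  proof (cases "t \<in> \<nn>")
    case True
    then have "first_break \<sigma> t (\<sigma> ` \<nn>) = break_seq \<sigma> t \<mm>0 (Suc (Suc i))"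
      using first_break_break[OF n] i by simp
    then show ?thesis unfolding e by blast
  next
    case False
    then show ?thesis using first_break_nonbreak[OF n] i e by metis
  qed
qed

lemma first_break_in_seq: "\<mm> \<in> \<omega> \<Longrightarrow> \<exists>i. first_break \<sigma> t \<mm> = break_seq \<sigma> t \<mm>0 (Suc i)"
  using orbit_forward first_break_Suc_ex by metis

definition next_break where "next_break \<mm> = first_break \<sigma> t (\<sigma> ` \<mm>)"

text \<open>Surjectivity is the accessible half: a break is its own first break, so it occurs in the
  sequence with a positive index and is the successor of a member. On the finite set of breaks this
  yields injectivity.\<close>

lemma next_break_inj: "inj_on next_break (breaks t \<omega>)"
proof -
  have f: "finite (breaks t \<omega>)" using fin by (simp add: breaks_def)
  have "breaks t \<omega> \<subseteq> next_break ` breaks t \<omega>"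
  proof
    fix \<mm> assume m: "\<mm> \<in> breaks t \<omega>"
    then have "first_break \<sigma> t \<mm> = \<mm>" by (simp add: breaks_def first_break_break)
    moreover obtain i where "first_break \<sigma> t \<mm> = break_seq \<sigma> t \<mm>0 (Suc i)"
      using first_break_in_seq m breaks_orbit by blast
    ultimately show "\<mm> \<in> next_break ` breaks t \<omega>"
      using break_seq_breaks[of i] by (auto simp: next_break_def)
  qed
  then show ?thesis
    by (intro eq_card_imp_inj_on f) (meson card_image_le card_mono f finite_imageI le_antisym)
qed

abbreviation bseq where "bseq \<equiv> break_seq \<sigma> t \<mm>0"

lemma bseq_cancel: "bseq (i + p) = bseq (j + p) \<longleftrightarrow> bseq i = bseq j"
proof (induction p)
  case (Suc p)
  have "next_break (bseq (i + p)) = next_break (bseq (j + p)) \<longleftrightarrow> bseq (i + p) = bseq (j + p)"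
    using next_break_inj break_seq_breaks by (auto simp: inj_on_def)
  then show ?case using Suc by (simp add: next_break_def)
qed simp

lemma breaks_bseq: "breaks t \<omega> = range bseq"
proof
  show "breaks t \<omega> \<subseteq> range bseq"
  proof
    fix \<mm> assume m: "\<mm> \<in> breaks t \<omega>"
    then obtain i where "first_break \<sigma> t \<mm> = bseq (Suc i)"
      using first_break_in_seq breaks_orbit by blast
    then show "\<mm> \<in> range bseq"
      using m first_break_break[of \<mm>] by (metis breaks_orbit breaks_iff rangeI)
  qed
qed (use break_seq_breaks in auto)

text \<open>The recursion for the sequence does not mention the number C of breaks. But any period p
  > 0 exhibits all breaks among the first p members, so C is at most p; hence the first C members
  are distinct, and the member with index C can only repeat the one with index 0.\<close>

lemma bseq_eq_iff: "bseq i = bseq j \<longleftrightarrow> [i = j] (mod card (breaks t \<omega>))"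
proof -
  define C where "C = card (breaks t \<omega>)"
  have f: "finite (breaks t \<omega>)" using fin by (simp add: breaks_def)
  have Cpos: "C > 0" using m0 f by (auto simp: C_def card_gt_0_iff)
  have mod: "bseq (i mod p) = bseq i" if "bseq p = bseq 0" for i p
  proof -
    have "bseq (p * q + r) = bseq r" for q r
    proof (induction q)
      case (Suc q)
      then show ?case using bseq_cancel[of p "p * q + r" 0] that by (simp add: algebra_simps)
    qed simp
    then show ?thesis by (metis mult_div_mod_eq)
  qed
  have big: "C \<le> p" if "bseq p = bseq 0" "p > 0" for p
  proof -
    have "breaks t \<omega> \<subseteq> bseq ` {..<p}"
    proof
      fix \<mm> assume "\<mm> \<in> breaks t \<omega>"
      then obtain i where "\<mm> = bseq i" using breaks_bseq by auto
      then show "\<mm> \<in> bseq ` {..<p}"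
        using mod[OF that(1), of i] that(2) by (intro image_eqI[of _ _ "i mod p"]) auto
    qed
    then show ?thesis
      using surj_card_le[of "{..<p}"] by (simp add: C_def)
  qed
  have diff: "bseq (b - a) = bseq 0" if "bseq a = bseq b" "a \<le> b" for a b
    using bseq_cancel[of "b - a" a 0] that by simp
  have inj: "inj_on bseq {..<C}"
  proof (rule linorder_inj_onI)
    fix a b assume ab: "a < b" "a \<in> {..<C}" "b \<in> {..<C}"
    show "bseq a \<noteq> bseq b"
    proof
      assume "bseq a = bseq b"
      then have "C \<le> b - a" using ab by (intro big diff) auto
      then show False using ab by auto
    qed
  qed auto
  have surj: "bseq ` {..<C} = breaks t \<omega>"
    using break_seq_breaks card_image[OF inj] by (intro card_subset_eq[OF f]) (auto simp: C_def)
  obtain a where a: "a < C" "bseq C = bseq a"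
    using break_seq_breaks[of C] unfolding surj[symmetric] by auto
  have "bseq (C - a) = bseq 0" using a diff[of a C] by simp
  then have "C \<le> C - a" using a by (intro big) auto
  then have "a = 0" using a by auto
  then have per: "bseq C = bseq 0" using a by simp
  have "bseq i = bseq j \<longleftrightarrow> bseq (i mod C) = bseq (j mod C)" using mod[OF per] by simp
  also have "\<dots> \<longleftrightarrow> i mod C = j mod C"
    using inj Cpos by (auto simp: inj_on_def)
  finally show ?thesis by (simp add: cong_def C_def)
qed

lemma bseq_break_index: "\<mm> \<in> \<omega> \<Longrightarrow> bseq (break_index \<sigma> t \<mm>0 \<mm>) = first_break \<sigma> t \<mm>"
  unfolding break_index_def by (rule LeastI_ex) (metis first_break_in_seq)

end

section \<open>The string of basis vectors\<close>

context break_orbit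
begin

lemma K_field: "\<mm> \<in> \<omega> \<Longrightarrow> field (R Quot \<mm>)"
  by (rule maximalideal.quotient_is_field[OF orbit_max R.is_cring])

lemma K_cring: "\<mm> \<in> \<omega> \<Longrightarrow> cring (R Quot \<mm>)"
  using K_field by (simp add: field_def domain_def)

lemma K_ring: "\<mm> \<in> \<omega> \<Longrightarrow> ring (R Quot \<mm>)"
  using K_cring by (simp add: cring_def)

lemmas K_simps = ring.ring_simprules[OF K_ring] cring.cring_simprules[OF K_cring]
  monoid.r_one[OF ring.is_monoid[OF K_ring]]

lemma K_closed [simp]:
  assumes "\<mm> \<in> \<omega>"
  shows "\<zero>\<^bsub>R Quot \<mm>\<^esub> \<in> carrier (R Quot \<mm>)" "\<one>\<^bsub>R Quot \<mm>\<^esub> \<in> carrier (R Quot \<mm>)"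
    and "\<lbrakk>c \<in> carrier (R Quot \<mm>); d \<in> carrier (R Quot \<mm>)\<rbrakk> \<Longrightarrow> c \<otimes>\<^bsub>R Quot \<mm>\<^esub> d \<in> carrier (R Quot \<mm>)"
    and "\<lbrakk>c \<in> carrier (R Quot \<mm>); d \<in> carrier (R Quot \<mm>)\<rbrakk> \<Longrightarrow> c \<oplus>\<^bsub>R Quot \<mm>\<^esub> d \<in> carrier (R Quot \<mm>)"
    and "c \<in> carrier (R Quot \<mm>) \<Longrightarrow> c \<otimes>\<^bsub>R Quot \<mm>\<^esub> \<zero>\<^bsub>R Quot \<mm>\<^esub> = \<zero>\<^bsub>R Quot \<mm>\<^esub>"
    and "c \<in> carrier (R Quot \<mm>) \<Longrightarrow> \<zero>\<^bsub>R Quot \<mm>\<^esub> \<otimes>\<^bsub>R Quot \<mm>\<^esub> c = \<zero>\<^bsub>R Quot \<mm>\<^esub>"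
    and "c \<in> carrier (R Quot \<mm>) \<Longrightarrow> c \<otimes>\<^bsub>R Quot \<mm>\<^esub> \<one>\<^bsub>R Quot \<mm>\<^esub> = c"
    and "c \<in> carrier (R Quot \<mm>) \<Longrightarrow> \<one>\<^bsub>R Quot \<mm>\<^esub> \<otimes>\<^bsub>R Quot \<mm>\<^esub> c = c"
    and "c \<in> carrier (R Quot \<mm>) \<Longrightarrow> c \<oplus>\<^bsub>R Quot \<mm>\<^esub> \<zero>\<^bsub>R Quot \<mm>\<^esub> = c"
    and "c \<in> carrier (R Quot \<mm>) \<Longrightarrow> \<zero>\<^bsub>R Quot \<mm>\<^esub> \<oplus>\<^bsub>R Quot \<mm>\<^esub> c = c"
  using assms by (simp_all add: K_simps)

lemma K_mult_eq_zero:
  "\<lbrakk>\<mm> \<in> \<omega>; c \<in> carrier (R Quot \<mm>); d \<in> carrier (R Quot \<mm>)\<rbrakk>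
    \<Longrightarrow> c \<otimes>\<^bsub>R Quot \<mm>\<^esub> d = \<zero>\<^bsub>R Quot \<mm>\<^esub> \<longleftrightarrow> c = \<zero>\<^bsub>R Quot \<mm>\<^esub> \<or> d = \<zero>\<^bsub>R Quot \<mm>\<^esub>"
  using K_field by (metis K_cring cring.cring_simprules(26) domain.integral_iff field_def)

lemma K_one_not_zero: "\<mm> \<in> \<omega> \<Longrightarrow> \<one>\<^bsub>R Quot \<mm>\<^esub> \<noteq> \<zero>\<^bsub>R Quot \<mm>\<^esub>"
  using K_field by (simp add: field_def domain_def domain_axioms_def)

lemma K_coset_simps:
  assumes "\<mm> \<in> \<omega>"
  shows "\<lbrakk>r \<in> carrier R; s \<in> carrier R\<rbrakk> \<Longrightarrow> (\<mm> +> r) \<otimes>\<^bsub>R Quot \<mm>\<^esub> (\<mm> +> s) = \<mm> +> (r \<otimes> s)"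
    and "\<lbrakk>r \<in> carrier R; s \<in> carrier R\<rbrakk> \<Longrightarrow> (\<mm> +> r) \<oplus>\<^bsub>R Quot \<mm>\<^esub> (\<mm> +> s) = \<mm> +> (r \<oplus> s)"
    and "\<mm> +> \<one> = \<one>\<^bsub>R Quot \<mm>\<^esub>"
    and "\<mm> +> \<zero> = \<zero>\<^bsub>R Quot \<mm>\<^esub>"
    and "r \<in> carrier R \<Longrightarrow> \<mm> +> r = \<zero>\<^bsub>R Quot \<mm>\<^esub> \<longleftrightarrow> r \<in> \<mm>"
  using quot_simps(1,2)[OF orbit_ideal[OF assms]] quot_coset_eq_zero[OF orbit_ideal[OF assms]]
    quot_simps(3,4)[OF orbit_ideal[OF assms] R.one_closed R.one_closed, symmetric] by simp_all

text \<open>Division in the residue field with the multiplier taken from R, since it is under R that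
  submodules are stable.\<close>

lemma K_div:
  assumes "\<mm> \<in> \<omega>" "c \<in> carrier (R Quot \<mm>)" "d \<in> carrier (R Quot \<mm>)" "d \<noteq> \<zero>\<^bsub>R Quot \<mm>\<^esub>"
  shows "\<exists>r \<in> carrier R. (\<mm> +> r) \<otimes>\<^bsub>R Quot \<mm>\<^esub> d = c"
proof -
  interpret K: field "R Quot \<mm>" by (rule K_field[OF assms(1)])
  have d: "d \<in> Units (R Quot \<mm>)" using assms K.field_Units by auto
  have "c \<otimes>\<^bsub>R Quot \<mm>\<^esub> inv\<^bsub>R Quot \<mm>\<^esub> d \<in> carrier (R Quot \<mm>)"
    using d assms by simp
  then obtain r where "r \<in> carrier R" "c \<otimes>\<^bsub>R Quot \<mm>\<^esub> inv\<^bsub>R Quot \<mm>\<^esub> d = \<mm> +> r"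
    using quot_rep by auto
  moreover have "(c \<otimes>\<^bsub>R Quot \<mm>\<^esub> inv\<^bsub>R Quot \<mm>\<^esub> d) \<otimes>\<^bsub>R Quot \<mm>\<^esub> d = c"
    using d assms by (simp add: K.m_assoc)
  ultimately show ?thesis by metis
qed

lemma K_subset: "\<mm> \<in> \<omega> \<Longrightarrow> c \<in> carrier (R Quot \<mm>) \<Longrightarrow> c \<subseteq> carrier R"
  using R.a_r_coset_subset_G[OF orbit_subset] by (auto simp: quot_rep)

lemma sigma_quot_hom: "\<mm> \<in> \<omega> \<Longrightarrow> (`) \<sigma> \<in> ring_hom (R Quot \<mm>) (R Quot (\<sigma> ` \<mm>))"
  by (rule image_quot_hom[OF sigma_hom]) (auto simp: orbit_ideal sigma_orbit)

lemma tau_quot_hom: "\<mm> \<in> \<omega> \<Longrightarrow> (`) tau \<in> ring_hom (R Quot \<mm>) (R Quot (tau ` \<mm>))"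
  by (rule image_quot_hom[OF tau_hom]) (auto simp: orbit_ideal tau_orbit)

lemma sigma_K [simp]:
  assumes "\<mm> \<in> \<omega>" "c \<in> carrier (R Quot \<mm>)"
  shows "\<sigma> ` c \<in> carrier (R Quot (\<sigma> ` \<mm>))"
    and "d \<in> carrier (R Quot \<mm>) \<Longrightarrow> \<sigma> ` (c \<otimes>\<^bsub>R Quot \<mm>\<^esub> d) = \<sigma> ` c \<otimes>\<^bsub>R Quot (\<sigma> ` \<mm>)\<^esub> \<sigma> ` d"
    and "d \<in> carrier (R Quot \<mm>) \<Longrightarrow> \<sigma> ` (c \<oplus>\<^bsub>R Quot \<mm>\<^esub> d) = \<sigma> ` c \<oplus>\<^bsub>R Quot (\<sigma> ` \<mm>)\<^esub> \<sigma> ` d"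
    and "tau ` \<sigma> ` c = c"
  using assms ring_hom_closed[OF sigma_quot_hom] ring_hom_mult[OF sigma_quot_hom]
    ring_hom_add[OF sigma_quot_hom] by (auto simp: tau_image_sigma[OF K_subset])

lemma tau_K [simp]:
  assumes "\<mm> \<in> \<omega>" "c \<in> carrier (R Quot \<mm>)"
  shows "tau ` c \<in> carrier (R Quot (tau ` \<mm>))"
    and "d \<in> carrier (R Quot \<mm>) \<Longrightarrow> tau ` (c \<otimes>\<^bsub>R Quot \<mm>\<^esub> d) = tau ` c \<otimes>\<^bsub>R Quot (tau ` \<mm>)\<^esub> tau ` d"
    and "d \<in> carrier (R Quot \<mm>) \<Longrightarrow> tau ` (c \<oplus>\<^bsub>R Quot \<mm>\<^esub> d) = tau ` c \<oplus>\<^bsub>R Quot (tau ` \<mm>)\<^esub> tau ` d"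
    and "\<sigma> ` tau ` c = c"
  using assms ring_hom_closed[OF tau_quot_hom] ring_hom_mult[OF tau_quot_hom]
    ring_hom_add[OF tau_quot_hom] by (auto simp: sigma_image_tau[OF K_subset])

lemma sigma_tau_coset [simp]:
  assumes "\<mm> \<in> \<omega>" "r \<in> carrier R"
  shows "\<sigma> ` (\<mm> +> r) = \<sigma> ` \<mm> +> \<sigma> r" "tau ` (\<mm> +> r) = tau ` \<mm> +> tau r"
  using assms by (simp_all add: image_coset[OF sigma_hom] image_coset[OF tau_hom] orbit_subset)

lemma sigma_tau_zero_one [simp]:
  assumes "\<mm> \<in> \<omega>"
  shows "\<sigma> ` \<zero>\<^bsub>R Quot \<mm>\<^esub> = \<zero>\<^bsub>R Quot (\<sigma> ` \<mm>)\<^esub>" "tau ` \<zero>\<^bsub>R Quot \<mm>\<^esub> = \<zero>\<^bsub>R Quot (tau ` \<mm>)\<^esub>"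
    and "\<sigma> ` \<one>\<^bsub>R Quot \<mm>\<^esub> = \<one>\<^bsub>R Quot (\<sigma> ` \<mm>)\<^esub>" "tau ` \<one>\<^bsub>R Quot \<mm>\<^esub> = \<one>\<^bsub>R Quot (tau ` \<mm>)\<^esub>"
  using assms ring_hom_one[OF sigma_quot_hom] ring_hom_one[OF tau_quot_hom]
  by (simp_all add: FactRing_def)

lemma sigma_eq_zero [simp]:
  "\<mm> \<in> \<omega> \<Longrightarrow> c \<in> carrier (R Quot \<mm>) \<Longrightarrow> \<sigma> ` c = \<zero>\<^bsub>R Quot (\<sigma> ` \<mm>)\<^esub> \<longleftrightarrow> c = \<zero>\<^bsub>R Quot \<mm>\<^esub>"
  by (metis sigma_K(4) sigma_orbit sigma_tau_zero_one(1,2) tau_sigma_orbit)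

lemma tau_eq_zero [simp]:
  "\<mm> \<in> \<omega> \<Longrightarrow> c \<in> carrier (R Quot \<mm>) \<Longrightarrow> tau ` c = \<zero>\<^bsub>R Quot (tau ` \<mm>)\<^esub> \<longleftrightarrow> c = \<zero>\<^bsub>R Quot \<mm>\<^esub>"
  by (metis tau_K(4) tau_orbit sigma_tau_zero_one(1,2) sigma_tau_orbit)

end

text \<open>Basis and steps depend on a word only through its length \<open>n\<close>, so a word and
  its dagger share one string.\<close>

locale string = break_orbit +
  fixes i n :: nat
begin

text \<open>The congruence of indices is replaced by an equality of breaks, which is easier to
  follow along \<sigma>. The second component of an index is its level.\<close>

definition B :: "('a set \<times> nat) set" where
  "B = {(\<mm>, k). \<mm> \<in> \<omega> \<and> k \<le> n \<and> bseq (i + k) = first_break \<sigma> t \<mm>}"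

lemma V_basis_eq: "length w = n \<Longrightarrow> V_basis \<sigma> t \<omega> \<mm>0 i w = B"
proof -
  have "[i + k = break_index \<sigma> t \<mm>0 \<mm>] (mod card (breaks t \<omega>)) \<longleftrightarrow> bseq (i + k) = first_break \<sigma> t \<mm>"
    if "\<mm> \<in> \<omega>" for \<mm> k
    using bseq_eq_iff[of "i + k" "break_index \<sigma> t \<mm>0 \<mm>"] bseq_break_index[OF that] by simp
  then show "length w = n \<Longrightarrow> ?thesis"
    by (auto simp: V_basis_def B_def)
qed

lemma finite_B: "finite B"
  by (rule finite_subset[of _ "\<omega> \<times> {..n}"]) (auto simp: B_def fin)

definition nxt :: "'a set \<times> nat \<Rightarrow> 'a set \<times> nat" where
  "nxt b = (\<sigma> ` fst b, if t \<in> fst b then Suc (snd b) else snd b)"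

text \<open>At the start the subtraction is truncated and the result has no meaning, which is why
  \<open>prv_facts\<close> excludes the start.\<close>

definition prv :: "'a set \<times> nat \<Rightarrow> 'a set \<times> nat" where
  "prv b = (tau ` fst b, if t \<in> tau ` fst b then snd b - 1 else snd b)"

definition is_start :: "'a set \<times> nat \<Rightarrow> bool" where
  "is_start b \<longleftrightarrow> t \<in> tau ` fst b \<and> snd b = 0"

definition is_end :: "'a set \<times> nat \<Rightarrow> bool" where
  "is_end b \<longleftrightarrow> t \<in> fst b \<and> snd b = n"

lemma B_orbit [simp]: "b \<in> B \<Longrightarrow> fst b \<in> \<omega>"
  by (auto simp: B_def)

lemma fst_nxt: "fst (nxt b) = \<sigma> ` fst b" and fst_prv: "fst (prv b) = tau ` fst b"
  by (simp_all add: nxt_def prv_def)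

lemma nxt_facts:
  assumes "b \<in> B" "\<not> is_end b"
  shows "nxt b \<in> B" "\<not> is_start (nxt b)" "prv (nxt b) = b"
proof -
  obtain \<mm> k where b: "b = (\<mm>, k)" by fastforce
  have m: "\<mm> \<in> \<omega>" "k \<le> n" "bseq (i + k) = first_break \<sigma> t \<mm>" using assms b by (auto simp: B_def)
  have "nxt b \<in> B"
  proof (cases "t \<in> \<mm>")
    case True
    then have "bseq (i + k) = \<mm>" "k < n" using m first_break_break assms(2) b by (auto simp: is_end_def)
    then show ?thesis using m True by (simp add: nxt_def b B_def sigma_orbit)
  next
    case False
    then show ?thesis using m by (simp add: nxt_def b B_def sigma_orbit first_break_nonbreak)
  qed
  then show "nxt b \<in> B" "\<not> is_start (nxt b)" "prv (nxt b) = b"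
    using m by (auto simp: is_start_def prv_def nxt_def b)
qed

text \<open>Going back across a break uses the injectivity of \<open>next_break\<close>: the
  preceding ideal and \<open>bseq (i + l)\<close> have the same successor break, so they
  agree.\<close>

lemma prv_facts:
  assumes "b \<in> B" "\<not> is_start b"
  shows "prv b \<in> B" "\<not> is_end (prv b)" "nxt (prv b) = b"
proof -
  obtain \<mm> k where b: "b = (\<mm>, k)" by fastforce
  have m: "\<mm> \<in> \<omega>" "k \<le> n" "bseq (i + k) = first_break \<sigma> t \<mm>" using assms b by (auto simp: B_def)
  note tm = tau_orbit[OF m(1)]
  show "prv b \<in> B"
  proof (cases "t \<in> tau ` \<mm>")
    case True
    then obtain l where l: "k = Suc l" using assms(2) b by (cases k) (auto simp: is_start_def)
    have "next_break (bseq (i + l)) = next_break (tau ` \<mm>)"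
      using m l by (simp add: next_break_def)
    then have "bseq (i + l) = tau ` \<mm>"
      using next_break_inj break_seq_breaks True tm by (auto simp: inj_on_def breaks_iff)
    then show ?thesis using m True tm l by (simp add: prv_def b B_def first_break_break)
  next
    case False
    then show ?thesis using m tm first_break_nonbreak[OF tm] by (simp add: prv_def b B_def)
  qed
  show "\<not> is_end (prv b)" "nxt (prv b) = b"
    using m assms(2) by (auto simp: is_end_def is_start_def nxt_def prv_def b)
qed

lemma fst_nxt_orbit [simp]: "b \<in> B \<Longrightarrow> \<sigma> ` fst b \<in> \<omega>"
  and fst_prv_orbit [simp]: "b \<in> B \<Longrightarrow> tau ` fst b \<in> \<omega>"
  by (auto simp: sigma_orbit tau_orbit)

text \<open>The ideals preceding two starts are breaks with the common successor
  \<open>bseq i\<close>, and \<open>next_break\<close> is injective.\<close>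

lemma start_unique:
  assumes "b \<in> B" "b' \<in> B" "is_start b" "is_start b'"
  shows "b = b'"
proof -
  have "next_break (tau ` fst b) = next_break (tau ` fst b')"
    using assms by (auto simp: next_break_def B_def is_start_def)
  then have "tau ` fst b = tau ` fst b'"
    using next_break_inj assms by (auto simp: inj_on_def is_start_def breaks_iff)
  then have "fst b = fst b'"
    by (metis assms(1,2) B_orbit sigma_tau_orbit)
  then show ?thesis using assms(3,4) by (simp add: is_start_def prod_eq_iff)
qed

section \<open>Positions on the string and induction along it\<close>

definition pos :: "'a set \<times> nat \<Rightarrow> nat" where
  "pos b = (LEAST p. is_start ((prv ^^ p) b))"

text \<open>Undoing the steps that lead from \<open>\<mm>0\<close> to the ideal ends at a break. At
  least one step is asked for, because a level begins right after a break.\<close>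

lemma break_behind:
  assumes "\<mm> \<in> \<omega>"
  shows "\<exists>p. t \<in> ((`) tau ^^ Suc p) \<mm>"
proof -
  obtain k where k: "\<mm> = ((`) \<sigma> ^^ Suc k) \<mm>0" using orbit_forward[OF assms] by metis
  have "((`) tau ^^ p) (((`) \<sigma> ^^ p) \<mm>0) = \<mm>0" for p
  proof (induction p)
    case (Suc p)
    have "((`) tau ^^ Suc p) (((`) \<sigma> ^^ Suc p) \<mm>0) = ((`) tau ^^ p) (tau ` \<sigma> ` (((`) \<sigma> ^^ p) \<mm>0))"
      by (simp add: funpow_swap1)
    then show ?case using Suc tau_sigma_orbit[OF pow_orbit[OF m0_orbit]] by simp
  qed simp
  then have "((`) tau ^^ Suc k) \<mm> = \<mm>0" using k by metis
  then show ?thesis using m0 by (metis breaks_def mem_Collect_eq)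
qed

text \<open>Induction on the level. Going back inside a level one comes after finitely many steps to
  an index right behind a break; on level 0 this is the start, and on a higher level the next step
  lowers the level.\<close>

lemma pos_ex: "b \<in> B \<Longrightarrow> \<exists>p. is_start ((prv ^^ p) b)"
proof (induction "snd b" arbitrary: b)
  have step: "\<exists>p. (prv ^^ p) b \<in> B \<and> snd ((prv ^^ p) b) = snd b \<and> t \<in> tau ` fst ((prv ^^ p) b)"
    if "b \<in> B" "t \<in> ((`) tau ^^ Suc p) (fst b)" for b p
    using that
  proof (induction p arbitrary: b)
    case 0
    then show ?case by (intro exI[of _ 0]) auto
  next
    case (Suc p)
    show ?case
    proof (cases "t \<in> tau ` fst b")
      case True
      then show ?thesis using Suc.prems by (intro exI[of _ 0]) auto
    next
      case False
      then have b': "prv b \<in> B" "snd (prv b) = snd b"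
        using prv_facts(1)[OF Suc.prems(1)] by (auto simp: is_start_def prv_def)
      have "t \<in> ((`) tau ^^ Suc p) (fst (prv b))"
        using Suc.prems(2) by (simp add: fst_prv funpow_swap1)
      from Suc.IH[OF b'(1) this] obtain q where "(prv ^^ q) (prv b) \<in> B"
        "snd ((prv ^^ q) (prv b)) = snd b" "t \<in> tau ` fst ((prv ^^ q) (prv b))"
        using b' by auto
      then show ?thesis by (intro exI[of _ "Suc q"]) (simp add: funpow_swap1)
    qed
  qed
  {
    case 0
    then obtain p where "t \<in> ((`) tau ^^ Suc p) (fst b)" using break_behind by fastforce
    from step[OF 0(2) this] show ?case using 0 by (auto simp: is_start_def)
  next
    case (Suc k)
    then obtain p where "t \<in> ((`) tau ^^ Suc p) (fst b)" using break_behind by fastforce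
    from step[OF Suc.prems this] obtain q where q: "(prv ^^ q) b \<in> B" "snd ((prv ^^ q) b) = snd b"
      "t \<in> tau ` fst ((prv ^^ q) b)" by auto
    then have "\<not> is_start ((prv ^^ q) b)" using Suc.hyps(2) by (simp add: is_start_def)
    then have "prv ((prv ^^ q) b) \<in> B" using q prv_facts by blast
    moreover have "k = snd (prv ((prv ^^ q) b))" using q Suc.hyps(2) by (simp add: prv_def)
    ultimately obtain p where "is_start ((prv ^^ p) (prv ((prv ^^ q) b)))" using Suc.hyps(1) by blast
    then have "is_start ((prv ^^ (p + Suc q)) b)" by (simp only: funpow_add o_def) simp
    then show ?case by blast
  }
qed

lemma pos_start: "is_start b \<Longrightarrow> pos b = 0"
  unfolding pos_def by (rule Least_eq_0) simp

lemma pos_prv: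
  assumes "b \<in> B" "\<not> is_start b"
  shows "pos b = Suc (pos (prv b))"
proof -
  obtain p where "is_start ((prv ^^ p) b)" using pos_ex assms by blast
  then have "pos b = Suc (LEAST p. is_start ((prv ^^ Suc p) b))"
    unfolding pos_def by (rule Least_Suc) (use assms in auto)
  then show ?thesis by (simp add: pos_def funpow_swap1)
qed

lemma pos_eq_0: "b \<in> B \<Longrightarrow> pos b = 0 \<longleftrightarrow> is_start b"
  using pos_start pos_prv by fastforce

lemma pos_induct [consumes 1, case_names start step]:
  assumes "b \<in> B" "\<And>b. b \<in> B \<Longrightarrow> is_start b \<Longrightarrow> P b"
    and "\<And>b. b \<in> B \<Longrightarrow> \<not> is_start b \<Longrightarrow> prv b \<in> B \<Longrightarrow> P (prv b) \<Longrightarrow> P b"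
  shows "P b"
  using assms(1)
proof (induction "pos b" arbitrary: b)
  case 0
  then show ?case using assms(2) pos_eq_0 by metis
next
  case (Suc p)
  then have "\<not> is_start b" using pos_start[of b] by auto
  then show ?case
    using Suc assms(3) pos_prv prv_facts(1) by (metis nat.inject)
qed

text \<open>Two indices with the same position go back in step until both are at the unique start.
  Thus positions order the basis linearly.\<close>

lemma pos_inj: "b \<in> B \<Longrightarrow> b' \<in> B \<Longrightarrow> pos b = pos b' \<Longrightarrow> b = b'"
proof (induction b arbitrary: b' rule: pos_induct)
  case (start b)
  then show ?case using start_unique pos_eq_0 pos_start by metis
next
  case (step b)
  then have "\<not> is_start b'" using pos_eq_0 by metis
  then show ?case using step pos_prv prv_facts by (metis nat.inject)
qed

end

section \<open>The modules attached to a word\<close>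

context string
begin

abbreviation K :: "'a set \<times> nat \<Rightarrow> 'a set ring" where "K b \<equiv> R Quot (fst b)"

definition G :: "('a set \<times> nat \<Rightarrow> 'a set) monoid" where
  "G = sum_group B (\<lambda>b. add_monoid (K b))"

lemma B_orbit_fst [simp]: "(\<mm>, k) \<in> B \<Longrightarrow> \<mm> \<in> \<omega>"
  using B_orbit by fastforce

lemma V_group_eq: "length w = n \<Longrightarrow> V_group R \<sigma> t \<omega> \<mm>0 i w = G"
  by (simp add: V_group_def V_basis_eq G_def case_prod_beta')

lemma K_add_group: "\<mm> \<in> \<omega> \<Longrightarrow> comm_group (add_monoid (R Quot \<mm>))"
  using K_ring by (simp add: ring_def abelian_group_def abelian_group_axioms_def)

lemma carrier_G: "carrier G = (\<Pi>\<^sub>E b\<in>B. carrier (K b))"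
proof -
  have "group (add_monoid (K b))" if "b \<in> B" for b
    using K_add_group that by (simp add: comm_group_def)
  then show ?thesis
    unfolding G_def by (subst carrier_sum_group) (auto simp: finite_B)
qed

lemma G_one: "\<one>\<^bsub>G\<^esub> = (\<lambda>b\<in>B. \<zero>\<^bsub>K b\<^esub>)" and G_mult: "u \<otimes>\<^bsub>G\<^esub> v = (\<lambda>b\<in>B. u b \<oplus>\<^bsub>K b\<^esub> v b)"
  by (simp_all add: G_def)

lemma G_at [simp]: "v \<in> carrier G \<Longrightarrow> b \<in> B \<Longrightarrow> v b \<in> carrier (K b)"
  by (auto simp: carrier_G)

lemma G_at_pair [simp]: "v \<in> carrier G \<Longrightarrow> (\<mm>, k) \<in> B \<Longrightarrow> v (\<mm>, k) \<in> carrier (R Quot \<mm>)"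
  using G_at by fastforce

lemma G_tau_sigma [simp]: "v \<in> carrier G \<Longrightarrow> b \<in> B \<Longrightarrow> tau ` \<sigma> ` v b = v b"
  and G_sigma_tau [simp]: "v \<in> carrier G \<Longrightarrow> b \<in> B \<Longrightarrow> \<sigma> ` tau ` v b = v b"
  using sigma_K(4)[of "fst b" "v b"] tau_K(4)[of "fst b" "v b"] by auto

lemma G_one_at [simp]: "b \<in> B \<Longrightarrow> \<one>\<^bsub>G\<^esub> b = \<zero>\<^bsub>K b\<^esub>"
  and G_mult_at [simp]: "b \<in> B \<Longrightarrow> (u \<otimes>\<^bsub>G\<^esub> v) b = u b \<oplus>\<^bsub>K b\<^esub> v b"
  by (simp_all add: G_one G_mult)

lemma G_I: "(\<And>b. b \<in> B \<Longrightarrow> f b \<in> carrier (K b)) \<Longrightarrow> (\<lambda>b\<in>B. f b) \<in> carrier G"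
  by (auto simp: carrier_G)

lemma G_eqI: "u \<in> carrier G \<Longrightarrow> v \<in> carrier G \<Longrightarrow> (\<And>b. b \<in> B \<Longrightarrow> u b = v b) \<Longrightarrow> u = v"
  unfolding carrier_G by (rule PiE_ext)

lemma comm_group_G: "comm_group G"
proof (rule comm_groupI)
  fix x assume x: "x \<in> carrier G"
  have "(\<lambda>b\<in>B. \<ominus>\<^bsub>K b\<^esub> x b) \<in> carrier G"
    by (rule G_I) (simp add: K_simps x)
  moreover have "(\<lambda>b\<in>B. \<ominus>\<^bsub>K b\<^esub> x b) \<otimes>\<^bsub>G\<^esub> x = \<one>\<^bsub>G\<^esub>"
    by (auto simp: G_mult G_one K_simps x intro!: restrict_ext)
  ultimately show "\<exists>y\<in>carrier G. y \<otimes>\<^bsub>G\<^esub> x = \<one>\<^bsub>G\<^esub>" by blast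
  show "\<one>\<^bsub>G\<^esub> \<otimes>\<^bsub>G\<^esub> x = x"
    by (rule G_eqI) (auto simp: x G_mult G_one intro!: G_I)
  fix y assume y: "y \<in> carrier G"
  show "x \<otimes>\<^bsub>G\<^esub> y \<in> carrier G" "x \<otimes>\<^bsub>G\<^esub> y = y \<otimes>\<^bsub>G\<^esub> x"
    using x y by (auto simp: G_mult K_simps intro!: G_I restrict_ext)
  fix z assume z: "z \<in> carrier G"
  show "x \<otimes>\<^bsub>G\<^esub> y \<otimes>\<^bsub>G\<^esub> z = x \<otimes>\<^bsub>G\<^esub> (y \<otimes>\<^bsub>G\<^esub> z)"
    using x y z by (auto simp: G_mult K_simps cong: restrict_cong)
next
  show "\<one>\<^bsub>G\<^esub> \<in> carrier G" by (auto simp: G_one intro!: G_I)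
qed

sublocale G: comm_group G by (rule comm_group_G)

definition single :: "'a set \<Rightarrow> 'a set \<times> nat \<Rightarrow> 'a set \<times> nat \<Rightarrow> 'a set" where
  "single c b = (\<lambda>b'\<in>B. if b' = b then c else \<zero>\<^bsub>K b'\<^esub>)"

lemma V_single_eq: "length w = n \<Longrightarrow> V_single R \<sigma> t \<omega> \<mm>0 i w c \<mm> k = single c (\<mm>, k)"
  by (simp add: V_single_def V_basis_eq single_def case_prod_beta' prod_eq_iff)

lemma single_closed [simp]: "b \<in> B \<Longrightarrow> c \<in> carrier (K b) \<Longrightarrow> single c b \<in> carrier G"
  by (auto simp: single_def intro!: G_I)

lemma single_at [simp]: "b' \<in> B \<Longrightarrow> single c b b' = (if b' = b then c else \<zero>\<^bsub>K b'\<^esub>)"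
  by (simp add: single_def)

lemma single_zero: "b \<in> B \<Longrightarrow> single \<zero>\<^bsub>K b\<^esub> b = \<one>\<^bsub>G\<^esub>"
  by (rule G_eqI) auto

text \<open>The basis is finite, so cutting \<open>v\<close> down to growing subsets of it builds
  \<open>v\<close> from single entries. Additive statements need to be checked only on
  these.\<close>

lemma G_generated [consumes 1, case_names one single mult]:
  assumes "v \<in> carrier G" and one: "P \<one>\<^bsub>G\<^esub>"
    and single: "\<And>b c. b \<in> B \<Longrightarrow> c \<in> carrier (K b) \<Longrightarrow> P (single c b)"
    and mult: "\<And>u v. u \<in> carrier G \<Longrightarrow> v \<in> carrier G \<Longrightarrow> P u \<Longrightarrow> P v \<Longrightarrow> P (u \<otimes>\<^bsub>G\<^esub> v)"
  shows "P v"
proof -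
  define cut where "cut S = (\<lambda>b\<in>B. if b \<in> S then v b else \<zero>\<^bsub>K b\<^esub>)" for S
  have cut_closed: "cut S \<in> carrier G" for S
    unfolding cut_def by (rule G_I) (use assms(1) in auto)
  have "P (cut S)" if "finite S" "S \<subseteq> B" for S
    using that
  proof (induction S rule: finite_induct)
    case empty
    have "cut {} = \<one>\<^bsub>G\<^esub>" by (simp add: cut_def G_one)
    then show ?case using one by simp
  next
    case (insert b S)
    then have b: "b \<in> B" "v b \<in> carrier (K b)" using assms(1) by auto
    have "cut (insert b S) = single (v b) b \<otimes>\<^bsub>G\<^esub> cut S"
      by (rule G_eqI) (use insert b assms(1) in \<open>auto simp: cut_closed\<close>, auto simp: cut_def)
    then show ?case using insert b by (auto intro!: mult single cut_closed)
  qed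
  moreover have "cut B = v"
    by (rule G_eqI) (use assms(1) in \<open>auto simp: cut_closed\<close>, auto simp: cut_def)
  ultimately show ?thesis using finite_B by force
qed

section \<open>The action written in coordinates along the string\<close>

definition rho :: "'a \<Rightarrow> ('a set \<times> nat \<Rightarrow> 'a set) \<Rightarrow> 'a set \<times> nat \<Rightarrow> 'a set" where
  "rho r v = (\<lambda>b\<in>B. (fst b +> r) \<otimes>\<^bsub>K b\<^esub> v b)"

text \<open>With vanishing scalars for the missing arrows, \<open>X\<close> becomes the shift \<open>b \<mapsto> nxt b\<close> composed with
  \<open>\<sigma>\<close> and multiplication by \<open>alpha w b\<close>, and \<open>Y\<close> the opposite shift with the scalar \<open>beta w b\<close>.\<close>

definition alpha :: "letter list \<Rightarrow> 'a set \<times> nat \<Rightarrow> 'a" where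
  "alpha w b = (if t \<notin> fst b then t else if w ! snd b = Lx then \<one> else \<zero>)"

definition beta :: "letter list \<Rightarrow> 'a set \<times> nat \<Rightarrow> 'a" where
  "beta w b = (if t \<in> fst b \<and> w ! snd b = Lx then \<zero> else \<one>)"

lemma alpha_beta_closed [simp]: "alpha w b \<in> carrier R" "beta w b \<in> carrier R"
  by (auto simp: alpha_def beta_def t_closed)

text \<open>The constraint that \<open>YX = t\<close> puts on the scalars. At a break one of the two
  vanishes, and t vanishes modulo the ideal.\<close>

lemma coset_beta_alpha:
  assumes "b \<in> B"
  shows "fst b +> (beta w b \<otimes> alpha w b) = fst b +> t"
proof (cases "t \<in> fst b")
  case True
  then have "fst b +> t = fst b +> \<zero>"
    using assms K_coset_simps(4)[of "fst b"] K_coset_simps(5)[of "fst b" t] t_closed by simp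
  then show ?thesis using True by (simp add: alpha_def beta_def)
next
  case False
  then show ?thesis by (simp add: alpha_def beta_def t_closed)
qed

text \<open>The entry at \<open>b\<close> is fetched from the predecessor. Guarding the start also
  keeps the lookup in \<open>alpha\<close> inside a word of length \<open>n\<close>, since a
  predecessor is never the end of the string.\<close>

definition Xop where
  "Xop w v = (\<lambda>b\<in>B. if is_start b then \<zero>\<^bsub>K b\<^esub>
     else \<sigma> ` ((fst (prv b) +> alpha w (prv b)) \<otimes>\<^bsub>K (prv b)\<^esub> v (prv b)))"

definition Yop where
  "Yop w v = (\<lambda>b\<in>B. if is_end b then \<zero>\<^bsub>K b\<^esub>
     else (fst b +> beta w b) \<otimes>\<^bsub>K b\<^esub> tau ` v (nxt b))"

lemma sigma_fst_prv [simp]: "b \<in> B \<Longrightarrow> \<sigma> ` fst (prv b) = fst b"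
  and tau_fst_nxt [simp]: "b \<in> B \<Longrightarrow> tau ` fst (nxt b) = fst b"
  by (simp_all add: fst_prv fst_nxt)

lemma sigma_from_prv:
  assumes "b \<in> B" "\<not> is_start b" "c \<in> carrier (K (prv b))"
  shows "\<sigma> ` c \<in> carrier (K b)"
    and "d \<in> carrier (K (prv b)) \<Longrightarrow> \<sigma> ` (c \<otimes>\<^bsub>K (prv b)\<^esub> d) = \<sigma> ` c \<otimes>\<^bsub>K b\<^esub> \<sigma> ` d"
    and "d \<in> carrier (K (prv b)) \<Longrightarrow> \<sigma> ` (c \<oplus>\<^bsub>K (prv b)\<^esub> d) = \<sigma> ` c \<oplus>\<^bsub>K b\<^esub> \<sigma> ` d"
    and "\<sigma> ` c = \<zero>\<^bsub>K b\<^esub> \<longleftrightarrow> c = \<zero>\<^bsub>K (prv b)\<^esub>"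
  using assms prv_facts(1)[OF assms(1,2)] sigma_K[of "fst (prv b)" c] sigma_eq_zero[of "fst (prv b)" c]
  by auto

lemma tau_from_nxt:
  assumes "b \<in> B" "\<not> is_end b" "c \<in> carrier (K (nxt b))"
  shows "tau ` c \<in> carrier (K b)"
    and "d \<in> carrier (K (nxt b)) \<Longrightarrow> tau ` (c \<otimes>\<^bsub>K (nxt b)\<^esub> d) = tau ` c \<otimes>\<^bsub>K b\<^esub> tau ` d"
    and "d \<in> carrier (K (nxt b)) \<Longrightarrow> tau ` (c \<oplus>\<^bsub>K (nxt b)\<^esub> d) = tau ` c \<oplus>\<^bsub>K b\<^esub> tau ` d"
    and "tau ` c = \<zero>\<^bsub>K b\<^esub> \<longleftrightarrow> c = \<zero>\<^bsub>K (nxt b)\<^esub>"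
  using assms nxt_facts(1)[OF assms(1,2)] tau_K[of "fst (nxt b)" c] tau_eq_zero[of "fst (nxt b)" c]
  by auto

lemma tau_coset_nxt:
  "b \<in> B \<Longrightarrow> r \<in> carrier R \<Longrightarrow> tau ` (fst (nxt b) +> r) = fst b +> tau r"
  by (simp add: fst_nxt)

lemma rho_at: "b \<in> B \<Longrightarrow> rho r v b = (fst b +> r) \<otimes>\<^bsub>K b\<^esub> v b"
  by (simp add: rho_def)

lemma Xop_start: "b \<in> B \<Longrightarrow> is_start b \<Longrightarrow> Xop w v b = \<zero>\<^bsub>K b\<^esub>"
  and Xop_at: "b \<in> B \<Longrightarrow> \<not> is_start b
    \<Longrightarrow> Xop w v b = \<sigma> ` ((fst (prv b) +> alpha w (prv b)) \<otimes>\<^bsub>K (prv b)\<^esub> v (prv b))"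
  by (simp_all add: Xop_def)

lemma Yop_end: "b \<in> B \<Longrightarrow> is_end b \<Longrightarrow> Yop w v b = \<zero>\<^bsub>K b\<^esub>"
  and Yop_at: "b \<in> B \<Longrightarrow> \<not> is_end b \<Longrightarrow> Yop w v b = (fst b +> beta w b) \<otimes>\<^bsub>K b\<^esub> tau ` v (nxt b)"
  by (simp_all add: Yop_def)

lemma rho_closed' [simp]: "r \<in> carrier R \<Longrightarrow> v \<in> carrier G \<Longrightarrow> rho r v \<in> carrier G"
  unfolding rho_def by (rule G_I) auto

lemma Xop_closed [simp]: "v \<in> carrier G \<Longrightarrow> Xop w v \<in> carrier G"
  unfolding Xop_def by (rule G_I) (simp add: prv_facts sigma_from_prv)

lemma Yop_closed [simp]: "v \<in> carrier G \<Longrightarrow> Yop w v \<in> carrier G"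
  unfolding Yop_def by (rule G_I) (simp add: nxt_facts tau_from_nxt)

text \<open>In coordinates each relation is an identity in one residue field. At the two ends of the
  string the products of X and Y vanish, in accordance with t lying in the ideal at the end and
  \<sigma>(t) in the ideal at the start.\<close>

lemma gwa_rep_op: "gwa_rep R \<sigma> t G rho (Xop w) (Yop w)"
proof (intro gwa_rep.intro gwa_rep_axioms.intro gwa_data_axioms comm_group_G)
  fix r assume r: "r \<in> carrier R"
  show "rho r \<in> hom G G"
  proof (rule homI)
    fix u v assume uv: "u \<in> carrier G" "v \<in> carrier G"
    show "rho r (u \<otimes>\<^bsub>G\<^esub> v) = rho r u \<otimes>\<^bsub>G\<^esub> rho r v"
      using r uv by (intro G_eqI) (auto simp: rho_at K_simps)
  qed (use r in auto)
  fix v assume v: "v \<in> carrier G"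
  show "Xop w (rho r v) = rho (\<sigma> r) (Xop w v)"
  proof (rule G_eqI)
    fix b assume b: "b \<in> B"
    show "Xop w (rho r v) b = rho (\<sigma> r) (Xop w v) b"
    proof (cases "is_start b")
      case True
      then show ?thesis using b r by (simp add: Xop_start rho_at)
    next
      case False
      note p = prv_facts[OF b False]
      have "(fst (prv b) +> alpha w (prv b)) \<otimes>\<^bsub>K (prv b)\<^esub> ((fst (prv b) +> r) \<otimes>\<^bsub>K (prv b)\<^esub> v (prv b))
        = (fst (prv b) +> r) \<otimes>\<^bsub>K (prv b)\<^esub> ((fst (prv b) +> alpha w (prv b)) \<otimes>\<^bsub>K (prv b)\<^esub> v (prv b))"
        using p v r by (intro K_simps) auto
      then show ?thesis
        using b False p v r by (simp add: Xop_at rho_at sigma_from_prv)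
    qed
  qed (use r v in auto)
  show "Yop w (rho r v) = rho (tau r) (Yop w v)"
  proof (rule G_eqI)
    fix b assume b: "b \<in> B"
    show "Yop w (rho r v) b = rho (tau r) (Yop w v) b"
    proof (cases "is_end b")
      case True
      then show ?thesis using b r by (simp add: Yop_end rho_at)
    next
      case False
      note p = nxt_facts[OF b False]
      have "(fst b +> beta w b) \<otimes>\<^bsub>K b\<^esub> ((fst b +> tau r) \<otimes>\<^bsub>K b\<^esub> tau ` v (nxt b))
        = (fst b +> tau r) \<otimes>\<^bsub>K b\<^esub> ((fst b +> beta w b) \<otimes>\<^bsub>K b\<^esub> tau ` v (nxt b))"
        using b False p v r by (intro K_simps) (auto simp: tau_from_nxt)
      then show ?thesis
        using b False p v r by (simp add: Yop_at rho_at tau_from_nxt tau_coset_nxt)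
    qed
  qed (use r v in auto)
  fix s assume s: "s \<in> carrier R"
  show "rho (r \<oplus> s) v = rho r v \<otimes>\<^bsub>G\<^esub> rho s v"
    using r s v by (intro G_eqI) (auto simp: rho_at K_simps simp flip: K_coset_simps)
  show "rho (r \<otimes> s) v = rho r (rho s v)"
    using r s v by (intro G_eqI) (auto simp: rho_at K_simps simp flip: K_coset_simps)
next
  show "Xop w \<in> hom G G"
  proof (rule homI)
    fix u v assume uv: "u \<in> carrier G" "v \<in> carrier G"
    show "Xop w (u \<otimes>\<^bsub>G\<^esub> v) = Xop w u \<otimes>\<^bsub>G\<^esub> Xop w v"
    proof (rule G_eqI)
      fix b assume b: "b \<in> B"
      show "Xop w (u \<otimes>\<^bsub>G\<^esub> v) b = (Xop w u \<otimes>\<^bsub>G\<^esub> Xop w v) b"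
      proof (cases "is_start b")
        case False
        note p = prv_facts[OF b False]
        show ?thesis
          using b False p uv by (simp add: Xop_at ring.ring_simprules(23)[OF K_ring] sigma_from_prv)
      qed (use b in \<open>simp add: Xop_start\<close>)
    qed (use uv in auto)
  qed auto
  show "Yop w \<in> hom G G"
  proof (rule homI)
    fix u v assume uv: "u \<in> carrier G" "v \<in> carrier G"
    show "Yop w (u \<otimes>\<^bsub>G\<^esub> v) = Yop w u \<otimes>\<^bsub>G\<^esub> Yop w v"
    proof (rule G_eqI)
      fix b assume b: "b \<in> B"
      show "Yop w (u \<otimes>\<^bsub>G\<^esub> v) b = (Yop w u \<otimes>\<^bsub>G\<^esub> Yop w v) b"
      proof (cases "is_end b")
        case False
        note p = nxt_facts[OF b False]
        show ?thesis
          using b False p uv by (simp add: Yop_at ring.ring_simprules(23)[OF K_ring] tau_from_nxt)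
      qed (use b in \<open>simp add: Yop_end\<close>)
    qed (use uv in auto)
  qed auto
next
  fix v assume v: "v \<in> carrier G"
  show "rho \<one> v = v"
    using v by (intro G_eqI) (auto simp: rho_at K_coset_simps)
  show "Yop w (Xop w v) = rho t v"
  proof (rule G_eqI)
    fix b assume b: "b \<in> B"
    show "Yop w (Xop w v) b = rho t v b"
    proof (cases "is_end b")
      case True
      then show ?thesis
        using b v K_coset_simps(5)[of "fst b" t] by (simp add: Yop_end rho_at is_end_def t_closed)
    next
      case False
      note p = nxt_facts[OF b False]
      have "Yop w (Xop w v) b = (fst b +> beta w b) \<otimes>\<^bsub>K b\<^esub> ((fst b +> alpha w b) \<otimes>\<^bsub>K b\<^esub> v b)"
        using b False p v by (simp add: Yop_at Xop_at)
      also have "\<dots> = ((fst b +> beta w b) \<otimes>\<^bsub>K b\<^esub> (fst b +> alpha w b)) \<otimes>\<^bsub>K b\<^esub> v b"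
        using b v by (intro monoid.m_assoc[OF ring.is_monoid[OF K_ring], symmetric]) auto
      also have "\<dots> = rho t v b"
        using b v by (simp add: K_coset_simps coset_beta_alpha rho_at)
      finally show ?thesis .
    qed
  qed (use v t_closed in auto)
  show "Xop w (Yop w v) = rho (\<sigma> t) v"
  proof (rule G_eqI)
    fix b assume b: "b \<in> B"
    show "Xop w (Yop w v) b = rho (\<sigma> t) v b"
    proof (cases "is_start b")
      case True
      then have "tau ` fst b +> t = \<zero>\<^bsub>R Quot (tau ` fst b)\<^esub>"
        using b K_coset_simps(5)[of "tau ` fst b" t] by (simp add: is_start_def t_closed)
      then have "\<sigma> ` (tau ` fst b +> t) = \<sigma> ` \<zero>\<^bsub>R Quot (tau ` fst b)\<^esub>" by simp
      then have "fst b +> \<sigma> t = \<zero>\<^bsub>K b\<^esub>" using b t_closed by simp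
      then show ?thesis
        using b v True by (simp add: Xop_start rho_at)
    next
      case False
      note p = prv_facts[OF b False]
      let ?b = "prv b"
      have tv: "tau ` v b \<in> carrier (K ?b)"
        using tau_from_nxt(1)[OF p(1,2)] p(3) b v by simp
      have "Xop w (Yop w v) b = \<sigma> ` ((fst ?b +> alpha w ?b) \<otimes>\<^bsub>K ?b\<^esub> ((fst ?b +> beta w ?b) \<otimes>\<^bsub>K ?b\<^esub> tau ` v b))"
        using b False p v by (simp add: Yop_at Xop_at)
      also have "(fst ?b +> alpha w ?b) \<otimes>\<^bsub>K ?b\<^esub> ((fst ?b +> beta w ?b) \<otimes>\<^bsub>K ?b\<^esub> tau ` v b)
          = ((fst ?b +> alpha w ?b) \<otimes>\<^bsub>K ?b\<^esub> (fst ?b +> beta w ?b)) \<otimes>\<^bsub>K ?b\<^esub> tau ` v b"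
        using p tv by (intro monoid.m_assoc[OF ring.is_monoid[OF K_ring], symmetric]) auto
      also have "(fst ?b +> alpha w ?b) \<otimes>\<^bsub>K ?b\<^esub> (fst ?b +> beta w ?b) = fst ?b +> t"
        using coset_beta_alpha[OF p(1), of w] p by (simp add: K_coset_simps R.m_comm)
      also have "\<sigma> ` ((fst ?b +> t) \<otimes>\<^bsub>K ?b\<^esub> tau ` v b) = rho (\<sigma> t) v b"
        using b v p tv False by (simp add: sigma_from_prv t_closed rho_at)
      finally show ?thesis .
    qed
  qed (use v t_closed in auto)
qed

section \<open>Agreement of the prescribed action with the action in coordinates\<close>

abbreviation VX where
  "VX w \<equiv> \<lambda>v. gfinprod G (\<lambda>(\<mm>, k). V_X_single R \<sigma> t \<omega> \<mm>0 i w (v (\<mm>, k)) \<mm> k) B"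

abbreviation VY where
  "VY w \<equiv> \<lambda>v. gfinprod G (\<lambda>(\<mm>, k). V_Y_single R \<sigma> t \<omega> \<mm>0 i w (v (\<mm>, k)) \<mm> k) B"

abbreviation V_module where "V_module w \<equiv> gwa_module G rho (VX w) (VY w)"

lemma V_mod_eq: "length w = n \<Longrightarrow> V_mod R \<sigma> t \<omega> \<mm>0 i w = V_module w"
  by (simp add: V_mod_def Let_def V_basis_eq V_group_eq rho_def[abs_def] case_prod_beta')

lemmas K_m_comm = comm_monoid.m_comm[OF cring.axioms(2)[OF K_cring]]

lemma B_snd: "b \<in> B \<Longrightarrow> snd b \<le> n"
  by (auto simp: B_def simp del: B_orbit B_orbit_fst)

lemma V_X_single_eq:
  assumes "length w = n" "b \<in> B" "c \<in> carrier (K b)"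
  shows "V_X_single R \<sigma> t \<omega> \<mm>0 i w c (fst b) (snd b) =
    (if is_end b then \<one>\<^bsub>G\<^esub> else single (\<sigma> ` ((fst b +> alpha w b) \<otimes>\<^bsub>K b\<^esub> c)) (nxt b))"
proof (cases "t \<in> fst b")
  case False
  then have "\<not> is_end b" by (simp add: is_end_def)
  note p = nxt_facts[OF assms(2) this]
  have h: "\<sigma> ` c \<otimes>\<^bsub>R Quot (\<sigma> ` fst b)\<^esub> \<sigma> ` (fst b +> t) = \<sigma> ` ((fst b +> t) \<otimes>\<^bsub>K b\<^esub> c)"
    unfolding sigma_K(2)[OF B_orbit[OF assms(2)] quot_coset[OF t_closed] assms(3)]
    by (rule K_m_comm) (use assms t_closed in auto)
  show ?thesis
    using False assms
    by (simp only: V_X_single_def V_single_eq breaks_iff B_orbit is_end_def nxt_def alpha_def h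
        simp_thms if_True if_False)
next
  case True
  have "snd b \<le> n" using assms(2) by (rule B_snd)
  have h: "single (\<sigma> ` ((fst b +> \<zero>) \<otimes>\<^bsub>K b\<^esub> c)) (nxt b) = \<one>\<^bsub>G\<^esub>" if "\<not> is_end b"
    using single_zero[OF nxt_facts(1)[OF assms(2) that]] assms(2,3) by (simp add: K_coset_simps fst_nxt)
  have h': "(fst b +> \<one>) \<otimes>\<^bsub>K b\<^esub> c = c"
    using assms(2,3) by (simp add: K_coset_simps)
  then show ?thesis
  proof (cases "snd b = n")
    case True
    then show ?thesis
      using \<open>t \<in> fst b\<close> assms by (simp add: V_X_single_def V_group_eq breaks_iff is_end_def)
  next
    case False
    then have "\<not> is_end b" "snd b < length w" using \<open>snd b \<le> n\<close> assms(1) by (auto simp: is_end_def)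
    then show ?thesis
      using \<open>t \<in> fst b\<close> assms h
      by (simp add: V_X_single_def V_single_eq V_group_eq breaks_iff alpha_def h' nxt_def del: sigma_K)
  qed
qed

lemma V_Y_single_eq:
  assumes "length w = n" "b \<in> B" "c \<in> carrier (K b)"
  shows "V_Y_single R \<sigma> t \<omega> \<mm>0 i w c (fst b) (snd b) =
    (if is_start b then \<one>\<^bsub>G\<^esub>
     else single ((fst (prv b) +> beta w (prv b)) \<otimes>\<^bsub>K (prv b)\<^esub> tau ` c) (prv b))"
proof (cases "t \<in> tau ` fst b")
  case False
  then show ?thesis
    using assms
    by (simp add: V_Y_single_def V_single_eq breaks_iff is_start_def beta_def prv_def K_coset_simps)
next
  case True
  have "single ((fst (prv b) +> \<zero>) \<otimes>\<^bsub>K (prv b)\<^esub> tau ` c) (prv b) = \<one>\<^bsub>G\<^esub>" if "\<not> is_start b"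
    using single_zero[OF prv_facts(1)[OF assms(2) that]] assms by (simp add: K_coset_simps fst_prv)
  then show ?thesis
    using True assms
    by (cases "w ! (snd b - 1)")
      (auto simp: V_Y_single_def V_single_eq V_group_eq breaks_iff is_start_def beta_def prv_def K_coset_simps)
qed

lemma gfinprod_zero_at:
  assumes "finite S" "f \<in> S \<rightarrow> carrier G" "b \<in> B" "\<And>a. a \<in> S \<Longrightarrow> f a b = \<zero>\<^bsub>K b\<^esub>"
  shows "gfinprod G f S b = \<zero>\<^bsub>K b\<^esub>"
  using assms
proof (induction S rule: finite_induct)
  case (insert a S)
  then have "gfinprod G f (insert a S) = f a \<otimes>\<^bsub>G\<^esub> gfinprod G f S"
    by (subst G.gfinprod_insert) auto
  then show ?case using insert by simp
qed simp

lemma gfinprod_single_at: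
  assumes "finite S" "f \<in> S \<rightarrow> carrier G" "b \<in> B" "a \<in> S"
    and "\<And>a'. a' \<in> S \<Longrightarrow> a' \<noteq> a \<Longrightarrow> f a' b = \<zero>\<^bsub>K b\<^esub>"
  shows "gfinprod G f S b = f a b"
proof -
  have e: "gfinprod G f (insert a (S - {a})) = f a \<otimes>\<^bsub>G\<^esub> gfinprod G f (S - {a})"
    by (subst G.gfinprod_insert) (use assms in auto)
  moreover have "gfinprod G f (S - {a}) b = \<zero>\<^bsub>K b\<^esub>"
    by (rule gfinprod_zero_at) (use assms in auto)
  moreover have "f a \<in> carrier G" using assms by auto
  ultimately show ?thesis using assms(3) e unfolding insert_Diff[OF assms(4)] by simp
qed

text \<open>Read at one index, the sum over the basis has at most one nonzero term: that of the
  predecessor, and none at the start.\<close>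

lemma VX_eq:
  assumes w: "length w = n" and v: "v \<in> carrier G"
  shows "VX w v = Xop w v"
proof -
  let ?f = "\<lambda>b. if is_end b then \<one>\<^bsub>G\<^esub> else single (\<sigma> ` ((fst b +> alpha w b) \<otimes>\<^bsub>K b\<^esub> v b)) (nxt b)"
  have f: "?f \<in> B \<rightarrow> carrier G"
    using v by (auto simp: nxt_facts fst_nxt simp del: sigma_K(2) intro!: single_closed)
  have "VX w v = gfinprod G ?f B"
    by (rule G.gfinprod_cong[symmetric])
      (use f V_X_single_eq[OF w _ G_at[OF v]] in \<open>simp_all add: case_prod_beta' simp_implies_def\<close>)
  also have "\<dots> = Xop w v"
  proof (rule G_eqI)
    fix b assume b: "b \<in> B"
    show "gfinprod G ?f B b = Xop w v b"
    proof (cases "is_start b")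
      case True
      then have "?f a b = \<zero>\<^bsub>K b\<^esub>" if "a \<in> B" for a
        using nxt_facts[OF that] b by auto
      then show ?thesis using True b gfinprod_zero_at[OF finite_B f b] by (simp add: Xop_start)
    next
      case False
      note p = prv_facts[OF b False]
      have "gfinprod G ?f B b = ?f (prv b) b"
      proof (rule gfinprod_single_at[OF finite_B f b p(1)])
        fix a assume a: "a \<in> B" "a \<noteq> prv b"
        show "?f a b = \<zero>\<^bsub>K b\<^esub>" using nxt_facts[OF a(1)] a b by auto
      qed
      then show ?thesis using p b False by (simp add: Xop_at)
    qed
  qed (use v f in \<open>auto intro!: G.gfinprod_closed\<close>)
  finally show ?thesis .
qed

lemma VY_eq:
  assumes w: "length w = n" and v: "v \<in> carrier G"
  shows "VY w v = Yop w v"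
proof -
  let ?f = "\<lambda>b. if is_start b then \<one>\<^bsub>G\<^esub>
    else single ((fst (prv b) +> beta w (prv b)) \<otimes>\<^bsub>K (prv b)\<^esub> tau ` v b) (prv b)"
  have f: "?f \<in> B \<rightarrow> carrier G"
    using v by (auto simp: prv_facts fst_prv intro!: single_closed)
  have "VY w v = gfinprod G ?f B"
    by (rule G.gfinprod_cong[symmetric])
      (use f V_Y_single_eq[OF w _ G_at[OF v]] in \<open>simp_all add: case_prod_beta' simp_implies_def\<close>)
  also have "\<dots> = Yop w v"
  proof (rule G_eqI)
    fix b assume b: "b \<in> B"
    show "gfinprod G ?f B b = Yop w v b"
    proof (cases "is_end b")
      case True
      then have "?f a b = \<zero>\<^bsub>K b\<^esub>" if "a \<in> B" for a
        using prv_facts[OF that] b by auto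
      then show ?thesis using True b gfinprod_zero_at[OF finite_B f b] by (simp add: Yop_end)
    next
      case False
      note p = nxt_facts[OF b False]
      have "gfinprod G ?f B b = ?f (nxt b) b"
      proof (rule gfinprod_single_at[OF finite_B f b p(1)])
        fix a assume a: "a \<in> B" "a \<noteq> nxt b"
        show "?f a b = \<zero>\<^bsub>K b\<^esub>" using prv_facts[OF a(1)] a b by auto
      qed
      then show ?thesis using p b False by (simp add: Yop_at)
    qed
  qed (use v f in \<open>auto intro!: G.gfinprod_closed\<close>)
  finally show ?thesis .
qed

text \<open>The prescribed operators are known to equal the coordinate operators on the carrier
  only, so the relations are carried over pointwise.\<close>

lemma gwa_rep_V: "length w = n \<Longrightarrow> gwa_rep R \<sigma> t G rho (VX w) (VY w)"
proof -
  assume w: "length w = n"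
  interpret rep: gwa_rep R \<sigma> t G rho "Xop w" "Yop w" by (rule gwa_rep_op)
  have "hom G G = hom G G \<and> f \<in> hom G G" if "g \<in> hom G G" "\<And>v. v \<in> carrier G \<Longrightarrow> f v = g v" for f g
    using that by (auto simp: hom_def)
  then show ?thesis
    by (intro gwa_rep.intro gwa_rep_axioms.intro gwa_data_axioms comm_group_G)
      (use rep.rho_hom rep.X_hom rep.Y_hom in \<open>auto simp: VX_eq[OF w] VY_eq[OF w] rep.rho_add rep.rho_mult
        rep.rho_one rep.YX rep.XY rep.X_rho rep.Y_rho\<close>)
qed

end

section \<open>The finitistic dual\<close>

locale word_string = string +
  fixes star :: "'a \<Rightarrow> 'a" and w :: "letter list"
  assumes star_iso: "star \<in> ring_iso R R" and star_star: "r \<in> carrier R \<Longrightarrow> star (star r) = r"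
    and sigma_star: "r \<in> carrier R \<Longrightarrow> \<sigma> (star r) = star (\<sigma> r)"
    and star_t: "star t = t" and real: "real_orbit star \<omega>"
    and len: "length w = n"
begin

lemma len_dagger: "length (dagger w) = n"
  by (simp add: dagger_def len)

sublocale V: gwa_rep R \<sigma> t G rho "VX w" "VY w"
  by (rule gwa_rep_V[OF len])

sublocale Vd: gwa_rep R \<sigma> t G rho "VX (dagger w)" "VY (dagger w)"
  by (rule gwa_rep_V[OF len_dagger])

section \<open>The involution on the residue fields, and the group in which forms take
  values\<close>

lemma star_simps [simp]:
  "r \<in> carrier R \<Longrightarrow> star r \<in> carrier R" "star \<one> = \<one>"
  "\<lbrakk>r \<in> carrier R; s \<in> carrier R\<rbrakk> \<Longrightarrow> star (r \<otimes> s) = star r \<otimes> star s"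
  "\<lbrakk>r \<in> carrier R; s \<in> carrier R\<rbrakk> \<Longrightarrow> star (r \<oplus> s) = star r \<oplus> star s"
  "r \<in> carrier R \<Longrightarrow> star (star r) = r" "star t = t"
  using ring_iso_memE(1-4)[OF star_iso] star_star star_t by auto

lemma star_hom: "star \<in> ring_hom R R"
  using star_iso by (auto simp: ring_iso_def)

lemma star_zero [simp]: "star \<zero> = \<zero>"
  using star_hom ring_hom_zero R.ring_axioms by blast

lemma tau_star: "r \<in> carrier R \<Longrightarrow> tau (star r) = star (tau r)"
  by (metis sigma_star sigma_tau star_simps(1) tau_sigma tau_simps(1))

lemma star_image: "\<mm> \<in> \<omega> \<Longrightarrow> star ` \<mm> = \<mm>"
  using real by (simp add: real_orbit_def)

text \<open>For a real orbit the involution acts inside each residue field instead of moving it to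
  another one.\<close>

lemma star_quot_hom: "\<mm> \<in> \<omega> \<Longrightarrow> (`) star \<in> ring_hom (R Quot \<mm>) (R Quot \<mm>)"
  using image_quot_hom[OF star_hom, of \<mm>] by (simp add: orbit_ideal star_image)

lemma star_K [simp]:
  assumes "\<mm> \<in> \<omega>" "c \<in> carrier (R Quot \<mm>)"
  shows "star ` c \<in> carrier (R Quot \<mm>)"
    and "d \<in> carrier (R Quot \<mm>) \<Longrightarrow> star ` (c \<otimes>\<^bsub>R Quot \<mm>\<^esub> d) = star ` c \<otimes>\<^bsub>R Quot \<mm>\<^esub> star ` d"
    and "d \<in> carrier (R Quot \<mm>) \<Longrightarrow> star ` (c \<oplus>\<^bsub>R Quot \<mm>\<^esub> d) = star ` c \<oplus>\<^bsub>R Quot \<mm>\<^esub> star ` d"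
  using assms ring_hom_closed[OF star_quot_hom] ring_hom_mult[OF star_quot_hom]
    ring_hom_add[OF star_quot_hom] by auto

lemma star_coset [simp]:
  "\<mm> \<in> \<omega> \<Longrightarrow> r \<in> carrier R \<Longrightarrow> star ` (\<mm> +> r) = \<mm> +> star r"
  by (simp add: image_coset[OF star_hom orbit_subset] star_image)

lemma star_quot_zero [simp]: "\<mm> \<in> \<omega> \<Longrightarrow> star ` \<zero>\<^bsub>R Quot \<mm>\<^esub> = \<zero>\<^bsub>R Quot \<mm>\<^esub>"
  by (simp add: FactRing_def star_image)

lemma star_quot_one [simp]: "\<mm> \<in> \<omega> \<Longrightarrow> star ` \<one>\<^bsub>R Quot \<mm>\<^esub> = \<one>\<^bsub>R Quot \<mm>\<^esub>"
  using ring_hom_one[OF star_quot_hom] .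

abbreviation Ob where "Ob \<equiv> R_orb R \<omega>"

lemma carrier_Ob: "carrier Ob = (\<Pi>\<^sub>E \<mm>\<in>\<omega>. carrier (R Quot \<mm>))"
proof -
  have "group (add_monoid (R Quot \<mm>))" if "\<mm> \<in> \<omega>" for \<mm>
    using K_add_group that by (simp add: comm_group_def)
  then show ?thesis
    unfolding R_orb_def by (subst carrier_sum_group) (auto simp: fin)
qed

lemma Ob_at [simp]: "f \<in> carrier Ob \<Longrightarrow> \<mm> \<in> \<omega> \<Longrightarrow> f \<mm> \<in> carrier (R Quot \<mm>)"
  by (auto simp: carrier_Ob)

lemma Ob_eqI: "f \<in> carrier Ob \<Longrightarrow> g \<in> carrier Ob \<Longrightarrow> (\<And>\<mm>. \<mm> \<in> \<omega> \<Longrightarrow> f \<mm> = g \<mm>) \<Longrightarrow> f = g"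
  unfolding carrier_Ob by (rule PiE_ext)

lemma Ob_one: "\<one>\<^bsub>Ob\<^esub> = (\<lambda>\<mm>\<in>\<omega>. \<zero>\<^bsub>R Quot \<mm>\<^esub>)"
  and Ob_mult: "f \<otimes>\<^bsub>Ob\<^esub> g = (\<lambda>\<mm>\<in>\<omega>. f \<mm> \<oplus>\<^bsub>R Quot \<mm>\<^esub> g \<mm>)"
  by (simp_all add: R_orb_def)

lemma Ob_closed [simp]:
  shows "\<one>\<^bsub>Ob\<^esub> \<in> carrier Ob"
    and "f \<in> carrier Ob \<Longrightarrow> g \<in> carrier Ob \<Longrightarrow> f \<otimes>\<^bsub>Ob\<^esub> g \<in> carrier Ob"
    and "f \<in> carrier Ob \<Longrightarrow> r \<in> carrier R \<Longrightarrow> R_orb_smult R \<omega> r f \<in> carrier Ob"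
  by (simp_all add: Ob_one Ob_mult carrier_Ob R_orb_smult_def PiE_mem)

lemma aut_pow_1_fun [simp]: "aut_pow R \<sigma> 1 = \<sigma>" "aut_pow R \<sigma> (- 1) = tau"
  by auto

lemma shift_1: "R_orb_shift R \<sigma> \<omega> 1 f = (\<lambda>\<mm>\<in>\<omega>. \<sigma> ` f (tau ` \<mm>))"
  and shift_minus_1: "R_orb_shift R \<sigma> \<omega> (- 1) f = (\<lambda>\<mm>\<in>\<omega>. tau ` f (\<sigma> ` \<mm>))"
  by (simp_all add: R_orb_shift_def)

lemma shift_at: "\<mm> \<in> \<omega> \<Longrightarrow> R_orb_shift R \<sigma> \<omega> d f \<mm> = aut_pow R \<sigma> d ` f (aut_pow R \<sigma> (- d) ` \<mm>)"
  by (simp add: R_orb_shift_def)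

lemma aut_pow_image_inverse: "S \<subseteq> carrier R \<Longrightarrow> aut_pow R \<sigma> d ` aut_pow R \<sigma> (- d) ` S = S"
  using image_aut_pow_add[of S d "- d"] by (simp cong: image_cong_simp)

lemma aut_pow_quot_hom:
  assumes "\<mm> \<in> \<omega>"
  shows "(`) (aut_pow R \<sigma> d) \<in> ring_hom (R Quot (aut_pow R \<sigma> (- d) ` \<mm>)) (R Quot \<mm>)"
  using image_quot_hom[OF aut_pow_hom, of "aut_pow R \<sigma> (- d) ` \<mm>" d] assms
  by (simp add: orbit_ideal aut_pow_orbit aut_pow_image_inverse orbit_subset)

lemma shift_Ob: "f \<in> carrier Ob \<Longrightarrow> R_orb_shift R \<sigma> \<omega> d f \<in> carrier Ob"
  unfolding carrier_Ob R_orb_shift_def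
  by (auto simp: PiE_iff aut_pow_orbit intro!: ring_hom_closed[OF aut_pow_quot_hom])

section \<open>Functionals in the finitistic dual and their values on the basis\<close>

definition is_dual :: "(('a set \<times> nat \<Rightarrow> 'a set) \<Rightarrow> 'a set \<Rightarrow> 'a set) \<Rightarrow> bool" where
  "is_dual \<phi> \<longleftrightarrow> \<phi> \<in> extensional (carrier G) \<and> (\<forall>v \<in> carrier G. \<phi> v \<in> carrier Ob) \<and>
     (\<forall>u \<in> carrier G. \<forall>v \<in> carrier G. \<forall>\<mm> \<in> \<omega>. \<phi> (u \<otimes>\<^bsub>G\<^esub> v) \<mm> = \<phi> u \<mm> \<oplus>\<^bsub>R Quot \<mm>\<^esub> \<phi> v \<mm>) \<and>
     (\<forall>r \<in> carrier R. \<forall>v \<in> carrier G. \<forall>\<mm> \<in> \<omega>. \<phi> (rho r v) \<mm> = (\<mm> +> star r) \<otimes>\<^bsub>R Quot \<mm>\<^esub> \<phi> v \<mm>)"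

abbreviation D where "D \<equiv> dual_group R star \<sigma> t \<omega> V.M"

lemma is_dualD:
  assumes "is_dual \<phi>"
  shows "\<phi> \<in> extensional (carrier G)"
    and "v \<in> carrier G \<Longrightarrow> \<phi> v \<in> carrier Ob"
    and "\<lbrakk>u \<in> carrier G; v \<in> carrier G; \<mm> \<in> \<omega>\<rbrakk> \<Longrightarrow> \<phi> (u \<otimes>\<^bsub>G\<^esub> v) \<mm> = \<phi> u \<mm> \<oplus>\<^bsub>R Quot \<mm>\<^esub> \<phi> v \<mm>"
    and "\<lbrakk>r \<in> carrier R; v \<in> carrier G; \<mm> \<in> \<omega>\<rbrakk> \<Longrightarrow> \<phi> (rho r v) \<mm> = (\<mm> +> star r) \<otimes>\<^bsub>R Quot \<mm>\<^esub> \<phi> v \<mm>"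
  using assms by (auto simp: is_dual_def)

lemma carrier_D: "\<phi> \<in> carrier D \<longleftrightarrow> is_dual \<phi>"
proof -
  have hom: "\<phi> \<in> hom G Ob \<longleftrightarrow> (\<forall>v \<in> carrier G. \<phi> v \<in> carrier Ob) \<and>
     (\<forall>u \<in> carrier G. \<forall>v \<in> carrier G. \<forall>\<mm> \<in> \<omega>. \<phi> (u \<otimes>\<^bsub>G\<^esub> v) \<mm> = \<phi> u \<mm> \<oplus>\<^bsub>R Quot \<mm>\<^esub> \<phi> v \<mm>)"
    (is "?h \<longleftrightarrow> ?c \<and> ?a")
  proof
    assume ?h
    then show "?c \<and> ?a" by (auto simp: hom_def Ob_mult)
  next
    assume ca: "?c \<and> ?a"
    have "\<phi> (u \<otimes>\<^bsub>G\<^esub> v) = \<phi> u \<otimes>\<^bsub>Ob\<^esub> \<phi> v" if "u \<in> carrier G" "v \<in> carrier G" for u v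
      by (rule Ob_eqI) (use ca that in \<open>auto simp: Ob_mult carrier_Ob[THEN eqset_imp_iff]\<close>)
    then show ?h using ca by (auto simp: hom_def)
  qed
  have smult: "(\<phi> (rho r v) = R_orb_smult R \<omega> (star r) (\<phi> v)) \<longleftrightarrow>
      (\<forall>\<mm> \<in> \<omega>. \<phi> (rho r v) \<mm> = (\<mm> +> star r) \<otimes>\<^bsub>R Quot \<mm>\<^esub> \<phi> v \<mm>)"
    if "\<forall>v \<in> carrier G. \<phi> v \<in> carrier Ob" "r \<in> carrier R" "v \<in> carrier G" for r v
  proof
    assume "\<forall>\<mm> \<in> \<omega>. \<phi> (rho r v) \<mm> = (\<mm> +> star r) \<otimes>\<^bsub>R Quot \<mm>\<^esub> \<phi> v \<mm>"
    then show "\<phi> (rho r v) = R_orb_smult R \<omega> (star r) (\<phi> v)"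
      using that Ob_closed(3)[of "\<phi> v" "star r"] by (intro Ob_eqI) (auto simp: R_orb_smult_def)
  qed (simp add: R_orb_smult_def)
  \<comment> \<open>Finiteness of the orbit settles the finiteness clause of the dual.\<close>
  have "finite {\<mm> \<in> \<omega>. P \<mm>}" for P using fin by simp
  then have "\<phi> \<in> carrier D \<longleftrightarrow> \<phi> \<in> hom G Ob \<and> \<phi> \<in> extensional (carrier G) \<and>
      (\<forall>r \<in> carrier R. \<forall>v \<in> carrier G. \<phi> (rho r v) = R_orb_smult R \<omega> (star r) (\<phi> v))"
    unfolding dual_group_def hom_add_monoid_gwa_module by simp
  then show ?thesis
  proof (cases "\<forall>v \<in> carrier G. \<phi> v \<in> carrier Ob")
    case True
    show ?thesis
      unfolding \<open>\<phi> \<in> carrier D \<longleftrightarrow> _\<close> is_dual_def hom using smult[OF True] by auto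
  qed (simp add: hom is_dual_def)
qed

lemma is_dual_zero: "is_dual \<phi> \<Longrightarrow> \<mm> \<in> \<omega> \<Longrightarrow> \<phi> \<one>\<^bsub>G\<^esub> \<mm> = \<zero>\<^bsub>R Quot \<mm>\<^esub>"
  using is_dualD(4)[of \<phi> \<zero> "\<one>\<^bsub>G\<^esub>" \<mm>] is_dualD(2)[of \<phi> "\<one>\<^bsub>G\<^esub>"]
  by (simp add: V.rho_zero K_coset_simps)

abbreviation unit_vec where "unit_vec b \<equiv> single \<one>\<^bsub>K b\<^esub> b"

lemma single_eq_rho: "b \<in> B \<Longrightarrow> r \<in> carrier R \<Longrightarrow> single (fst b +> r) b = rho r (unit_vec b)"
  by (rule G_eqI) (simp_all add: rho_at)

lemma is_dual_single:
  assumes "is_dual \<phi>" "b \<in> B" "r \<in> carrier R" "\<mm> \<in> \<omega>"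
  shows "\<phi> (single (fst b +> r) b) \<mm> = (\<mm> +> star r) \<otimes>\<^bsub>R Quot \<mm>\<^esub> \<phi> (unit_vec b) \<mm>"
  using assms by (simp add: single_eq_rho is_dualD(4))

lemma orbit_separate: "\<mm> \<in> \<omega> \<Longrightarrow> \<nn> \<in> \<omega> \<Longrightarrow> \<mm> \<noteq> \<nn> \<Longrightarrow> \<exists>r \<in> \<mm>. r \<notin> \<nn>"
  by (metis maximalideal.I_maximal maximalideal.I_notcarr orbit_max orbit_ideal orbit_subset subsetI)

text \<open>Take s in the ideal of \<open>b\<close> but outside \<mm>. By reality
  \<open>star s\<close> lies in the ideal of \<open>b\<close> as well and annihilates the basis
  vector; by semilinearity s annihilates the value at \<mm>, where it is a nonzero element of a
  field.\<close>

lemma is_dual_unit_off: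
  assumes "is_dual \<phi>" "b \<in> B" "\<mm> \<in> \<omega>" "\<mm> \<noteq> fst b"
  shows "\<phi> (unit_vec b) \<mm> = \<zero>\<^bsub>R Quot \<mm>\<^esub>"
proof -
  obtain s where s: "s \<in> fst b" "s \<notin> \<mm>" using orbit_separate assms by (metis B_orbit)
  then have sR: "s \<in> carrier R" using orbit_subset assms(2) B_orbit by blast
  have "star s \<in> fst b" using star_image[of "fst b"] s(1) assms(2) by auto
  then have "fst b +> star s = \<zero>\<^bsub>K b\<^esub>" using K_coset_simps(5) sR assms(2) by simp
  then have "\<zero>\<^bsub>R Quot \<mm>\<^esub> = (\<mm> +> s) \<otimes>\<^bsub>R Quot \<mm>\<^esub> \<phi> (unit_vec b) \<mm>"
    using is_dual_single[OF assms(1,2) star_simps(1)[OF sR] assms(3)] sR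
      single_zero[OF assms(2)] is_dual_zero[OF assms(1,3)] by simp
  moreover have "\<mm> +> s \<noteq> \<zero>\<^bsub>R Quot \<mm>\<^esub>" using K_coset_simps(5)[OF assms(3) sR] s by simp
  moreover have "\<phi> (unit_vec b) \<mm> \<in> carrier (R Quot \<mm>)"
    using assms is_dualD(2) by simp
  ultimately show ?thesis
    using K_mult_eq_zero[OF assms(3)] sR by (metis quot_coset)
qed

text \<open>The stretching factor of the step from \<open>b\<close> to \<open>nxt b\<close>,
  dictated by \<open>gam_dagger\<close>: off the breaks Y contributes 1 where X has the scalar t,
  while at a break the scalar of Y for w already is that of X for the dagger word.\<close>

definition gam :: "'a set \<times> nat \<Rightarrow> 'a" where
  "gam b = (if t \<in> fst b then \<one> else t)"

lemma gam_closed [simp]: "gam b \<in> carrier R"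
  by (simp add: gam_def t_closed)

text \<open>On a segment between two breaks the dual basis differs from the basis of the module of the
  dagger word by the product of the scalars \<open>t\<close> passed so far.\<close>

primrec scale_rec :: "nat \<Rightarrow> 'a set \<times> nat \<Rightarrow> 'a set" where
  "scale_rec 0 b = \<one>\<^bsub>K b\<^esub>"
| "scale_rec (Suc p) b = \<sigma> ` ((fst (prv b) +> gam (prv b)) \<otimes>\<^bsub>K (prv b)\<^esub> scale_rec p (prv b))"

definition scale :: "'a set \<times> nat \<Rightarrow> 'a set" where
  "scale b = scale_rec (pos b) b"

lemma scale_step:
  "b \<in> B \<Longrightarrow> \<not> is_start b \<Longrightarrow> scale b = \<sigma> ` ((fst (prv b) +> gam (prv b)) \<otimes>\<^bsub>K (prv b)\<^esub> scale (prv b))"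
  by (simp add: scale_def pos_prv)

text \<open>Off the breaks t is nonzero in the residue field, so every factor is a unit and the
  rescaling can be undone.\<close>

lemma scale_unit: "b \<in> B \<Longrightarrow> scale b \<in> carrier (K b) \<and> scale b \<noteq> \<zero>\<^bsub>K b\<^esub>"
proof (induction b rule: pos_induct)
  case (start b)
  then show ?case by (simp add: scale_def pos_start K_one_not_zero)
next
  case (step b)
  have "fst (prv b) +> gam (prv b) \<noteq> \<zero>\<^bsub>K (prv b)\<^esub>"
  proof (cases "t \<in> fst (prv b)")
    case True
    then show ?thesis using step.hyps(3) by (simp add: gam_def K_coset_simps(3) K_one_not_zero)
  next
    case False
    then show ?thesis using step.hyps(3) by (simp add: gam_def K_coset_simps(5) t_closed)
  qed
  with step have "(fst (prv b) +> gam (prv b)) \<otimes>\<^bsub>K (prv b)\<^esub> scale (prv b) \<in> carrier (K (prv b))"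
    "(fst (prv b) +> gam (prv b)) \<otimes>\<^bsub>K (prv b)\<^esub> scale (prv b) \<noteq> \<zero>\<^bsub>K (prv b)\<^esub>"
    by (simp_all add: K_mult_eq_zero)
  then show ?case
    unfolding scale_step[OF step.hyps(1,2)] using sigma_from_prv(1,4)[OF step.hyps(1,2)] by blast
qed

lemma scale_closed [simp]: "b \<in> B \<Longrightarrow> scale b \<in> carrier (K b)"
  using scale_unit by blast

definition Theta :: "(('a set \<times> nat \<Rightarrow> 'a set) \<Rightarrow> 'a set \<Rightarrow> 'a set) \<Rightarrow> 'a set \<times> nat \<Rightarrow> 'a set" where
  "Theta \<phi> = (\<lambda>b\<in>B. scale b \<otimes>\<^bsub>K b\<^esub> \<phi> (unit_vec b) (fst b))"

lemma is_dual_unit_closed [simp]: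
  "is_dual \<phi> \<Longrightarrow> b \<in> B \<Longrightarrow> \<mm> \<in> \<omega> \<Longrightarrow> \<phi> (unit_vec b) \<mm> \<in> carrier (R Quot \<mm>)"
  by (simp add: is_dualD(2))

lemma Theta_closed: "is_dual \<phi> \<Longrightarrow> Theta \<phi> \<in> carrier G"
  unfolding Theta_def by (rule G_I) simp

lemma Theta_inj:
  assumes "is_dual \<phi>" "is_dual \<psi>" "Theta \<phi> = Theta \<psi>"
  shows "\<phi> = \<psi>"
proof -
  have unit: "\<phi> (unit_vec b) \<mm> = \<psi> (unit_vec b) \<mm>" if b: "b \<in> B" "\<mm> \<in> \<omega>" for b \<mm>
  proof (cases "\<mm> = fst b")
    case True
    interpret K: field "K b" using K_field b by simp
    have "scale b \<otimes>\<^bsub>K b\<^esub> \<phi> (unit_vec b) (fst b) = scale b \<otimes>\<^bsub>K b\<^esub> \<psi> (unit_vec b) (fst b)"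
      using fun_cong[OF assms(3), of b] b by (simp add: Theta_def)
    then show ?thesis
      using True scale_unit[OF b(1)] assms b K.m_lcancel by simp
  next
    case False
    then show ?thesis
      using is_dual_unit_off[OF assms(1) b] is_dual_unit_off[OF assms(2) b] by simp
  qed
  have "\<forall>\<mm>\<in>\<omega>. \<phi> v \<mm> = \<psi> v \<mm>" if "v \<in> carrier G" for v
    using that
  proof (induction rule: G_generated)
    case one
    then show ?case using is_dual_zero[OF assms(1)] is_dual_zero[OF assms(2)] by simp
  next
    case (single b c)
    then obtain r where "r \<in> carrier R" "c = fst b +> r" by (auto simp: quot_rep)
    then show ?case using single assms unit by (simp add: is_dual_single)
  next
    case (mult u v)
    then show ?case using assms by (simp add: is_dualD(3))
  qed
  then have "\<phi> v = \<psi> v" if "v \<in> carrier G" for v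
    using that assms by (intro Ob_eqI) (auto simp: is_dualD(2))
  then show ?thesis
    using extensionalityI is_dualD(1) assms by metis
qed

lemma D_mult: "\<phi> \<otimes>\<^bsub>D\<^esub> \<psi> = (\<lambda>v\<in>carrier G. \<phi> v \<otimes>\<^bsub>Ob\<^esub> \<psi> v)"
  and D_one: "\<one>\<^bsub>D\<^esub> = (\<lambda>v\<in>carrier G. \<one>\<^bsub>Ob\<^esub>)"
  by (simp_all add: dual_group_def)

lemma is_dual_D_one: "is_dual \<one>\<^bsub>D\<^esub>"
  by (simp add: is_dual_def D_one) (simp add: Ob_one)

lemma is_dual_D_mult:
  assumes "is_dual \<phi>" "is_dual \<psi>"
  shows "is_dual (\<phi> \<otimes>\<^bsub>D\<^esub> \<psi>)"
  using assms by (simp add: is_dual_def D_mult) (simp add: Ob_mult K_simps)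

lemma Theta_mult:
  assumes "is_dual \<phi>" "is_dual \<psi>"
  shows "Theta (\<phi> \<otimes>\<^bsub>D\<^esub> \<psi>) = Theta \<phi> \<otimes>\<^bsub>G\<^esub> Theta \<psi>"
  by (rule G_eqI)
    (use assms in \<open>simp_all add: Theta_closed is_dual_D_mult\<close>,
     simp add: Theta_def D_mult Ob_mult assms ring.ring_simprules(23)[OF K_ring])

lemma Theta_one: "Theta \<one>\<^bsub>D\<^esub> = \<one>\<^bsub>G\<^esub>"
  by (rule G_eqI) (simp_all add: Theta_closed is_dual_D_one, simp add: Theta_def D_one Ob_one)

text \<open>Reads one coordinate, conjugated to be star-semilinear. These functionals are the
  preimages of single entries under \<open>Theta\<close>, and they also separate vectors.\<close>

definition coord :: "'a set \<times> nat \<Rightarrow> 'a set \<Rightarrow> ('a set \<times> nat \<Rightarrow> 'a set) \<Rightarrow> 'a set \<Rightarrow> 'a set" where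
  "coord b e = (\<lambda>v\<in>carrier G. \<lambda>\<mm>\<in>\<omega>. if \<mm> = fst b then e \<otimes>\<^bsub>K b\<^esub> star ` v b else \<zero>\<^bsub>R Quot \<mm>\<^esub>)"

lemma is_dual_coord:
  assumes "b \<in> B" "e \<in> carrier (K b)"
  shows "is_dual (coord b e)"
  unfolding is_dual_def
proof (intro conjI ballI)
  interpret K: field "K b" using K_field assms by simp
  show "coord b e \<in> extensional (carrier G)" by (simp add: coord_def)
  show "coord b e v \<in> carrier Ob" if "v \<in> carrier G" for v
    using that assms by (simp add: coord_def carrier_Ob PiE_iff)
  show "coord b e (u \<otimes>\<^bsub>G\<^esub> v) \<mm> = coord b e u \<mm> \<oplus>\<^bsub>R Quot \<mm>\<^esub> coord b e v \<mm>"
    if "u \<in> carrier G" "v \<in> carrier G" "\<mm> \<in> \<omega>" for u v \<mm>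
    using that assms by (simp add: coord_def K.r_distr)
  show "coord b e (rho r v) \<mm> = (\<mm> +> star r) \<otimes>\<^bsub>R Quot \<mm>\<^esub> coord b e v \<mm>"
    if "r \<in> carrier R" "v \<in> carrier G" "\<mm> \<in> \<omega>" for r v \<mm>
    using that assms by (simp add: coord_def rho_at K.m_lcomm)
qed

lemma Theta_surj:
  assumes "u \<in> carrier G"
  shows "\<exists>\<phi>. is_dual \<phi> \<and> Theta \<phi> = u"
  using assms
proof (induction rule: G_generated)
  case one
  then show ?case using is_dual_D_one Theta_one by blast
next
  case (mult u v)
  then obtain \<phi> \<psi> where "is_dual \<phi>" "Theta \<phi> = u" "is_dual \<psi>" "Theta \<psi> = v" by blast
  then show ?case by (intro exI[of _ "\<phi> \<otimes>\<^bsub>D\<^esub> \<psi>"]) (simp add: is_dual_D_mult Theta_mult)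
next
  case (single b c)
  interpret K: field "K b" using K_field single by simp
  have su: "scale b \<in> Units (K b)" using scale_unit[OF single(1)] K.field_Units by auto
  \<comment> \<open>Dividing by the scale compensates the factor that \<open>Theta\<close> will put
    in.\<close>
  define e where "e = inv\<^bsub>K b\<^esub> scale b \<otimes>\<^bsub>K b\<^esub> c"
  have "scale b \<otimes>\<^bsub>K b\<^esub> e = (scale b \<otimes>\<^bsub>K b\<^esub> inv\<^bsub>K b\<^esub> scale b) \<otimes>\<^bsub>K b\<^esub> c"
    unfolding e_def by (rule K.m_assoc[symmetric]) (use su single in auto)
  then have e: "e \<in> carrier (K b)" "scale b \<otimes>\<^bsub>K b\<^esub> e = c"
    using su single(2) by (simp_all add: e_def)
  define \<phi> where "\<phi> = coord b e"
  have \<phi>: "\<phi> v \<mm> = (if \<mm> = fst b then e \<otimes>\<^bsub>K b\<^esub> star ` v b else \<zero>\<^bsub>R Quot \<mm>\<^esub>)"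
    if "v \<in> carrier G" "\<mm> \<in> \<omega>" for v \<mm> using that by (simp add: \<phi>_def coord_def)
  have "is_dual \<phi>" unfolding \<phi>_def by (rule is_dual_coord[OF single(1) e(1)])
  moreover have "Theta \<phi> = single c b"
  proof (rule G_eqI)
    fix b' assume b': "b' \<in> B"
    then have "scale b' \<in> carrier (K b')" by simp
    then show "Theta \<phi> b' = single c b b'"
      using b' single e
      by (cases "b' = b"; cases "fst b' = fst b") (simp_all add: Theta_def \<phi> del: scale_closed)
  qed (use \<open>is_dual \<phi>\<close> single in \<open>auto simp: Theta_closed\<close>)
  ultimately show ?case by blast
qed

section \<open>The action on the dual, compared with the module of the dagger word\<close>

abbreviation rhoD where
  "rhoD \<equiv> \<lambda>r \<phi>. \<lambda>v \<in> carrier V.M. \<phi> (cls (Scal (star r)) \<odot>\<^bsub>V.M\<^esub> v)"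
abbreviation XD where
  "XD \<equiv> \<lambda>\<phi>. \<lambda>v \<in> carrier V.M. R_orb_shift R \<sigma> \<omega> 1 (\<phi> (cls GY \<odot>\<^bsub>V.M\<^esub> v))"
abbreviation YD where
  "YD \<equiv> \<lambda>\<phi>. \<lambda>v \<in> carrier V.M. R_orb_shift R \<sigma> \<omega> (- 1) (\<phi> (cls GX \<odot>\<^bsub>V.M\<^esub> v))"

lemma finitistic_dual_eq: "finitistic_dual R star \<sigma> t \<omega> V.M = gwa_module D rhoD XD YD"
  by (simp add: finitistic_dual_def)

lemma smult_V [simp]:
  assumes "v \<in> carrier G"
  shows "cls GX \<odot>\<^bsub>V.M\<^esub> v = Xop w v" and "cls GY \<odot>\<^bsub>V.M\<^esub> v = Yop w v"
  using V.smult_gen[OF assms] VX_eq[OF len assms] VY_eq[OF len assms] by auto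

lemma XD_at: "v \<in> carrier G \<Longrightarrow> \<mm> \<in> \<omega> \<Longrightarrow> XD \<phi> v \<mm> = \<sigma> ` \<phi> (Yop w v) (tau ` \<mm>)"
  and YD_at: "v \<in> carrier G \<Longrightarrow> \<mm> \<in> \<omega> \<Longrightarrow> YD \<phi> v \<mm> = tau ` \<phi> (Xop w v) (\<sigma> ` \<mm>)"
  by (simp_all add: shift_1 shift_minus_1 VX_eq[OF len] VY_eq[OF len])

lemma XYD_closed:
  assumes "is_dual \<phi>" "v \<in> carrier G"
  shows "XD \<phi> v \<in> carrier Ob" "YD \<phi> v \<in> carrier Ob"
  using assms is_dualD(2)[OF assms(1)] by (simp_all add: shift_Ob)

lemma op_add:
  assumes "u \<in> carrier G" "v \<in> carrier G"
  shows "Xop w' (u \<otimes>\<^bsub>G\<^esub> v) = Xop w' u \<otimes>\<^bsub>G\<^esub> Xop w' v"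
    and "Yop w' (u \<otimes>\<^bsub>G\<^esub> v) = Yop w' u \<otimes>\<^bsub>G\<^esub> Yop w' v"
    and "r \<in> carrier R \<Longrightarrow> rho r (u \<otimes>\<^bsub>G\<^esub> v) = rho r u \<otimes>\<^bsub>G\<^esub> rho r v"
  using gwa_rep.X_hom[OF gwa_rep_op] gwa_rep.Y_hom[OF gwa_rep_op] gwa_rep.rho_hom[OF gwa_rep_op] assms
  by (auto simp: hom_def)

lemma op_rho:
  assumes "r \<in> carrier R" "v \<in> carrier G"
  shows "Xop w' (rho r v) = rho (\<sigma> r) (Xop w' v)" "Yop w' (rho r v) = rho (tau r) (Yop w' v)"
    and "s \<in> carrier R \<Longrightarrow> rho (s \<otimes> r) v = rho s (rho r v)"
  using gwa_rep.X_rho[OF gwa_rep_op] gwa_rep.Y_rho[OF gwa_rep_op] gwa_rep.rho_mult[OF gwa_rep_op] assms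
  by auto

lemma is_dual_rhoD:
  assumes "is_dual \<phi>" "r \<in> carrier R"
  shows "is_dual (rhoD r \<phi>)"
proof -
  note d = is_dualD[OF assms(1)]
  have "rho (star r) (rho s v) = rho s (rho (star r) v)" if "s \<in> carrier R" "v \<in> carrier G" for s v
    using that assms(2) op_rho(3)[of s v "star r"] op_rho(3)[of "star r" v s] by (simp add: R.m_comm)
  then show ?thesis
    unfolding is_dual_def using assms by (simp add: d op_add)
qed

text \<open>Semilinearity survives: Y turns r into \<open>tau r\<close>, the outer \<sigma> undoes
  this, and \<sigma> commutes with the involution.\<close>

lemma is_dual_XD:
  assumes "is_dual \<phi>"
  shows "is_dual (XD \<phi>)"
  unfolding is_dual_def
proof (intro conjI ballI)
  note d = is_dualD[OF assms]
  show "XD \<phi> \<in> extensional (carrier G)" by simp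
  show "XD \<phi> v \<in> carrier Ob" if "v \<in> carrier G" for v
    using XYD_closed[OF assms that] by simp
  fix u v \<mm> assume uv: "u \<in> carrier G" "v \<in> carrier G" and m: "\<mm> \<in> \<omega>"
  have c: "\<phi> (Yop w x) (tau ` \<mm>) \<in> carrier (R Quot (tau ` \<mm>))" if "x \<in> carrier G" for x
    using that m d(2) by (simp add: tau_orbit)
  show "XD \<phi> (u \<otimes>\<^bsub>G\<^esub> v) \<mm> = XD \<phi> u \<mm> \<oplus>\<^bsub>R Quot \<mm>\<^esub> XD \<phi> v \<mm>"
    using uv m sigma_K(3)[OF tau_orbit[OF m] c c]
    by (simp only: XD_at op_add d(3) G.m_closed Yop_closed tau_orbit sigma_tau_orbit)
  fix r assume r: "r \<in> carrier R"
  have "\<sigma> ` ((tau ` \<mm> +> star (tau r)) \<otimes>\<^bsub>R Quot (tau ` \<mm>)\<^esub> \<phi> (Yop w v) (tau ` \<mm>))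
      = (\<mm> +> star r) \<otimes>\<^bsub>R Quot \<mm>\<^esub> \<sigma> ` \<phi> (Yop w v) (tau ` \<mm>)"
    using r m tau_orbit[OF m] c[OF uv(2)] by (simp add: sigma_star)
  then show "XD \<phi> (rho r v) \<mm> = (\<mm> +> star r) \<otimes>\<^bsub>R Quot \<mm>\<^esub> XD \<phi> v \<mm>"
    using r uv m by (simp only: XD_at op_rho d(4) rho_closed' Yop_closed tau_orbit tau_simps)
qed

lemma is_dual_YD:
  assumes "is_dual \<phi>"
  shows "is_dual (YD \<phi>)"
  unfolding is_dual_def
proof (intro conjI ballI)
  note d = is_dualD[OF assms]
  show "YD \<phi> \<in> extensional (carrier G)" by simp
  show "YD \<phi> v \<in> carrier Ob" if "v \<in> carrier G" for v
    using XYD_closed[OF assms that] by simp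
  fix u v \<mm> assume uv: "u \<in> carrier G" "v \<in> carrier G" and m: "\<mm> \<in> \<omega>"
  have c: "\<phi> (Xop w x) (\<sigma> ` \<mm>) \<in> carrier (R Quot (\<sigma> ` \<mm>))" if "x \<in> carrier G" for x
    using that m d(2) by (simp add: sigma_orbit)
  show "YD \<phi> (u \<otimes>\<^bsub>G\<^esub> v) \<mm> = YD \<phi> u \<mm> \<oplus>\<^bsub>R Quot \<mm>\<^esub> YD \<phi> v \<mm>"
    using uv m tau_K(3)[OF sigma_orbit[OF m] c c]
    by (simp only: YD_at op_add d(3) G.m_closed Xop_closed sigma_orbit tau_sigma_orbit)
  fix r assume r: "r \<in> carrier R"
  have "tau ` ((\<sigma> ` \<mm> +> star (\<sigma> r)) \<otimes>\<^bsub>R Quot (\<sigma> ` \<mm>)\<^esub> \<phi> (Xop w v) (\<sigma> ` \<mm>))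
      = (\<mm> +> star r) \<otimes>\<^bsub>R Quot \<mm>\<^esub> tau ` \<phi> (Xop w v) (\<sigma> ` \<mm>)"
    using r m sigma_orbit[OF m] c[OF uv(2)] by (simp add: tau_star)
  then show "YD \<phi> (rho r v) \<mm> = (\<mm> +> star r) \<otimes>\<^bsub>R Quot \<mm>\<^esub> YD \<phi> v \<mm>"
    using r uv m by (simp only: YD_at op_rho d(4) rho_closed' Xop_closed sigma_orbit sigma_simps)
qed

lemma star_alpha_beta: "star (alpha w' b) = alpha w' b" "star (beta w' b) = beta w' b"
  by (auto simp: alpha_def beta_def)

lemma dagger_nth: "k < n \<Longrightarrow> dagger w ! k = Lx \<longleftrightarrow> w ! k \<noteq> Lx"
  by (cases "w ! k") (auto simp: dagger_def len)

text \<open>The heart of the comparison: up to \<open>gam\<close>, the arrow X of the dagger word is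
  the transpose of the arrow Y of w, and conversely. The end is excluded so that at a break there is
  a letter to look at.\<close>

lemma gam_dagger:
  assumes "b \<in> B" "\<not> is_end b"
  shows "gam b \<otimes> beta w b = alpha (dagger w) b" "beta (dagger w) b \<otimes> gam b = alpha w b"
proof -
  have "snd b < n" if "t \<in> fst b"
    using assms(2) that B_snd[OF assms(1)] by (auto simp: is_end_def)
  then show "gam b \<otimes> beta w b = alpha (dagger w) b" "beta (dagger w) b \<otimes> gam b = alpha w b"
    by (auto simp: gam_def beta_def alpha_def dagger_nth t_closed)
qed

lemma Yop_unit:
  assumes "b \<in> B"
  shows "is_start b \<Longrightarrow> Yop w (unit_vec b) = \<one>\<^bsub>G\<^esub>"
    and "\<not> is_start b \<Longrightarrow> Yop w (unit_vec b) = single (fst (prv b) +> beta w (prv b)) (prv b)"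
proof -
  have at: "Yop w (unit_vec b) b' =
      (if \<not> is_start b \<and> b' = prv b then fst b' +> beta w b' else \<zero>\<^bsub>K b'\<^esub>)" if b': "b' \<in> B" for b'
  proof (cases "is_end b'")
    case True
    then show ?thesis using assms b' prv_facts[OF assms] by (auto simp: Yop_end)
  next
    case False
    note p = nxt_facts[OF b' False]
    have iff: "nxt b' = b \<longleftrightarrow> \<not> is_start b \<and> b' = prv b" using p prv_facts[OF assms] by auto
    have "tau ` unit_vec b (nxt b') = (if nxt b' = b then \<one>\<^bsub>K b'\<^esub> else \<zero>\<^bsub>K b'\<^esub>)"
    proof (cases "b = nxt b'")
      case True
      then show ?thesis using p(1) b' by simp
    qed (use p(1) b' in \<open>simp add: eq_commute[of b]\<close>)
    then show ?thesis
      unfolding Yop_at[OF b' False] iff using b' by (cases "\<not> is_start b \<and> b' = prv b") (simp_all, blast)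
  qed
  show "is_start b \<Longrightarrow> Yop w (unit_vec b) = \<one>\<^bsub>G\<^esub>"
    using assms at by (intro G_eqI) simp_all
  show "\<not> is_start b \<Longrightarrow> Yop w (unit_vec b) = single (fst (prv b) +> beta w (prv b)) (prv b)"
    using assms at prv_facts[OF assms] by (intro G_eqI) auto
qed

lemma Xop_unit:
  assumes "b \<in> B"
  shows "is_end b \<Longrightarrow> Xop w (unit_vec b) = \<one>\<^bsub>G\<^esub>"
    and "\<not> is_end b \<Longrightarrow> Xop w (unit_vec b) = single (fst (nxt b) +> \<sigma> (alpha w b)) (nxt b)"
proof -
  have at: "Xop w (unit_vec b) b' =
      (if \<not> is_end b \<and> b' = nxt b then fst b' +> \<sigma> (alpha w b) else \<zero>\<^bsub>K b'\<^esub>)" if b': "b' \<in> B" for b'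
  proof (cases "is_start b'")
    case True
    then show ?thesis using assms b' nxt_facts[OF assms] by (auto simp: Xop_start)
  next
    case False
    note p = prv_facts[OF b' False]
    have iff: "prv b' = b \<longleftrightarrow> \<not> is_end b \<and> b' = nxt b" using p nxt_facts[OF assms] by auto
    show ?thesis
    proof (cases "prv b' = b")
      case True
      then have "\<not> is_end b \<and> b' = nxt b" using iff by simp
      then show ?thesis unfolding Xop_at[OF b' False] using True assms by (simp add: fst_nxt)
    next
      case False
      have "\<sigma> ` \<zero>\<^bsub>K (prv b')\<^esub> = \<zero>\<^bsub>K b'\<^esub>"
        using sigma_tau_zero_one[OF B_orbit[OF p(1)]] b' by simp
      then show ?thesis
        unfolding Xop_at[OF b' \<open>\<not> is_start b'\<close>] using False iff p(1) by (auto simp del: sigma_tau_zero_one)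
    qed
  qed
  show "is_end b \<Longrightarrow> Xop w (unit_vec b) = \<one>\<^bsub>G\<^esub>"
    using assms at by (intro G_eqI) simp_all
  show "\<not> is_end b \<Longrightarrow> Xop w (unit_vec b) = single (fst (nxt b) +> \<sigma> (alpha w b)) (nxt b)"
    using assms at nxt_facts[OF assms] by (intro G_eqI) auto
qed

lemma Theta_at: "b \<in> B \<Longrightarrow> Theta \<phi> b = scale b \<otimes>\<^bsub>K b\<^esub> \<phi> (unit_vec b) (fst b)"
  by (simp add: Theta_def)

lemma Theta_rho:
  assumes "is_dual \<phi>" "r \<in> carrier R"
  shows "Theta (rhoD r \<phi>) = rho r (Theta \<phi>)"
proof (rule G_eqI)
  fix b assume b: "b \<in> B"
  interpret K: field "K b" using K_field b by simp
  show "Theta (rhoD r \<phi>) b = rho r (Theta \<phi>) b"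
    using assms b is_dual_unit_closed[OF assms(1) b, of "fst b"] is_dualD(4)[OF assms(1), of "star r" "unit_vec b" "fst b"]
    by (simp add: Theta_at rho_at K.m_lcomm)
qed (use assms in \<open>auto intro!: rho_closed' Theta_closed is_dual_rhoD[simplified]\<close>)

text \<open>Y moves a basis vector to its predecessor, so X on the dual moves forward. One step of
  \<open>scale\<close> supplies the factor \<open>gam\<close>, which turns the scalar of Y for w
  into that of X for the dagger word.\<close>

lemma Theta_X:
  assumes "is_dual \<phi>"
  shows "Theta (XD \<phi>) = Xop (dagger w) (Theta \<phi>)"
proof (rule G_eqI)
  fix b assume b: "b \<in> B"
  have L: "Theta (XD \<phi>) b = scale b \<otimes>\<^bsub>K b\<^esub> \<sigma> ` \<phi> (Yop w (unit_vec b)) (tau ` fst b)"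
    using b by (simp only: Theta_at XD_at single_closed K_closed B_orbit)
  show "Theta (XD \<phi>) b = Xop (dagger w) (Theta \<phi>) b"
  proof (cases "is_start b")
    case True
    then show ?thesis
      unfolding L using b is_dual_zero[OF assms, of "tau ` fst b"] by (simp add: Xop_start Yop_unit)
  next
    case False
    note p = prv_facts[OF b False]
    interpret K: field "K (prv b)" using K_field p by simp
    let ?p = "prv b" and ?f = "\<phi> (unit_vec (prv b)) (fst (prv b))"
    have f: "?f \<in> carrier (K ?p)" using assms p by simp
    have "\<phi> (Yop w (unit_vec b)) (tau ` fst b) = (fst ?p +> beta w ?p) \<otimes>\<^bsub>K ?p\<^esub> ?f"
      using is_dual_single[OF assms p(1) alpha_beta_closed(2), of "fst ?p" w] p Yop_unit(2)[OF b False]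
      by (simp add: star_alpha_beta flip: fst_prv)
    then have "Theta (XD \<phi>) b = \<sigma> ` (((fst ?p +> gam ?p) \<otimes>\<^bsub>K ?p\<^esub> scale ?p)
        \<otimes>\<^bsub>K ?p\<^esub> ((fst ?p +> beta w ?p) \<otimes>\<^bsub>K ?p\<^esub> ?f))"
      unfolding L using b False p f
      by (simp add: scale_step sigma_from_prv del: sigma_K sigma_tau_coset)
    also have "((fst ?p +> gam ?p) \<otimes>\<^bsub>K ?p\<^esub> scale ?p) \<otimes>\<^bsub>K ?p\<^esub> ((fst ?p +> beta w ?p) \<otimes>\<^bsub>K ?p\<^esub> ?f)
      = ((fst ?p +> gam ?p) \<otimes>\<^bsub>K ?p\<^esub> (fst ?p +> beta w ?p)) \<otimes>\<^bsub>K ?p\<^esub> (scale ?p \<otimes>\<^bsub>K ?p\<^esub> ?f)"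
      using p f by (simp add: K.m_ac)
    also have "(fst ?p +> gam ?p) \<otimes>\<^bsub>K ?p\<^esub> (fst ?p +> beta w ?p) = fst ?p +> alpha (dagger w) ?p"
      using p gam_dagger(1)[OF p(1,2)] by (simp add: K_coset_simps)
    finally show ?thesis unfolding Xop_at[OF b False] Theta_at[OF p(1)] .
  qed
qed (use assms in \<open>auto intro!: Xop_closed Theta_closed is_dual_XD[simplified]\<close>)

text \<open>The transpose of X moves backward. Its scalar is split into the scalar of Y for the
  dagger word and \<open>gam\<close>, and \<open>gam\<close> is absorbed when \<open>scale\<close>
  passes from \<open>b\<close> to \<open>nxt b\<close>.\<close>

lemma Theta_Y:
  assumes "is_dual \<phi>"
  shows "Theta (YD \<phi>) = Yop (dagger w) (Theta \<phi>)"
proof (rule G_eqI)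
  fix b assume b: "b \<in> B"
  have L: "Theta (YD \<phi>) b = scale b \<otimes>\<^bsub>K b\<^esub> tau ` \<phi> (Xop w (unit_vec b)) (\<sigma> ` fst b)"
    using b by (simp only: Theta_at YD_at single_closed K_closed B_orbit)
  show "Theta (YD \<phi>) b = Yop (dagger w) (Theta \<phi>) b"
  proof (cases "is_end b")
    case True
    then show ?thesis
      unfolding L using b is_dual_zero[OF assms, of "\<sigma> ` fst b"] by (simp add: Yop_end Xop_unit)
  next
    case False
    note p = nxt_facts[OF b False]
    interpret K: field "K b" using K_field b by simp
    let ?q = "nxt b" and ?f = "\<phi> (unit_vec (nxt b)) (fst (nxt b))"
    have f: "?f \<in> carrier (K ?q)" using assms p by simp
    have tf: "tau ` ?f \<in> carrier (K b)" using tau_from_nxt(1)[OF b False f] .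
    have "\<phi> (Xop w (unit_vec b)) (\<sigma> ` fst b) = (fst ?q +> \<sigma> (alpha w b)) \<otimes>\<^bsub>K ?q\<^esub> ?f"
      using is_dual_single[OF assms p(1) sigma_simps(1)[OF alpha_beta_closed(1)], of "fst ?q" w b] p Xop_unit(2)[OF b False]
      by (simp add: star_alpha_beta flip: fst_nxt sigma_star)
    then have "Theta (YD \<phi>) b = scale b \<otimes>\<^bsub>K b\<^esub> ((fst b +> alpha w b) \<otimes>\<^bsub>K b\<^esub> tau ` ?f)"
      unfolding L using b False p f by (simp add: tau_from_nxt tau_coset_nxt del: tau_K sigma_tau_coset)
    also have "fst b +> alpha w b = (fst b +> beta (dagger w) b) \<otimes>\<^bsub>K b\<^esub> (fst b +> gam b)"
      using b gam_dagger(2)[OF b False] by (simp add: K_coset_simps)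
    also have "scale b \<otimes>\<^bsub>K b\<^esub> ((fst b +> beta (dagger w) b) \<otimes>\<^bsub>K b\<^esub> (fst b +> gam b) \<otimes>\<^bsub>K b\<^esub> tau ` ?f)
      = (fst b +> beta (dagger w) b) \<otimes>\<^bsub>K b\<^esub> (((fst b +> gam b) \<otimes>\<^bsub>K b\<^esub> scale b) \<otimes>\<^bsub>K b\<^esub> tau ` ?f)"
      using b tf by (simp add: K.m_ac)
    also have "((fst b +> gam b) \<otimes>\<^bsub>K b\<^esub> scale b) = tau ` scale ?q"
      using scale_step[OF p(1,2)] p b sigma_K(4)[of "fst b" "(fst b +> gam b) \<otimes>\<^bsub>K b\<^esub> scale b"] by (simp del: sigma_K)
    finally show ?thesis using b False p f by (simp add: Yop_at Theta_at tau_from_nxt del: tau_K)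
  qed
qed (use assms in \<open>auto intro!: Yop_closed Theta_closed is_dual_YD[simplified]\<close>)

sublocale dual: gwa_rep_iso R \<sigma> t G rho "VX (dagger w)" "VY (dagger w)" D rhoD XD YD Theta
proof (intro gwa_rep_iso.intro Vd.gwa_rep_axioms gwa_rep_iso_axioms.intro)
  show "bij_betw Theta (carrier D) (carrier G)"
  proof (rule bij_betwI')
    show "\<exists>\<phi>\<in>carrier D. u = Theta \<phi>" if "u \<in> carrier G" for u
      using Theta_surj[OF that] carrier_D by auto
  qed (auto simp: carrier_D Theta_closed intro: Theta_inj)
  fix \<phi> assume \<phi>: "\<phi> \<in> carrier D"
  then show "Theta (XD \<phi>) = VX (dagger w) (Theta \<phi>)" "Theta (YD \<phi>) = VY (dagger w) (Theta \<phi>)"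
    by (simp_all only: carrier_D Theta_X Theta_Y VX_eq[OF len_dagger] VY_eq[OF len_dagger] Theta_closed)
qed (simp_all only: carrier_D is_dual_D_mult is_dual_D_one is_dual_rhoD is_dual_XD is_dual_YD
    Theta_mult Theta_one Theta_rho Theta_closed)

lemma dual_isomorphic:
  "isomorphic_modules A (finitistic_dual R star \<sigma> t \<omega> (V_mod R \<sigma> t \<omega> \<mm>0 i w))
     (V_mod R \<sigma> t \<omega> \<mm>0 i (dagger w))"
  using dual.isomorphic unfolding V_mod_eq[OF len] V_mod_eq[OF len_dagger] finitistic_dual_eq .

end

section \<open>Weight spaces and admissible forms\<close>

context string
begin

text \<open>A maximal ideal other than that of \<open>b\<close> contains an element outside the
  ideal of \<open>b\<close>, by maximality, and this element acts on the coordinate at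
  \<open>b\<close> by a nonzero scalar of a field.\<close>

lemma weight_space_iff:
  assumes "length w = n" "\<mm> \<in> Max_ideals R"
  shows "v \<in> weight_space R \<sigma> t (V_module w) \<mm> \<longleftrightarrow>
    v \<in> carrier G \<and> (\<forall>b\<in>B. fst b \<noteq> \<mm> \<longrightarrow> v b = \<zero>\<^bsub>K b\<^esub>)"
proof -
  interpret V: gwa_rep R \<sigma> t G rho "VX w" "VY w" by (rule gwa_rep_V[OF assms(1)])
  have max: "maximalideal \<mm> R" using assms(2) by (simp add: Max_ideals_def)
  then have sub: "\<mm> \<subseteq> carrier R"
    by (simp add: maximalideal_def ideal_def additive_subgroup.a_subset)
  have "(\<forall>r\<in>\<mm>. rho r v = \<one>\<^bsub>G\<^esub>) \<longleftrightarrow> (\<forall>b\<in>B. fst b \<noteq> \<mm> \<longrightarrow> v b = \<zero>\<^bsub>K b\<^esub>)" if v: "v \<in> carrier G"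
  proof
    assume L: "\<forall>r\<in>\<mm>. rho r v = \<one>\<^bsub>G\<^esub>"
    show "\<forall>b\<in>B. fst b \<noteq> \<mm> \<longrightarrow> v b = \<zero>\<^bsub>K b\<^esub>"
    proof (intro ballI impI)
      fix b assume b: "b \<in> B" "fst b \<noteq> \<mm>"
      obtain r where r: "r \<in> \<mm>" "r \<notin> fst b"
        using maximalideal.I_maximal[OF max orbit_ideal[OF B_orbit[OF b(1)]]] b(2)
          maximalideal.I_notcarr[OF orbit_max[OF B_orbit[OF b(1)]]] orbit_subset[OF B_orbit[OF b(1)]] by blast
      have rR: "r \<in> carrier R" using r(1) sub by blast
      have "(fst b +> r) \<otimes>\<^bsub>K b\<^esub> v b = \<zero>\<^bsub>K b\<^esub>"
        using L r(1) b(1) by (metis rho_at G_one_at)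
      moreover have "fst b +> r \<noteq> \<zero>\<^bsub>K b\<^esub>"
        using K_coset_simps(5)[OF B_orbit[OF b(1)] rR] r(2) by simp
      ultimately show "v b = \<zero>\<^bsub>K b\<^esub>"
        using K_mult_eq_zero[OF B_orbit[OF b(1)] quot_coset[OF rR] G_at[OF v b(1)]] by blast
    qed
  next
    assume R: "\<forall>b\<in>B. fst b \<noteq> \<mm> \<longrightarrow> v b = \<zero>\<^bsub>K b\<^esub>"
    show "\<forall>r\<in>\<mm>. rho r v = \<one>\<^bsub>G\<^esub>"
    proof
      fix r assume r: "r \<in> \<mm>"
      then have rR: "r \<in> carrier R" using sub by blast
      show "rho r v = \<one>\<^bsub>G\<^esub>"
      proof (rule G_eqI)
        fix b assume b: "b \<in> B"
        show "rho r v b = \<one>\<^bsub>G\<^esub> b"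
        proof (cases "fst b = \<mm>")
          case True
          then have "fst b +> r = \<zero>\<^bsub>K b\<^esub>" using K_coset_simps(5)[OF B_orbit[OF b] rR] r by simp
          then show ?thesis using b v by (simp add: rho_at)
        next
          case False
          then show ?thesis using R b rR by (simp add: rho_at)
        qed
      qed (use rR v in auto)
    qed
  qed
  moreover have "(\<forall>r\<in>\<mm>. cls (Scal r) \<odot>\<^bsub>V.M\<^esub> v = \<zero>\<^bsub>V.M\<^esub>) \<longleftrightarrow> (\<forall>r\<in>\<mm>. rho r v = \<one>\<^bsub>G\<^esub>)"
    if "v \<in> carrier G"
    using sub that by (auto simp: subset_iff)
  ultimately show ?thesis
    unfolding weight_space_def mem_Collect_eq carrier_gwa_module by blast
qed

lemma finsum_V_at:
  assumes "finite S" "f \<in> S \<rightarrow> carrier G" "b \<in> B" and "M = V_module w"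
    and "\<And>\<mm>. \<mm> \<in> S \<Longrightarrow> \<mm> \<noteq> fst b \<Longrightarrow> f \<mm> b = \<zero>\<^bsub>K b\<^esub>"
  shows "abelian_monoid M \<Longrightarrow> finsum M f S b = (if fst b \<in> S then f (fst b) b else \<zero>\<^bsub>K b\<^esub>)"
  using assms
proof (induction S rule: finite_induct)
  case empty
  then interpret M: abelian_monoid M by simp
  have "\<one>\<^bsub>G\<^esub> = \<zero>\<^bsub>M\<^esub>" using empty by simp
  then show ?case using empty(3) by (simp only: M.finsum_empty) (metis G_one_at empty_iff)
next
  case (insert \<mm> S)
  interpret M: abelian_monoid M by fact
  have "finsum M f (insert \<mm> S) = f \<mm> \<otimes>\<^bsub>G\<^esub> finsum M f S"
    using insert.hyps insert.prems by (subst M.finsum_insert) (auto simp: Pi_iff)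
  then have "finsum M f (insert \<mm> S) b = f \<mm> b \<oplus>\<^bsub>K b\<^esub> finsum M f S b"
    using insert.prems by simp
  moreover have "f \<mm> b \<in> carrier (K b)" using insert.prems by (intro G_at) auto
  moreover have "finsum M f S b = (if fst b \<in> S then f (fst b) b else \<zero>\<^bsub>K b\<^esub>)"
    using insert.prems by (intro insert.IH) auto
  moreover have "f (fst b) b \<in> carrier (K b)" if "fst b \<in> S" using insert.prems that by (intro G_at) auto
  ultimately show ?case
    using insert.prems(3,5) insert.hyps by (cases "\<mm> = fst b"; cases "fst b \<in> S") simp_all
qed

text \<open>The component of weight \<mm> is the restriction of \<open>v\<close> to the indices over
  \<mm>. It is unique because at an index \<open>b\<close> only the component of weight
  \<open>fst b\<close> can contribute to a sum of weight vectors.\<close>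

lemma weight_module_V:
  assumes "length w = n"
  shows "weight_module R \<sigma> t (V_module w)"
proof -
  interpret V: gwa_rep R \<sigma> t G rho "VX w" "VY w" by (rule gwa_rep_V[OF assms])
  note ws = weight_space_iff[OF assms]
  have M: "abelian_monoid V.M"
    using V.left_module by (simp add: left_module_def abelian_group_def)
  have \<omega>Max: "\<mm> \<in> Max_ideals R" if "\<mm> \<in> \<omega>" for \<mm>
    using orbit_max[OF that] by (simp add: Max_ideals_def)
  have at: "finsum V.M f {\<mm> \<in> Max_ideals R. f \<mm> \<noteq> \<zero>\<^bsub>V.M\<^esub>} b = f (fst b) b"
    if f: "f \<in> (\<Pi>\<^sub>E \<mm> \<in> Max_ideals R. weight_space R \<sigma> t V.M \<mm>)"
      and fn: "finite {\<mm> \<in> Max_ideals R. f \<mm> \<noteq> \<zero>\<^bsub>V.M\<^esub>}" and b: "b \<in> B" for f b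
  proof -
    have "f \<mm> \<in> carrier G" "\<mm> \<noteq> fst b \<Longrightarrow> f \<mm> b = \<zero>\<^bsub>K b\<^esub>" if "\<mm> \<in> Max_ideals R" for \<mm>
      using PiE_mem[OF f that] ws[OF that] b by auto
    then have "finsum V.M f {\<mm> \<in> Max_ideals R. f \<mm> \<noteq> \<zero>\<^bsub>V.M\<^esub>} b =
        (if fst b \<in> {\<mm> \<in> Max_ideals R. f \<mm> \<noteq> \<zero>\<^bsub>V.M\<^esub>} then f (fst b) b else \<zero>\<^bsub>K b\<^esub>)"
      by (intro finsum_V_at[OF fn _ b refl _ M]) auto
    then show ?thesis using \<omega>Max[OF B_orbit[OF b]] b by auto
  qed
  show ?thesis
    unfolding weight_module_def
  proof (intro conjI ballI V.left_module)
    fix v assume "v \<in> carrier V.M"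
    then have v: "v \<in> carrier G" by simp
    define f where "f = (\<lambda>\<mm>\<in>Max_ideals R. \<lambda>b\<in>B. if fst b = \<mm> then v b else \<zero>\<^bsub>K b\<^esub>)"
    have f_closed: "f \<mm> \<in> carrier G" if "\<mm> \<in> Max_ideals R" for \<mm>
      using that v by (auto simp: f_def intro!: G_I)
    have f_at: "f \<mm> b = (if fst b = \<mm> then v b else \<zero>\<^bsub>K b\<^esub>)" if "\<mm> \<in> Max_ideals R" "b \<in> B" for \<mm> b
      using that by (simp add: f_def)
    have f_ws: "f \<in> (\<Pi>\<^sub>E \<mm> \<in> Max_ideals R. weight_space R \<sigma> t V.M \<mm>)"
    proof (rule PiE_I)
      fix \<mm> assume m: "\<mm> \<in> Max_ideals R"
      then show "f \<mm> \<in> weight_space R \<sigma> t V.M \<mm>"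
        unfolding ws[OF m] using f_closed f_at by simp
    qed (simp add: f_def)
    have f_fin: "finite {\<mm> \<in> Max_ideals R. f \<mm> \<noteq> \<zero>\<^bsub>V.M\<^esub>}"
    proof (rule finite_subset[OF _ fin], rule subsetI, rule ccontr)
      fix \<mm> assume m: "\<mm> \<in> {\<mm> \<in> Max_ideals R. f \<mm> \<noteq> \<zero>\<^bsub>V.M\<^esub>}" "\<mm> \<notin> \<omega>"
      then have "fst b \<noteq> \<mm>" if "b \<in> B" for b using that B_orbit by auto
      then have "f \<mm> = \<one>\<^bsub>G\<^esub>" using m f_closed f_at by (intro G_eqI) auto
      then show False using m by simp
    qed
    have f_sum: "v = finsum V.M f {\<mm> \<in> Max_ideals R. f \<mm> \<noteq> \<zero>\<^bsub>V.M\<^esub>}"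
    proof (rule G_eqI[OF v])
      show "finsum V.M f {\<mm> \<in> Max_ideals R. f \<mm> \<noteq> \<zero>\<^bsub>V.M\<^esub>} \<in> carrier G"
        using abelian_monoid.finsum_closed[OF M, of f "{\<mm> \<in> Max_ideals R. f \<mm> \<noteq> \<zero>\<^bsub>V.M\<^esub>}"] f_closed by auto
      show "v b = finsum V.M f {\<mm> \<in> Max_ideals R. f \<mm> \<noteq> \<zero>\<^bsub>V.M\<^esub>} b" if "b \<in> B" for b
        unfolding at[OF f_ws f_fin that] using f_at \<omega>Max that by simp
    qed
    show "\<exists>!f. f \<in> (\<Pi>\<^sub>E \<mm> \<in> Max_ideals R. weight_space R \<sigma> t V.M \<mm>) \<and>
        finite {\<mm> \<in> Max_ideals R. f \<mm> \<noteq> \<zero>\<^bsub>V.M\<^esub>} \<and>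
        v = finsum V.M f {\<mm> \<in> Max_ideals R. f \<mm> \<noteq> \<zero>\<^bsub>V.M\<^esub>}"
    proof (rule ex1I[of _ f])
      fix g assume g: "g \<in> (\<Pi>\<^sub>E \<mm> \<in> Max_ideals R. weight_space R \<sigma> t V.M \<mm>) \<and>
        finite {\<mm> \<in> Max_ideals R. g \<mm> \<noteq> \<zero>\<^bsub>V.M\<^esub>} \<and>
        v = finsum V.M g {\<mm> \<in> Max_ideals R. g \<mm> \<noteq> \<zero>\<^bsub>V.M\<^esub>}"
      show "g = f"
      proof (rule PiE_ext)
        show "g \<in> (\<Pi>\<^sub>E \<mm> \<in> Max_ideals R. weight_space R \<sigma> t V.M \<mm>)" using g by blast
        show "f \<in> (\<Pi>\<^sub>E \<mm> \<in> Max_ideals R. weight_space R \<sigma> t V.M \<mm>)" by (rule f_ws)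
        fix \<mm> assume m: "\<mm> \<in> Max_ideals R"
        have gm: "g \<mm> \<in> carrier G" "\<And>b. b \<in> B \<Longrightarrow> fst b \<noteq> \<mm> \<Longrightarrow> g \<mm> b = \<zero>\<^bsub>K b\<^esub>"
          using PiE_mem[of g "Max_ideals R", OF _ m] g ws[OF m] by auto
        show "g \<mm> = f \<mm>"
        proof (rule G_eqI[OF gm(1) f_closed[OF m]])
          fix b assume b: "b \<in> B"
          have "v b = g (fst b) b" using g at[of g b] b by metis
          then show "g \<mm> b = f \<mm> b" using f_at[OF m b] gm(2)[OF b] by auto
        qed
      qed
    qed (use f_ws f_fin f_sum in blast)
  qed
qed

lemma weight_support_V:
  assumes "length w = n"
  shows "weight_support R \<sigma> t (V_module w) \<subseteq> \<omega>"
proof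
  fix \<mm> assume "\<mm> \<in> weight_support R \<sigma> t (V_module w)"
  then have m: "\<mm> \<in> Max_ideals R" "weight_space R \<sigma> t (V_module w) \<mm> \<noteq> {\<one>\<^bsub>G\<^esub>}"
    by (auto simp: weight_support_def)
  show "\<mm> \<in> \<omega>"
  proof (rule ccontr)
    assume "\<mm> \<notin> \<omega>"
    then have ne: "fst b \<noteq> \<mm>" if "b \<in> B" for b using that B_orbit by auto
    have "v = \<one>\<^bsub>G\<^esub>" if "v \<in> weight_space R \<sigma> t (V_module w) \<mm>" for v
      using that weight_space_iff[OF assms m(1)] ne by (intro G_eqI) auto
    moreover have "\<one>\<^bsub>G\<^esub> \<in> weight_space R \<sigma> t (V_module w) \<mm>"
      using weight_space_iff[OF assms m(1)] by simp
    ultimately show False using m(2) by blast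
  qed
qed

end

section \<open>The involution of the algebra and the form of the empty word\<close>

context word_string
begin

lemma gterm_star_gterms: "a \<in> gterms R \<Longrightarrow> gterm_star star a \<in> gterms R"
  by (induction rule: gterms.induct) (auto intro: gterms.intros)

text \<open>The relations for \<open>YX\<close> and \<open>XY\<close> are each carried to
  themselves, because t and \<sigma>(t) are fixed by the involution, while the commutation rules of
  X and of Y with scalars are exchanged. Products of scalars are reversed, which commutativity of R
  repairs.\<close>

lemma gwa_eq_star: "gwa_eq R \<sigma> t a b \<Longrightarrow> gwa_eq R \<sigma> t (gterm_star star a) (gterm_star star b)"
proof (induction rule: gwa_eq.induct)
  case (gwa_mul_assoc a b c)
  then show ?case by (auto intro: gwa_sym gwa_eq.gwa_mul_assoc gterm_star_gterms)
next
  case (gwa_scal_mul r s)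
  then show ?case using gwa_eq.gwa_scal_mul[of "star s" R "star r"] by (simp add: R.m_comm)
next
  case gwa_XY
  have "star (\<sigma> t) = \<sigma> t" using sigma_star[OF t_closed] by simp
  then show ?case by (simp add: gwa_eq.gwa_XY)
next
  case (gwa_X_scal r)
  then have "tau (star (\<sigma> r)) = star r" by (simp add: sigma_star[symmetric])
  then show ?case using gwa_X_scal gwa_eq.gwa_Y_scal[of "star (\<sigma> r)" R \<sigma> t] by (simp add: gwa_sym)
next
  case (gwa_Y_scal r)
  then have "\<sigma> (star (tau r)) = star r" by (simp add: sigma_star)
  then show ?case using gwa_Y_scal gwa_eq.gwa_X_scal[of "star (tau r)" R \<sigma> t] by (simp add: gwa_sym)
qed (auto intro: gwa_eq.intros gterm_star_gterms)

lemma gwa_star_cls: "a \<in> gterms R \<Longrightarrow> gwa_star R star \<sigma> t (cls a) = cls (gterm_star star a)"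
proof -
  assume a: "a \<in> gterms R"
  have "cls (gterm_star star b) = cls (gterm_star star a)" if "b \<in> cls a" for b
    using that gwa_eq_star by (intro cls_eqI[symmetric]) (auto simp: gwa_class_def)
  moreover have "a \<in> cls a" using a by (simp add: gwa_class_def gwa_refl)
  ultimately show ?thesis unfolding gwa_star_def by blast
qed

lemma shift_0: "f \<in> carrier Ob \<Longrightarrow> R_orb_shift R \<sigma> \<omega> 0 f = f"
  by (rule Ob_eqI) (simp_all add: shift_Ob, simp add: shift_at cong: image_cong_simp)

lemma shift_shift:
  assumes "f \<in> carrier Ob"
  shows "R_orb_shift R \<sigma> \<omega> d (R_orb_shift R \<sigma> \<omega> e f) = R_orb_shift R \<sigma> \<omega> (d + e) f"
proof (rule Ob_eqI)
  fix \<mm> assume m: "\<mm> \<in> \<omega>"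
  note sub = K_subset[OF aut_pow_orbit[OF m] Ob_at[OF assms aut_pow_orbit[OF m]]]
  have "- d - e = - e + - d" by simp
  then have "aut_pow R \<sigma> (- e) ` aut_pow R \<sigma> (- d) ` \<mm> = aut_pow R \<sigma> (- d - e) ` \<mm>"
    using image_aut_pow_add[OF orbit_subset[OF m], of "- e" "- d"] by metis
  then show "R_orb_shift R \<sigma> \<omega> d (R_orb_shift R \<sigma> \<omega> e f) \<mm> = R_orb_shift R \<sigma> \<omega> (d + e) f \<mm>"
    using m image_aut_pow_add[OF sub] by (simp add: shift_at aut_pow_orbit)
qed (simp_all add: shift_Ob assms)

lemma shift_hom: "R_orb_shift R \<sigma> \<omega> d \<in> hom Ob Ob"
proof (rule homI)
  fix f g assume fg: "f \<in> carrier Ob" "g \<in> carrier Ob"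
  show "R_orb_shift R \<sigma> \<omega> d (f \<otimes>\<^bsub>Ob\<^esub> g) = R_orb_shift R \<sigma> \<omega> d f \<otimes>\<^bsub>Ob\<^esub> R_orb_shift R \<sigma> \<omega> d g"
  proof (rule Ob_eqI)
    fix \<mm> assume "\<mm> \<in> \<omega>"
    then show "R_orb_shift R \<sigma> \<omega> d (f \<otimes>\<^bsub>Ob\<^esub> g) \<mm> = (R_orb_shift R \<sigma> \<omega> d f \<otimes>\<^bsub>Ob\<^esub> R_orb_shift R \<sigma> \<omega> d g) \<mm>"
      using fg ring_hom_add[OF aut_pow_quot_hom] by (simp add: shift_at Ob_mult aut_pow_orbit)
  qed (intro shift_Ob Ob_closed fg)+
qed (simp add: shift_Ob)

lemma group_Ob: "group Ob"
  unfolding R_orb_def using K_add_group by (intro sum_group) (simp add: comm_group_def)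

lemma eval_D_hom: "u \<in> carrier G \<Longrightarrow> (\<lambda>\<phi>. \<phi> u) \<in> hom D Ob"
  by (rule homI) (auto simp: carrier_D is_dualD(2) D_mult)

lemma dual_hom: "is_dual \<phi> \<Longrightarrow> \<phi> \<in> hom G Ob"
  using carrier_D[of \<phi>] unfolding dual_group_def hom_add_monoid_gwa_module by simp

text \<open>The source of admissibility. Products work because the involution reverses factors, as
  successive actions on a functional do, and shifts add up like degrees.\<close>

lemma act_dual:
  "gterm_homogeneous R a d \<Longrightarrow> is_dual \<phi> \<Longrightarrow> u \<in> carrier G \<Longrightarrow>
    dual.H.act a \<phi> u = R_orb_shift R \<sigma> \<omega> d (\<phi> (V.act (gterm_star star a) u))"
proof (induction arbitrary: \<phi> u rule: gterm_homogeneous.induct)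
  case (1 r)
  then show ?case by (simp add: shift_0 is_dualD(2))
next
  case (4 a d)
  note a = gterm_homogeneous_gterms[OF 4(1)]
  let ?x = "V.act (gterm_star star a) u"
  have x: "?x \<in> carrier G" using gterm_star_gterms[OF a] 4(4) by simp
  \<comment> \<open>A negative passes through the evaluation at \<open>u\<close>, the shift and
    \<phi>, since each of them is a group homomorphism.\<close>
  have ev: "group_hom D Ob (\<lambda>\<psi>. \<psi> u)" and sh: "group_hom Ob Ob (R_orb_shift R \<sigma> \<omega> d)"
    and ph: "group_hom G Ob \<phi>"
    by (intro group_hom.intro group_hom_axioms.intro dual.H.G.is_group G.is_group group_Ob
        eval_D_hom shift_hom dual_hom 4)+
  have "(inv\<^bsub>D\<^esub> dual.H.act a \<phi>) u = inv\<^bsub>Ob\<^esub> (dual.H.act a \<phi> u)"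
    by (rule group_hom.hom_inv[OF ev dual.H.act_closed[OF a]]) (use 4(3) carrier_D in blast)
  also have "\<dots> = inv\<^bsub>Ob\<^esub> (R_orb_shift R \<sigma> \<omega> d (\<phi> ?x))"
    by (simp only: 4(2)[OF 4(3,4)])
  also have "\<dots> = R_orb_shift R \<sigma> \<omega> d (inv\<^bsub>Ob\<^esub> (\<phi> ?x))"
    by (rule group_hom.hom_inv[OF sh is_dualD(2)[OF 4(3) x], symmetric])
  also have "\<dots> = R_orb_shift R \<sigma> \<omega> d (\<phi> (inv\<^bsub>G\<^esub> ?x))"
    by (simp only: group_hom.hom_inv[OF ph x])
  finally show ?case by (simp only: gterm_act.simps gterm_star.simps)
next
  case (5 a d b)
  note ab = gterm_homogeneous_gterms[OF 5(1)] gterm_homogeneous_gterms[OF 5(2)]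
  then show ?case
    using 5 dual_hom[OF 5(5)] gterm_star_gterms[OF ab(1)] gterm_star_gterms[OF ab(2)] hom_mult[OF shift_hom]
    by (simp add: D_mult is_dualD(2) hom_mult[OF dual_hom])
next
  case (6 a d b e)
  note ab = gterm_homogeneous_gterms[OF 6(1)] gterm_homogeneous_gterms[OF 6(2)]
  have "is_dual (dual.H.act b \<phi>)" using dual.H.act_closed[OF ab(2)] 6(5) carrier_D by blast
  then have "dual.H.act a (dual.H.act b \<phi>) u = R_orb_shift R \<sigma> \<omega> d (dual.H.act b \<phi> (V.act (gterm_star star a) u))"
    using 6(6) by (rule 6(3))
  also have "\<dots> = R_orb_shift R \<sigma> \<omega> d (R_orb_shift R \<sigma> \<omega> e (\<phi> (V.act (gterm_star star b) (V.act (gterm_star star a) u))))"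
    by (intro arg_cong[where f = "R_orb_shift R \<sigma> \<omega> d"] 6(4,5) V.act_closed gterm_star_gterms ab 6(6))
  also have "\<dots> = R_orb_shift R \<sigma> \<omega> (d + e) (\<phi> (V.act (gterm_star star b) (V.act (gterm_star star a) u)))"
    by (intro shift_shift is_dualD(2)[OF 6(5)] V.act_closed gterm_star_gterms ab 6(6))
  finally show ?case by (simp only: gterm_act.simps gterm_star.simps)
qed auto

text \<open>The inverse of \<open>Theta\<close>, read as a function of two vectors. When the dagger
  fixes w it is A-linear in the first one.\<close>

definition form where "form v = inv_into (carrier D) Theta v"

lemma form_facts:
  assumes "v \<in> carrier G"
  shows "is_dual (form v)" "Theta (form v) = v"
  using Theta_surj[OF assms] carrier_D inv_into_into[of v Theta "carrier D"] f_inv_into_f[of v Theta "carrier D"]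
  unfolding form_def by auto

lemma form_eqI: "is_dual \<phi> \<Longrightarrow> Theta \<phi> = v \<Longrightarrow> v \<in> carrier G \<Longrightarrow> form v = \<phi>"
  using form_facts Theta_inj by metis

text \<open>Admissibility is A-linearity of \<open>form\<close> combined with
  \<open>act_dual\<close>. Non-degeneracy in the first argument is injectivity of
  \<open>form\<close>; in the second it is surjectivity, as the functionals \<open>form u\<close>
  then include all coordinate functionals.\<close>

lemma pseudo_unitarizable_Nil:
  assumes "w = []"
  shows "pseudo_unitarizable R star \<sigma> t \<omega> V.M"
proof -
  have w: "dagger w = w" using assms by (simp add: dagger_def)
  have form_mult: "form (u \<otimes>\<^bsub>G\<^esub> v) = form u \<otimes>\<^bsub>D\<^esub> form v" if "u \<in> carrier G" "v \<in> carrier G" for u v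
    using that by (intro form_eqI) (auto simp: form_facts is_dual_D_mult Theta_mult)
  have form_act: "form (V.act a v) = dual.H.act a (form v)" if "a \<in> gterms R" "v \<in> carrier G" for a v
    using that dual.H.act_closed[OF that(1)] dual.theta_act[OF that(1)] w
    by (intro form_eqI) (auto simp: form_facts carrier_D)
  have adm: "admissible_form R star \<sigma> t \<omega> V.M form"
    unfolding admissible_form_def hom_add_monoid_gwa_module
  proof (intro conjI ballI allI)
    show "(\<lambda>v. form v u) \<in> hom G Ob" if "u \<in> carrier V.M" for u
      using that by (intro homI) (auto simp: form_mult D_mult form_facts is_dualD(2)[OF form_facts(1)])
    show "(\<lambda>u. form v u) \<in> hom G Ob" if "v \<in> carrier V.M" for v
      using that dual_hom[OF form_facts(1)] by simp
    show "form (cls (Scal r) \<odot>\<^bsub>V.M\<^esub> v) u = R_orb_smult R \<omega> r (form v u)"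
      if "r \<in> carrier R" "v \<in> carrier V.M" "u \<in> carrier V.M" for r v u
    proof -
      have "form (V.act (Scal r) v) u = form v (rho (star r) u)"
        using that form_act[of "Scal r" v] by (simp add: gterms.intros)
      then have e: "form (rho r v) u = form v (rho (star r) u)" by simp
      have "form v (rho (star r) u) = R_orb_smult R \<omega> r (form v u)"
        using that is_dualD(2,4)[OF form_facts(1)[of v]] Ob_closed(3)[of "form v u" r]
        by (intro Ob_eqI) (simp_all add: R_orb_smult_def)
      then show ?thesis using that e by simp
    qed
    fix d a v u
    assume a: "a \<in> gwa_component R \<sigma> t d" and vu: "v \<in> carrier V.M" "u \<in> carrier V.M"
    obtain b where b: "gterm_homogeneous R b d" "a = cls b" using a by (auto simp: gwa_component_def)
    note bg = gterm_homogeneous_gterms[OF b(1)]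
    show "form (a \<odot>\<^bsub>V.M\<^esub> v) u = R_orb_shift R \<sigma> \<omega> d (form v (gwa_star R star \<sigma> t a \<odot>\<^bsub>V.M\<^esub> u))"
      using vu bg gterm_star_gterms[OF bg] act_dual[OF b(1) form_facts(1)]
      by (simp add: b(2) gwa_star_cls V.smult_cls form_act)
  qed
  have "nondegenerate_form R \<omega> V.M form"
    unfolding nondegenerate_form_def
  proof (intro ballI impI)
    fix v assume "v \<in> carrier V.M" "v \<noteq> \<zero>\<^bsub>V.M\<^esub>"
    then have v: "v \<in> carrier G" "v \<noteq> \<one>\<^bsub>G\<^esub>" by auto
    have "\<exists>u\<in>carrier G. form v u \<noteq> \<one>\<^bsub>Ob\<^esub>"
    proof (rule ccontr)
      assume "\<not> ?thesis"
      then have "form v = \<one>\<^bsub>D\<^esub>"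
        by (intro extensionalityI[OF is_dualD(1)[OF form_facts(1)[OF v(1)]] is_dualD(1)[OF is_dual_D_one]])
          (simp add: D_one)
      then show False using form_facts(2)[OF v(1)] Theta_one v(2) by simp
    qed
    then obtain u where u: "u \<in> carrier G" "form v u \<noteq> \<one>\<^bsub>Ob\<^esub>" by blast
    obtain b where b: "b \<in> B" "v b \<noteq> \<zero>\<^bsub>K b\<^esub>"
      using v G_eqI[of v "\<one>\<^bsub>G\<^esub>"] by auto
    have du: "is_dual (coord b \<one>\<^bsub>K b\<^esub>)" using b by (intro is_dual_coord) auto
    have "star ` star ` v b = v b"
      using K_subset[OF B_orbit[OF b(1)] G_at[OF v(1) b(1)]] by (force simp: image_image subset_iff)
    then have "star ` v b \<noteq> \<zero>\<^bsub>K b\<^esub>" using b star_quot_zero[OF B_orbit[OF b(1)]] by metis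
    then have "coord b \<one>\<^bsub>K b\<^esub> v (fst b) \<noteq> \<one>\<^bsub>Ob\<^esub> (fst b)"
      using b v by (simp add: coord_def Ob_one)
    then have "coord b \<one>\<^bsub>K b\<^esub> v \<noteq> \<one>\<^bsub>Ob\<^esub>" by metis
    moreover have "form (Theta (coord b \<one>\<^bsub>K b\<^esub>)) = coord b \<one>\<^bsub>K b\<^esub>"
      using du by (intro form_eqI) (auto simp: Theta_closed)
    ultimately have "form (Theta (coord b \<one>\<^bsub>K b\<^esub>)) v \<noteq> \<one>\<^bsub>Ob\<^esub>" by metis
    moreover have "Theta (coord b \<one>\<^bsub>K b\<^esub>) \<in> carrier V.M" "u \<in> carrier V.M"
      using u(1) Theta_closed[OF du] by simp_all
    ultimately show "\<exists>w1\<in>carrier V.M. \<exists>w2\<in>carrier V.M. form w1 v \<noteq> \<one>\<^bsub>Ob\<^esub> \<and> form v w2 \<noteq> \<one>\<^bsub>Ob\<^esub>"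
      using u(2) by blast
  qed
  then show ?thesis
    unfolding pseudo_unitarizable_def using adm weight_module_V[OF len] weight_support_V[OF len] by blast
qed

end

section \<open>Non-isomorphism and simplicity\<close>

context string
begin

lemma Xpow_closed [simp]: "v \<in> carrier G \<Longrightarrow> (Xop w ^^ q) v \<in> carrier G"
  and Ypow_closed [simp]: "v \<in> carrier G \<Longrightarrow> (Yop w ^^ q) v \<in> carrier G"
  by (induction q) auto

lemma Xop_eq_zero:
  assumes "v \<in> carrier G" "b \<in> B" "\<not> is_start b \<Longrightarrow> v (prv b) = \<zero>\<^bsub>K (prv b)\<^esub>"
  shows "Xop w v b = \<zero>\<^bsub>K b\<^esub>"
proof (cases "is_start b")
  case False
  note p = prv_facts[OF assms(2) False]
  have "(fst (prv b) +> alpha w (prv b)) \<otimes>\<^bsub>K (prv b)\<^esub> v (prv b) = \<zero>\<^bsub>K (prv b)\<^esub>"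
    using assms(3)[OF False] p by simp
  then show ?thesis
    unfolding Xop_at[OF assms(2) False] using sigma_from_prv(4)[OF assms(2) False] p(1) assms(2) by simp
qed (simp add: Xop_start assms)

lemma Xop_nonzero:
  assumes "v \<in> carrier G" "b \<in> B" "\<not> is_start b" "v (prv b) \<noteq> \<zero>\<^bsub>K (prv b)\<^esub>" "alpha w (prv b) \<notin> fst (prv b)"
  shows "Xop w v b \<noteq> \<zero>\<^bsub>K b\<^esub>"
proof -
  note p = prv_facts[OF assms(2,3)]
  have "fst (prv b) +> alpha w (prv b) \<noteq> \<zero>\<^bsub>K (prv b)\<^esub>"
    using assms(5) K_coset_simps(5)[OF B_orbit[OF p(1)]] by simp
  then have "(fst (prv b) +> alpha w (prv b)) \<otimes>\<^bsub>K (prv b)\<^esub> v (prv b) \<noteq> \<zero>\<^bsub>K (prv b)\<^esub>"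
    using assms(1,4) p(1) K_mult_eq_zero[OF B_orbit[OF p(1)]] by simp
  moreover have "(fst (prv b) +> alpha w (prv b)) \<otimes>\<^bsub>K (prv b)\<^esub> v (prv b) \<in> carrier (K (prv b))"
    using assms(1) p(1) by simp
  ultimately show ?thesis
    unfolding Xop_at[OF assms(2,3)] using sigma_from_prv(4)[OF assms(2,3)] by blast
qed

lemma Yop_eq_zero:
  assumes "v \<in> carrier G" "b \<in> B" "\<not> is_end b \<Longrightarrow> v (nxt b) = \<zero>\<^bsub>K (nxt b)\<^esub>"
  shows "Yop w v b = \<zero>\<^bsub>K b\<^esub>"
proof (cases "is_end b")
  case False
  note p = nxt_facts[OF assms(2) False]
  have "tau ` v (nxt b) = \<zero>\<^bsub>K b\<^esub>"
    using assms(2,3) False tau_from_nxt(4)[OF assms(2) False, of "v (nxt b)"] p(1) by simp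
  then show ?thesis using assms(2) by (simp add: Yop_at[OF assms(2) False])
qed (simp add: Yop_end assms)

lemma one_in_ideal: "b \<in> B \<Longrightarrow> \<one> \<notin> fst b"
  using K_coset_simps(3,5)[OF B_orbit] K_one_not_zero[OF B_orbit] R.one_closed by metis

lemma pos_nxt: "b \<in> B \<Longrightarrow> \<not> is_end b \<Longrightarrow> pos (nxt b) = Suc (pos b)"
  using pos_prv[OF nxt_facts(1,2)] nxt_facts(3) by simp

lemma Xpow_behind: "v \<in> carrier G \<Longrightarrow> b \<in> B \<Longrightarrow> pos b < q \<Longrightarrow> (Xop w ^^ q) v b = \<zero>\<^bsub>K b\<^esub>"
proof (induction q arbitrary: b)
  case (Suc q)
  have "Xop w ((Xop w ^^ q) v) b = \<zero>\<^bsub>K b\<^esub>"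
  proof (rule Xop_eq_zero)
    assume s: "\<not> is_start b"
    show "(Xop w ^^ q) v (prv b) = \<zero>\<^bsub>K (prv b)\<^esub>"
      by (rule Suc.IH) (use Suc.prems s prv_facts[OF Suc.prems(2) s] pos_prv[OF Suc.prems(2) s] in auto)
  qed (use Suc.prems in auto)
  then show ?case by simp
qed simp

lemma Xpow_start_off:
  assumes "e \<in> carrier G" "\<And>b. b \<in> B \<Longrightarrow> \<not> is_start b \<Longrightarrow> e b = \<zero>\<^bsub>K b\<^esub>"
  shows "b \<in> B \<Longrightarrow> pos b \<noteq> q \<Longrightarrow> (Xop w ^^ q) e b = \<zero>\<^bsub>K b\<^esub>"
proof (induction q arbitrary: b)
  case 0
  then show ?case using assms(2) pos_eq_0 by simp
next
  case (Suc q)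
  have "Xop w ((Xop w ^^ q) e) b = \<zero>\<^bsub>K b\<^esub>"
  proof (rule Xop_eq_zero)
    assume s: "\<not> is_start b"
    show "(Xop w ^^ q) e (prv b) = \<zero>\<^bsub>K (prv b)\<^esub>"
      by (rule Suc.IH) (use Suc.prems s prv_facts[OF Suc.prems(1) s] pos_prv[OF Suc.prems(1) s] in auto)
  qed (use Suc.prems assms in auto)
  then show ?case by simp
qed

text \<open>On the way to an index of level 0 no break is crossed, so each scalar of X met there is
  t at an ideal that does not contain it.\<close>

lemma Xpow_start_on:
  assumes "e \<in> carrier G" "\<And>b. b \<in> B \<Longrightarrow> is_start b \<Longrightarrow> e b \<noteq> \<zero>\<^bsub>K b\<^esub>"
  shows "b \<in> B \<Longrightarrow> snd b = 0 \<Longrightarrow> (Xop w ^^ pos b) e b \<noteq> \<zero>\<^bsub>K b\<^esub>"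
proof (induction b rule: pos_induct)
  case (start b)
  then show ?case using assms(2) pos_start by simp
next
  case (step b)
  have nt: "t \<notin> fst (prv b)" using step by (auto simp: is_start_def fst_prv)
  have "snd (prv b) = 0" using step.prems by (simp add: prv_def)
  from step.IH[OF this] have "(Xop w ^^ pos (prv b)) e (prv b) \<noteq> \<zero>\<^bsub>K (prv b)\<^esub>" .
  then have "Xop w ((Xop w ^^ pos (prv b)) e) b \<noteq> \<zero>\<^bsub>K b\<^esub>"
    using step nt assms(1) by (intro Xop_nonzero) (auto simp: alpha_def)
  then show ?case using pos_prv[OF step.hyps(1,2)] by simp
qed

lemma first_break_vec: "(bseq i, 0) \<in> B" "t \<in> bseq i"
  using break_seq_breaks[of i] first_break_break[of "bseq i"]
  by (simp_all add: B_def breaks_def del: B_orbit_fst)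

text \<open>The first letter is visible in the module: the start vector is killed by \<open>Y\<close>, and whether
  the power of \<open>X\<close> carrying it across the first break is hit by one more power of \<open>X\<close> depends on
  that letter.\<close>

lemma first_letter_invariant:
  assumes "n > 0" "w ! 0 = Lx" "w' ! 0 = Ly"
    and g: "bij_betw g (carrier G) (carrier G)" "g \<one>\<^bsub>G\<^esub> = \<one>\<^bsub>G\<^esub>"
    and gX: "\<And>v. v \<in> carrier G \<Longrightarrow> g (Xop w v) = Xop w' (g v)"
    and gY: "\<And>v. v \<in> carrier G \<Longrightarrow> g (Yop w v) = Yop w' (g v)"
  shows False
proof -
  \<comment> \<open>\<open>b0\<close> is the break at which level 0 ends; \<open>b1\<close> will be
    the first index of level 1.\<close>
  define b0 where "b0 = (bseq i, 0::nat)"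
  have b0: "b0 \<in> B" "t \<in> fst b0" "snd b0 = 0" "\<not> is_end b0"
    using first_break_vec assms(1) by (auto simp: b0_def is_end_def)
  define b1 where "b1 = nxt b0"
  note n0 = nxt_facts[OF b0(1,4), folded b1_def]
  define q where "q = pos b0"
  have q: "pos b1 = Suc q" using pos_nxt[OF b0(1,4)] by (simp add: b1_def q_def)
  have g_closed: "v \<in> carrier G \<Longrightarrow> g v \<in> carrier G" for v
    using g(1) by (auto simp: bij_betw_def)
  define v where "v = (\<lambda>b\<in>B. if is_start b then \<one>\<^bsub>K b\<^esub> else \<zero>\<^bsub>K b\<^esub>)"
  have v: "v \<in> carrier G" unfolding v_def by (rule G_I) simp
  have v_at: "v b = (if is_start b then \<one>\<^bsub>K b\<^esub> else \<zero>\<^bsub>K b\<^esub>)" if "b \<in> B" for b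
    using that by (simp add: v_def)
  have "(Xop w ^^ q) v b0 \<noteq> \<zero>\<^bsub>K b0\<^esub>"
    unfolding q_def using v v_at b0 K_one_not_zero by (intro Xpow_start_on) auto
  then have "Xop w ((Xop w ^^ q) v) b1 \<noteq> \<zero>\<^bsub>K b1\<^esub>"
    using v n0 b0 assms(2) one_in_ideal[OF b0(1)] by (intro Xop_nonzero) (auto simp: alpha_def)
  then have nz: "(Xop w ^^ Suc q) v b1 \<noteq> \<zero>\<^bsub>K b1\<^esub>" by simp
  have "Yop w v = \<one>\<^bsub>G\<^esub>"
  proof (rule G_eqI)
    fix b assume b: "b \<in> B"
    have "Yop w v b = \<zero>\<^bsub>K b\<^esub>"
      using v b nxt_facts[OF b] v_at by (intro Yop_eq_zero) auto
    then show "Yop w v b = \<one>\<^bsub>G\<^esub> b" using b by simp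
  qed (use v in auto)
  define z where "z = g v"
  have z: "z \<in> carrier G" using v g_closed by (simp add: z_def)
  have Yz: "Yop w' z = \<one>\<^bsub>G\<^esub>" using gY[OF v] \<open>Yop w v = \<one>\<^bsub>G\<^esub>\<close> g(2) by (simp add: z_def)
  \<comment> \<open>\<open>Y z = 0\<close> allows z nonzero entries only at the start and right
    after the breaks with letter x. The latter are hit by X with scalar 1, and \<open>u\<close>
    collects their preimages.\<close>
  define u where "u = (\<lambda>b\<in>B. if \<not> is_end b \<and> t \<in> fst b \<and> w' ! snd b = Lx then tau ` z (nxt b) else \<zero>\<^bsub>K b\<^esub>)"
  have u: "u \<in> carrier G"
    unfolding u_def by (rule G_I) (use z nxt_facts tau_from_nxt(1) in simp)
  define e where "e = (\<lambda>b\<in>B. if is_start b then z b else \<zero>\<^bsub>K b\<^esub>)"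
  have e: "e \<in> carrier G" unfolding e_def by (rule G_I) (use z in simp)
  have decomp: "z = e \<otimes>\<^bsub>G\<^esub> Xop w' u"
  proof (rule G_eqI)
    fix b assume b: "b \<in> B"
    show "z b = (e \<otimes>\<^bsub>G\<^esub> Xop w' u) b"
    proof (cases "is_start b")
      case True
      then show ?thesis using b z by (simp add: Xop_start e_def)
    next
      case False
      note p = prv_facts[OF b False]
      show ?thesis
      proof (cases "t \<in> fst (prv b) \<and> w' ! snd (prv b) = Lx")
        case True
        then have "alpha w' (prv b) = \<one>" by (simp add: alpha_def)
        moreover have "u (prv b) = tau ` z b" using True p by (simp add: u_def)
        moreover have "tau ` z b \<in> carrier (K (prv b))" using tau_from_nxt(1)[OF p(1,2)] p b z by simp
        ultimately have "Xop w' u b = z b"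
          using p b z by (simp add: Xop_at[OF b False] K_coset_simps)
        then show ?thesis using b z False by (simp add: e_def)
      next
        case nl: False
        then have "u (prv b) = \<zero>\<^bsub>K (prv b)\<^esub>" using p by (auto simp: u_def)
        then have "Xop w' u b = \<zero>\<^bsub>K b\<^esub>" using u b by (intro Xop_eq_zero) auto
        moreover have "beta w' (prv b) = \<one>" using nl by (auto simp: beta_def)
        then have "tau ` z b = \<zero>\<^bsub>K (prv b)\<^esub>"
          using fun_cong[OF Yz, of "prv b"] p z b tau_from_nxt(1)[OF p(1,2), of "z b"]
          by (simp add: Yop_at[OF p(1,2)] K_coset_simps)
        then have "z b = \<zero>\<^bsub>K b\<^esub>" using tau_from_nxt(4)[OF p(1,2), of "z b"] p z b by simp
        ultimately show ?thesis using b False by (simp add: e_def)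
      qed
    qed
  qed (use z e u in auto)
  have Xadd: "(Xop w' ^^ k) (x \<otimes>\<^bsub>G\<^esub> y) = (Xop w' ^^ k) x \<otimes>\<^bsub>G\<^esub> (Xop w' ^^ k) y"
    if "x \<in> carrier G" "y \<in> carrier G" for x y k
    using gwa_rep.X_hom[OF gwa_rep_op, of w'] that by (induction k) (auto simp: hom_def)
  \<comment> \<open>After \<open>q\<close> steps only the entry at \<open>b0\<close> can be left of
    \<open>e\<close>, and there the letter y stops X.\<close>
  have Xe: "(Xop w' ^^ Suc q) e = \<one>\<^bsub>G\<^esub>"
  proof (rule G_eqI)
    fix b assume b: "b \<in> B"
    show "(Xop w' ^^ Suc q) e b = \<one>\<^bsub>G\<^esub> b"
    proof (cases "pos b = Suc q")
      case True
      then have "b = b1" using pos_inj[OF b n0(1)] q by simp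
      moreover have "alpha w' b0 = \<zero>" using b0 assms(3) by (simp add: alpha_def)
      moreover have "\<sigma> ` \<zero>\<^bsub>K b0\<^esub> = \<zero>\<^bsub>K b1\<^esub>"
        using sigma_tau_zero_one(1)[OF B_orbit[OF b0(1)]] by (simp add: b1_def fst_nxt)
      ultimately show ?thesis
        using n0 e b0 by (simp add: Xop_at K_coset_simps del: sigma_tau_zero_one)
    next
      case False
      then have "(Xop w' ^^ Suc q) e b = \<zero>\<^bsub>K b\<^esub>"
        using e b by (intro Xpow_start_off) (auto simp: e_def)
      then show ?thesis using b by simp
    qed
  qed (use e in \<open>auto simp del: funpow.simps\<close>)
  have "(Xop w' ^^ Suc q) z = (Xop w' ^^ Suc q) (Xop w' u)"
    using decomp Xadd[OF e Xop_closed[OF u], of "Suc q"] Xe Xpow_closed[OF Xop_closed[OF u], of "Suc q"]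
    by (simp del: funpow.simps Xpow_closed)
  then have zu: "(Xop w' ^^ Suc q) z = (Xop w' ^^ Suc (Suc q)) u"
    by (simp add: funpow_swap1)
  have "u \<in> g ` carrier G" using bij_betw_imp_surj_on[OF g(1)] u by simp
  then obtain u' where u': "u' \<in> carrier G" "g u' = u" by blast
  have gpow: "g ((Xop w ^^ k) x) = (Xop w' ^^ k) (g x)" if "x \<in> carrier G" for k x
    using that by (induction k) (auto simp: gX)
  \<comment> \<open>Pulled back along \<open>g\<close>, the equation places X^(q+1) v in the image
    of X^(q+2), whose elements vanish up to position q+1; but that is the position of
    \<open>b1\<close>, where the left side is nonzero.\<close>
  have "g ((Xop w ^^ Suc q) v) = g ((Xop w ^^ Suc (Suc q)) u')"
    unfolding gpow[OF v] gpow[OF u'(1)] using zu u' by (simp only: z_def)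
  then have "(Xop w ^^ Suc q) v = (Xop w ^^ Suc (Suc q)) u'"
    using g(1) v u'(1) Xpow_closed unfolding bij_betw_def inj_on_def by blast
  moreover have "(Xop w ^^ Suc (Suc q)) u' b1 = \<zero>\<^bsub>K b1\<^esub>"
    using u' n0 q by (intro Xpow_behind) auto
  ultimately show False using nz by simp
qed

section \<open>Last nonzero positions as a substitute for dimension\<close>

definition lead :: "('a set \<times> nat \<Rightarrow> 'a set) set \<Rightarrow> nat set" where
  "lead S = {pos b | b. b \<in> B \<and>
     (\<exists>v\<in>S. v b \<noteq> \<zero>\<^bsub>K b\<^esub> \<and> (\<forall>b'\<in>B. pos b < pos b' \<longrightarrow> v b' = \<zero>\<^bsub>K b'\<^esub>))}"

lemma lead_mono:
  assumes "S \<subseteq> T"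
  shows "lead S \<subseteq> lead T"
proof
  fix p assume "p \<in> lead S"
  then obtain b v where bv: "p = pos b" "b \<in> B" "v \<in> S" "v b \<noteq> \<zero>\<^bsub>K b\<^esub>"
    "\<forall>b'\<in>B. pos b < pos b' \<longrightarrow> v b' = \<zero>\<^bsub>K b'\<^esub>"
    unfolding lead_def by blast
  moreover have "v \<in> T" using bv(3) assms by blast
  ultimately show "p \<in> lead T" unfolding lead_def by blast
qed

definition R_submodule where
  "R_submodule S \<longleftrightarrow> S \<subseteq> carrier G \<and> \<one>\<^bsub>G\<^esub> \<in> S \<and> (\<forall>u\<in>S. \<forall>v\<in>S. u \<otimes>\<^bsub>G\<^esub> v \<in> S) \<and>
     (\<forall>r\<in>carrier R. \<forall>v\<in>S. rho r v \<in> S)"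

text \<open>Reduction as with leading terms: the last nonzero entry of a vector of T is matched by
  an R-multiple of a vector of S ending at the same position, by division in the residue field. The
  difference stays in T and ends earlier.\<close>

lemma lead_eq_imp_subset:
  assumes S: "R_submodule S" and T: "R_submodule T" and ST: "S \<subseteq> T" "lead T \<subseteq> lead S"
  shows "T \<subseteq> S"
proof -
  \<comment> \<open>The action of R is the same for all words; the empty one represents
    them.\<close>
  interpret rep: gwa_rep R \<sigma> t G rho "Xop []" "Yop []" by (rule gwa_rep_op)
  have "v \<in> T \<Longrightarrow> (\<And>b. b \<in> B \<Longrightarrow> N \<le> pos b \<Longrightarrow> v b = \<zero>\<^bsub>K b\<^esub>) \<Longrightarrow> v \<in> S" for v N
  proof (induction N arbitrary: v)
    case 0
    have vG: "v \<in> carrier G" using 0(1) T by (auto simp: R_submodule_def)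
    have "v = \<one>\<^bsub>G\<^esub>" by (rule G_eqI) (use vG 0(2) in auto)
    then show ?case using S by (simp add: R_submodule_def)
  next
    case (Suc N)
    have vG: "v \<in> carrier G" using Suc.prems(1) T by (auto simp: R_submodule_def)
    show ?case
    proof (cases "\<exists>b\<in>B. pos b = N \<and> v b \<noteq> \<zero>\<^bsub>K b\<^esub>")
      case False
      then have "v b = \<zero>\<^bsub>K b\<^esub>" if "b \<in> B" "N \<le> pos b" for b
        using that Suc.prems(2) by (cases "pos b = N") auto
      then show ?thesis using Suc by blast
    next
      case True
      then obtain b where b: "b \<in> B" "pos b = N" "v b \<noteq> \<zero>\<^bsub>K b\<^esub>" by blast
      have "\<forall>b'\<in>B. pos b < pos b' \<longrightarrow> v b' = \<zero>\<^bsub>K b'\<^esub>" using Suc.prems(2) b(2) by simp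
      then have "pos b \<in> lead T" unfolding lead_def using Suc.prems(1) b by blast
      then have "N \<in> lead T" using b(2) by simp
      then have "N \<in> lead S" using ST(2) by blast
      then obtain b' s where s: "N = pos b'" "b' \<in> B" "s \<in> S" "s b' \<noteq> \<zero>\<^bsub>K b'\<^esub>"
        and above: "\<forall>b''\<in>B. pos b' < pos b'' \<longrightarrow> s b'' = \<zero>\<^bsub>K b''\<^esub>"
        unfolding lead_def by blast
      have "b' = b" using pos_inj[OF s(2) b(1)] s(1) b(2) by simp
      have sG: "s \<in> carrier G" using s(3) S by (auto simp: R_submodule_def)
      obtain r where r: "r \<in> carrier R" "(fst b +> r) \<otimes>\<^bsub>K b\<^esub> s b = v b"
        using K_div[OF B_orbit[OF b(1)] G_at[OF vG b(1)] G_at[OF sG b(1)]] s \<open>b' = b\<close> by blast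
      let ?v = "v \<otimes>\<^bsub>G\<^esub> rho (\<ominus> r) s"
      have inv: "rho (\<ominus> r) s \<otimes>\<^bsub>G\<^esub> rho r s = \<one>\<^bsub>G\<^esub>"
        using rep.rho_add[of "\<ominus> r" r s] rep.rho_zero[OF sG] r sG by (simp add: R.l_neg)
      have "?v \<in> S"
      proof (rule Suc.IH)
        show "?v \<in> T" using Suc.prems(1) T ST(1) s(3) r(1) by (auto simp: R_submodule_def)
        fix c assume c: "c \<in> B" "N \<le> pos c"
        show "?v c = \<zero>\<^bsub>K c\<^esub>"
        proof (cases "pos c = N")
          case True
          then have "c = b" using pos_inj c b by simp
          moreover have "v b = rho r s b" using r b by (simp add: rho_at)
          moreover have "rho r s \<otimes>\<^bsub>G\<^esub> rho (\<ominus> r) s = \<one>\<^bsub>G\<^esub>" using inv r sG by (simp add: G.m_comm)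
          then have "(rho r s \<otimes>\<^bsub>G\<^esub> rho (\<ominus> r) s) b = \<one>\<^bsub>G\<^esub> b" by simp
          ultimately show ?thesis using b by simp
        next
          case False
          then have "v c = \<zero>\<^bsub>K c\<^esub>" "s c = \<zero>\<^bsub>K c\<^esub>" using c Suc.prems(2) above s(1) by auto
          then show ?thesis using c r(1) by (simp add: rho_at)
        qed
      qed
      then have "?v \<otimes>\<^bsub>G\<^esub> rho r s \<in> S" using S r(1) s(3) by (auto simp: R_submodule_def)
      moreover have "?v \<otimes>\<^bsub>G\<^esub> rho r s = v"
        using inv vG sG r by (simp add: G.m_assoc)
      ultimately show ?thesis by simp
    qed
  qed
  note main = this
  show ?thesis
  proof
    fix v assume "v \<in> T"
    moreover have "v b = \<zero>\<^bsub>K b\<^esub>" if "b \<in> B" "Suc (Max (pos ` B)) \<le> pos b" for b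
    proof -
      have "pos b \<le> Max (pos ` B)" using finite_B that(1) by (intro Max_ge) auto
      then show ?thesis using that(2) by linarith
    qed
    ultimately show "v \<in> S" using main by blast
  qed
qed

text \<open>The images of the powers of \<open>g\<close> form a decreasing chain of submodules, which stops because a
  submodule is determined inside a larger one by its finitely many leading positions.\<close>

lemma injective_imp_surjective:
  assumes closed: "\<And>v. v \<in> carrier G \<Longrightarrow> g v \<in> carrier G" and inj: "inj_on g (carrier G)"
    and add: "\<And>u v. u \<in> carrier G \<Longrightarrow> v \<in> carrier G \<Longrightarrow> g (u \<otimes>\<^bsub>G\<^esub> v) = g u \<otimes>\<^bsub>G\<^esub> g v"
    and one: "g \<one>\<^bsub>G\<^esub> = \<one>\<^bsub>G\<^esub>"
    and rho: "\<And>r v. r \<in> carrier R \<Longrightarrow> v \<in> carrier G \<Longrightarrow> g (rho r v) = rho r (g v)"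
  shows "g ` carrier G = carrier G"
proof -
  define S where "S k = (g ^^ k) ` carrier G" for k
  have S_Suc: "S (Suc k) = g ` S k" for k by (simp add: S_def image_comp)
  have S_sub: "R_submodule (S k)" for k
  proof (induction k)
    case 0
    show ?case by (auto simp: S_def R_submodule_def)
  next
    case (Suc k)
    then have k: "S k \<subseteq> carrier G" "\<one>\<^bsub>G\<^esub> \<in> S k"
      "\<And>u v. u \<in> S k \<Longrightarrow> v \<in> S k \<Longrightarrow> u \<otimes>\<^bsub>G\<^esub> v \<in> S k"
      "\<And>r v. r \<in> carrier R \<Longrightarrow> v \<in> S k \<Longrightarrow> rho r v \<in> S k"
      by (auto simp: R_submodule_def)
    have "g u \<otimes>\<^bsub>G\<^esub> g v \<in> g ` S k" if "u \<in> S k" "v \<in> S k" for u v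
      using that k(3) add[OF subsetD[OF k(1) that(1)] subsetD[OF k(1) that(2)]]
      by (intro image_eqI[of _ _ "u \<otimes>\<^bsub>G\<^esub> v"]) auto
    moreover have "rho r (g v) \<in> g ` S k" if "r \<in> carrier R" "v \<in> S k" for r v
      using that k(4) rho[OF that(1) subsetD[OF k(1) that(2)]]
      by (intro image_eqI[of _ _ "rho r v"]) auto
    moreover have "\<one>\<^bsub>G\<^esub> \<in> g ` S k" using k(2) one by (metis imageI)
    moreover have "g ` S k \<subseteq> carrier G" using k(1) closed by blast
    ultimately show ?case unfolding S_Suc R_submodule_def by blast
  qed
  have S_G: "S k \<subseteq> carrier G" for k using S_sub by (simp add: R_submodule_def)
  have dec: "S (Suc k) \<subseteq> S k" for k
  proof (induction k)
    case 0
    then show ?case using closed by (auto simp: S_def)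
  next
    case (Suc k)
    then show ?case unfolding S_Suc[of "Suc k"] S_Suc[of k] by blast
  qed
  have lead_fin: "finite (lead (S k))" for k
    by (rule finite_subset[of _ "pos ` B"]) (auto simp: lead_def finite_B)
  have lead_dec: "lead (S (Suc k)) \<subseteq> lead (S k)" for k
    by (rule lead_mono[OF dec])
  obtain k where k: "lead (S k) = lead (S (Suc k))"
  proof (rule ccontr)
    assume "\<not> thesis"
    then have "lead (S (Suc k)) \<subset> lead (S k)" for k using lead_dec that by blast
    then have lt: "card (lead (S (Suc k))) < card (lead (S k))" for k
      using lead_fin by (simp add: psubset_card_mono)
    have "card (lead (S k)) + k \<le> card (lead (S 0))" for k
    proof (induction k)
      case (Suc k)
      then show ?case using lt[of k] by linarith
    qed simp
    from this[of "Suc (card (lead (S 0)))"] show False by simp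
  qed
  have "S k \<subseteq> S (Suc k)"
    by (rule lead_eq_imp_subset) (use S_sub dec k in auto)
  \<comment> \<open>Injectivity cancels one application of \<open>g\<close>, so the place where the
    chain stops can be moved back to its beginning.\<close>
  have desc: "S k \<subseteq> S (Suc k) \<Longrightarrow> S 0 \<subseteq> S (Suc 0)" for k
  proof (induction k)
    case (Suc k)
    have "S k \<subseteq> S (Suc k)"
    proof
      fix x assume x: "x \<in> S k"
      then have "g x \<in> g ` S (Suc k)" using Suc.prems unfolding S_Suc[of "Suc k"] S_Suc[of k] by blast
      then obtain y where y: "y \<in> S (Suc k)" "g x = g y" by blast
      then have "x = y" using x S_G inj by (meson inj_onD subsetD)
      then show "x \<in> S (Suc k)" using y by simp
    qed
    then show ?case by (rule Suc.IH)
  qed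
  then have "carrier G \<subseteq> g ` carrier G"
    using \<open>S k \<subseteq> S (Suc k)\<close> by (force simp: S_def)
  then show ?thesis using closed by blast
qed

end

section \<open>A non-degenerate form forces the empty word\<close>

context word_string
begin

text \<open>The modules of w and of its dagger live on the same group, so the embedding obtained
  from a form is an injective R-linear self-map \<open>g\<close> of it, the situation of
  \<open>injective_imp_surjective\<close>.\<close>

lemma pseudo_unitarizable_imp_Nil:
  assumes "pseudo_unitarizable R star \<sigma> t \<omega> V.M"
  shows "w = []"
proof (rule ccontr)
  assume ne: "w \<noteq> []"
  obtain F where adm: "admissible_form R star \<sigma> t \<omega> V.M F" and nd: "nondegenerate_form R \<omega> V.M F"
    using assms by (auto simp: pseudo_unitarizable_def)
  note adm' = adm[unfolded admissible_form_def hom_add_monoid_gwa_module, unfolded carrier_gwa_module]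
  have F1: "(\<lambda>v. F v u) \<in> hom G Ob" and F2: "(\<lambda>v. F u v) \<in> hom G Ob" if "u \<in> carrier G" for u
    using adm' that by auto
  have F3: "F (rho r v) u = R_orb_smult R \<omega> r (F v u)"
    if "r \<in> carrier R" "v \<in> carrier G" "u \<in> carrier G" for r v u
  proof -
    have "F (cls (Scal r) \<odot>\<^bsub>V.M\<^esub> v) u = R_orb_smult R \<omega> r (F v u)" using adm' that by blast
    then show ?thesis using that by simp
  qed
  have F4: "F (cls a \<odot>\<^bsub>V.M\<^esub> v) u = R_orb_shift R \<sigma> \<omega> d (F v (cls (gterm_star star a) \<odot>\<^bsub>V.M\<^esub> u))"
    if "gterm_homogeneous R a d" "v \<in> carrier G" "u \<in> carrier G" for a d v u
  proof -
    have "cls a \<in> gwa_component R \<sigma> t d" using that(1) by (auto simp: gwa_component_def)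
    then have "F (cls a \<odot>\<^bsub>V.M\<^esub> v) u = R_orb_shift R \<sigma> \<omega> d (F v (gwa_star R star \<sigma> t (cls a) \<odot>\<^bsub>V.M\<^esub> u))"
      using adm' that(2,3) by blast
    then show ?thesis unfolding gwa_star_cls[OF gterm_homogeneous_gterms[OF that(1)]] .
  qed
  have F_closed: "F v u \<in> carrier Ob" if "v \<in> carrier G" "u \<in> carrier G" for v u
    using F2[OF that(1)] that(2) by (auto simp: hom_def)
  have Frho: "F (rho r v) u = F v (rho (star r) u)"
    if "r \<in> carrier R" "v \<in> carrier G" "u \<in> carrier G" for r v u
    using F4[OF gterm_homogeneous.intros(1)[OF that(1)] that(2,3)] that
    by (simp add: shift_0 F_closed VX_eq[OF len] VY_eq[OF len])
  have FX: "F (Xop w v) u = R_orb_shift R \<sigma> \<omega> 1 (F v (Yop w u))"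
    and FY: "F (Yop w v) u = R_orb_shift R \<sigma> \<omega> (- 1) (F v (Xop w u))"
    if "v \<in> carrier G" "u \<in> carrier G" for v u
    using F4[OF gterm_homogeneous.intros(2) that] F4[OF gterm_homogeneous.intros(3) that] that
    by (simp_all add: VX_eq[OF len] VY_eq[OF len])
  \<comment> \<open>Members of the dual are extensional, hence the restriction to the
    carrier.\<close>
  define Fr where "Fr v = restrict (F v) (carrier G)" for v
  have Fr: "Fr v u = F v u" if "u \<in> carrier G" for v u using that by (simp add: Fr_def)
  have Fr_dual: "is_dual (Fr v)" if v: "v \<in> carrier G" for v
    unfolding is_dual_def
  proof (intro conjI ballI)
    show "Fr v \<in> extensional (carrier G)" by (simp add: Fr_def)
    show "Fr v u \<in> carrier Ob" if "u \<in> carrier G" for u using F_closed[OF v that] Fr that by simp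
    show "Fr v (x \<otimes>\<^bsub>G\<^esub> y) \<mm> = Fr v x \<mm> \<oplus>\<^bsub>R Quot \<mm>\<^esub> Fr v y \<mm>"
      if "x \<in> carrier G" "y \<in> carrier G" "\<mm> \<in> \<omega>" for x y \<mm>
      using hom_mult[OF F2[OF v] that(1,2)] that by (simp add: Fr Ob_mult)
    \<comment> \<open>Linearity in the first argument and admissibility in degree 0 combine to
      semilinearity in the second.\<close>
    show "Fr v (rho r u) \<mm> = (\<mm> +> star r) \<otimes>\<^bsub>R Quot \<mm>\<^esub> Fr v u \<mm>"
      if "r \<in> carrier R" "u \<in> carrier G" "\<mm> \<in> \<omega>" for r u \<mm>
    proof -
      have "F v (rho r u) = R_orb_smult R \<omega> (star r) (F v u)"
        using Frho[of "star r" v u] F3[of "star r" v u] that v by simp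
      then have "F v (rho r u) \<mm> = R_orb_smult R \<omega> (star r) (F v u) \<mm>" by (rule fun_cong)
      then show ?thesis using that by (simp add: Fr R_orb_smult_def)
    qed
  qed
  define g where "g v = Theta (Fr v)" for v
  have g_closed: "g v \<in> carrier G" if "v \<in> carrier G" for v
    using Fr_dual[OF that] by (simp add: g_def Theta_closed)
  have Fr_eqI: "Fr v = \<psi>" if "v \<in> carrier G" "is_dual \<psi>" "\<And>u. u \<in> carrier G \<Longrightarrow> F v u = \<psi> u" for v \<psi>
    using that by (intro extensionalityI[OF is_dualD(1)[OF Fr_dual] is_dualD(1)]) (auto simp: Fr)
  have g_add: "g (x \<otimes>\<^bsub>G\<^esub> y) = g x \<otimes>\<^bsub>G\<^esub> g y" if xy: "x \<in> carrier G" "y \<in> carrier G" for x y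
  proof -
    have "Fr (x \<otimes>\<^bsub>G\<^esub> y) = Fr x \<otimes>\<^bsub>D\<^esub> Fr y"
      using xy hom_mult[OF F1 xy] is_dual_D_mult[OF Fr_dual[OF xy(1)] Fr_dual[OF xy(2)]]
      by (intro Fr_eqI) (auto simp: D_mult Fr)
    then show ?thesis using xy by (simp add: g_def Theta_mult Fr_dual)
  qed
  have g_rho: "g (rho r v) = rho r (g v)" if rv: "r \<in> carrier R" "v \<in> carrier G" for r v
  proof -
    have "Fr (rho r v) = rhoD r (Fr v)"
      using rv is_dual_rhoD[OF Fr_dual[OF rv(2)] rv(1)] Frho[OF rv] by (intro Fr_eqI) (auto simp: Fr)
    then show ?thesis unfolding g_def by (simp only: Theta_rho[OF Fr_dual[OF rv(2)] rv(1)])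
  qed
  have g_X: "g (Xop w v) = Xop (dagger w) (g v)" if v: "v \<in> carrier G" for v
  proof -
    have "Fr (Xop w v) = XD (Fr v)"
      using v is_dual_XD[OF Fr_dual[OF v]] FX[OF v] by (intro Fr_eqI) (auto simp: Fr VY_eq[OF len])
    then show ?thesis unfolding g_def by (simp only: Theta_X[OF Fr_dual[OF v]])
  qed
  have g_Y: "g (Yop w v) = Yop (dagger w) (g v)" if v: "v \<in> carrier G" for v
  proof -
    have "Fr (Yop w v) = YD (Fr v)"
      using v is_dual_YD[OF Fr_dual[OF v]] FY[OF v] by (intro Fr_eqI) (auto simp: Fr VX_eq[OF len])
    then show ?thesis unfolding g_def by (simp only: Theta_Y[OF Fr_dual[OF v]])
  qed
  have gh: "group_hom G G g"
    by (intro group_hom.intro group_hom_axioms.intro homI G.is_group) (auto simp: g_closed g_add)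
  have g_ker: "v = \<one>\<^bsub>G\<^esub>" if v: "v \<in> carrier G" "g v = \<one>\<^bsub>G\<^esub>" for v
  proof (rule ccontr)
    assume "v \<noteq> \<one>\<^bsub>G\<^esub>"
    then obtain u where u: "u \<in> carrier G" "F v u \<noteq> \<one>\<^bsub>Ob\<^esub>"
      using nd v(1) by (auto simp: nondegenerate_form_def)
    have "Fr v = \<one>\<^bsub>D\<^esub>"
      using v Theta_one Theta_inj[OF Fr_dual[OF v(1)] is_dual_D_one] by (simp add: g_def)
    then have "Fr v u = \<one>\<^bsub>Ob\<^esub>" using u by (simp add: D_one)
    then show False using u Fr by simp
  qed
  have g_inj: "inj_on g (carrier G)"
    using group_hom.inj_on_one_iff[OF gh] g_ker by simp
  have g_one: "g \<one>\<^bsub>G\<^esub> = \<one>\<^bsub>G\<^esub>" by (rule group_hom.hom_one[OF gh])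
  have bij: "bij_betw g (carrier G) (carrier G)"
    unfolding bij_betw_def using g_inj injective_imp_surjective[OF g_closed g_inj g_add g_one g_rho] by blast
  have n: "n > 0" using ne len by auto
  show False
  proof (cases "w ! 0")
    case Lx
    then show ?thesis
      using first_letter_invariant[OF n Lx _ bij g_one g_X g_Y] dagger_nth[OF n] by (cases "dagger w ! 0") auto
  next
    case Ly
    \<comment> \<open>The invariant expects the letter x on the side of the domain, so in this case
      the inverse of \<open>g\<close> is used.\<close>
    let ?h = "inv_into (carrier G) g"
    have h: "?h v \<in> carrier G" "g (?h v) = v" if "v \<in> carrier G" for v
      using that bij bij_betw_inv_into_right[OF bij] bij_betw_inv_into[OF bij] by (auto simp: bij_betw_def)
    have h_eq: "?h (g v) = v" if "v \<in> carrier G" for v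
      using bij_betw_inv_into_left[OF bij that] .
    have "?h \<one>\<^bsub>G\<^esub> = \<one>\<^bsub>G\<^esub>" using h_eq[of "\<one>\<^bsub>G\<^esub>"] g_one by simp
    moreover have "?h (Xop (dagger w) v) = Xop w (?h v)" "?h (Yop (dagger w) v) = Yop w (?h v)"
      if "v \<in> carrier G" for v
      using h[OF that] g_X[of "?h v"] g_Y[of "?h v"] h_eq by (metis Xop_closed, metis Yop_closed)
    moreover have "dagger w ! 0 = Lx" using dagger_nth[OF n] Ly by simp
    ultimately show ?thesis
      using first_letter_invariant[OF n _ Ly bij_betw_inv_into[OF bij]] by blast
  qed
qed

end

section \<open>Submodules in terms of the generators\<close>

context gwa_rep
begin

lemma inv_eq_rho: "v \<in> carrier G \<Longrightarrow> inv\<^bsub>G\<^esub> v = \<rho> (\<ominus> \<one>) v"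
  using rho_add[of "\<ominus> \<one>" \<one> v] rho_zero[of v] rho_one[of v]
  by (intro G.inv_equality) (simp_all add: R.l_neg)

text \<open>Stability under R, X and Y spreads to all terms by induction; negatives are multiples by
  -1.\<close>

lemma submoduleI:
  assumes H: "H \<subseteq> carrier G" "\<one>\<^bsub>G\<^esub> \<in> H" "\<And>u v. u \<in> H \<Longrightarrow> v \<in> H \<Longrightarrow> u \<otimes>\<^bsub>G\<^esub> v \<in> H"
    and ops: "\<And>r v. r \<in> carrier R \<Longrightarrow> v \<in> H \<Longrightarrow> \<rho> r v \<in> H"
      "\<And>v. v \<in> H \<Longrightarrow> fX v \<in> H" "\<And>v. v \<in> H \<Longrightarrow> fY v \<in> H"
  shows "submodule H A M"
proof -
  have inv: "inv\<^bsub>G\<^esub> v \<in> H" if "v \<in> H" for v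
    using that H(1) ops(1)[of "\<ominus> \<one>" v] by (auto simp: inv_eq_rho)
  have act: "act a v \<in> H" if "a \<in> gterms R" "v \<in> H" for a v
    using that by (induction arbitrary: v rule: gterms.induct) (auto simp: ops H inv)
  have group: "group (add_monoid M)"
    using left_module by (simp add: left_module_def abelian_group_def abelian_group_axioms_def comm_group_def)
  have "inv\<^bsub>add_monoid M\<^esub> v \<in> H" if "v \<in> H" for v
  proof -
    have "inv\<^bsub>add_monoid M\<^esub> v = inv\<^bsub>G\<^esub> v"
      using that H(1) by (intro group.inv_equality[OF group]) auto
    then show ?thesis using inv that by simp
  qed
  then have "subgroup H (add_monoid M)"
    using H by (intro group.subgroupI[OF group]) auto
  then show ?thesis
    unfolding submodule_def submodule_axioms_def
    using H(1) act by (auto simp: carrier_gwa smult_cls subset_iff)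
qed

lemma submoduleD:
  assumes "submodule H A M"
  shows "H \<subseteq> carrier G" "\<one>\<^bsub>G\<^esub> \<in> H" "\<And>u v. u \<in> H \<Longrightarrow> v \<in> H \<Longrightarrow> u \<otimes>\<^bsub>G\<^esub> v \<in> H"
    and "\<And>r v. r \<in> carrier R \<Longrightarrow> v \<in> H \<Longrightarrow> \<rho> r v \<in> H"
    and "\<And>v. v \<in> H \<Longrightarrow> fX v \<in> H" and "\<And>v. v \<in> H \<Longrightarrow> fY v \<in> H"
proof -
  interpret H: submodule H A M by fact
  show sub: "H \<subseteq> carrier G" using H.subset by simp
  show "\<one>\<^bsub>G\<^esub> \<in> H" using H.one_closed by simp
  show "u \<otimes>\<^bsub>G\<^esub> v \<in> H" if "u \<in> H" "v \<in> H" for u v using H.m_closed[OF that] by simp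
  have "act a v \<in> H" if "a \<in> gterms R" "v \<in> H" for a v
  proof -
    have "cls a \<in> carrier A" using that(1) by (simp add: carrier_gwa)
    then have "cls a \<odot>\<^bsub>M\<^esub> v \<in> H" using that(2) by (rule H.smult_closed)
    then show ?thesis unfolding smult_cls[OF that(1) subsetD[OF sub that(2)]] .
  qed
  from this[of "Scal _"] this[of GX] this[of GY]
  show "\<And>r v. r \<in> carrier R \<Longrightarrow> v \<in> H \<Longrightarrow> \<rho> r v \<in> H" "\<And>v. v \<in> H \<Longrightarrow> fX v \<in> H" "\<And>v. v \<in> H \<Longrightarrow> fY v \<in> H"
    by (auto simp: gterms.intros)
qed

end

section \<open>Simplicity exactly for the empty word\<close>

context string
begin

lemma single_neq_one: "b \<in> B \<Longrightarrow> single \<one>\<^bsub>K b\<^esub> b \<noteq> \<one>\<^bsub>G\<^esub>"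
  using single_at[of b "\<one>\<^bsub>K b\<^esub>" b] G_one_at[of b] K_one_not_zero[OF B_orbit, of b] by metis

lemma simple_imp_Nil:
  assumes len: "length w = n" and simple: "simple_module A (V_module w)"
  shows "w = []"
proof (rule ccontr)
  assume "w \<noteq> []"
  then have n: "n > 0" using len by auto
  interpret V: gwa_rep R \<sigma> t G rho "VX w" "VY w" by (rule gwa_rep_V[OF len])
  define b0 where "b0 = (bseq i, 0::nat)"
  have b0: "b0 \<in> B" "t \<in> fst b0" "snd b0 = 0" "\<not> is_end b0"
    using first_break_vec n by (auto simp: b0_def is_end_def)
  define b1 where "b1 = nxt b0"
  have b1: "b1 \<in> B" "snd b1 = 1"
    using nxt_facts(1)[OF b0(1,4)] b0 by (auto simp: b1_def nxt_def)
  have contra: False if "H = {u} \<or> H = C" "x \<in> H" "x \<noteq> u" "y \<in> C - H"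
    for H C :: "('a set \<times> nat \<Rightarrow> 'a set) set" and u x y
    using that by auto
  have sub: "submodule H A V.M \<Longrightarrow> H = {\<one>\<^bsub>G\<^esub>} \<or> H = carrier G" for H
    using simple by (simp add: simple_module_def)
  \<comment> \<open>Both candidates for a proper submodule prescribe zeros on a set of levels, so
    they are treated together, with a predicate \<open>P\<close> on levels.\<close>
  have dich: "{v \<in> carrier G. \<forall>b\<in>B. P (snd b) \<longrightarrow> v b = \<zero>\<^bsub>K b\<^esub>} = {\<one>\<^bsub>G\<^esub>} \<or>
      {v \<in> carrier G. \<forall>b\<in>B. P (snd b) \<longrightarrow> v b = \<zero>\<^bsub>K b\<^esub>} = carrier G"
    if X: "\<And>v b. v \<in> carrier G \<Longrightarrow> \<forall>b\<in>B. P (snd b) \<longrightarrow> v b = \<zero>\<^bsub>K b\<^esub> \<Longrightarrow> b \<in> B \<Longrightarrow> P (snd b) \<Longrightarrow> Xop w v b = \<zero>\<^bsub>K b\<^esub>"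
      and Y: "\<And>v b. v \<in> carrier G \<Longrightarrow> \<forall>b\<in>B. P (snd b) \<longrightarrow> v b = \<zero>\<^bsub>K b\<^esub> \<Longrightarrow> b \<in> B \<Longrightarrow> P (snd b) \<Longrightarrow> Yop w v b = \<zero>\<^bsub>K b\<^esub>"
    for P
  proof -
    let ?H = "{v \<in> carrier G. \<forall>b\<in>B. P (snd b) \<longrightarrow> v b = \<zero>\<^bsub>K b\<^esub>}"
    have "submodule ?H A V.M"
    proof (rule V.submoduleI)
      fix v assume "v \<in> ?H"
      then have v: "v \<in> carrier G" "\<forall>b\<in>B. P (snd b) \<longrightarrow> v b = \<zero>\<^bsub>K b\<^esub>" by blast+
      have "Xop w v \<in> ?H" "Yop w v \<in> ?H" using v X[OF v] Y[OF v] Xop_closed Yop_closed by blast+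
      then show "VX w v \<in> ?H" "VY w v \<in> ?H" unfolding VX_eq[OF len v(1)] VY_eq[OF len v(1)] .
    qed (simp_all add: rho_at)
    then show ?thesis by (rule sub)
  qed
  show False
  proof (cases "w ! 0")
    case Lx
    \<comment> \<open>With first letter x the only arrow between levels 0 and 1 is X going up:
      nothing returns to level 0.\<close>
    let ?H = "{v \<in> carrier G. \<forall>b\<in>B. snd b = 0 \<longrightarrow> v b = \<zero>\<^bsub>K b\<^esub>}"
    have "?H = {\<one>\<^bsub>G\<^esub>} \<or> ?H = carrier G"
    proof (rule dich)
      fix v b assume v: "v \<in> carrier G" "\<forall>b\<in>B. snd b = 0 \<longrightarrow> v b = \<zero>\<^bsub>K b\<^esub>" and b: "b \<in> B" "snd b = 0"
      show "Xop w v b = \<zero>\<^bsub>K b\<^esub>"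
        using v b prv_facts(1)[OF b(1)] by (intro Xop_eq_zero) (auto simp: prv_def)
      show "Yop w v b = \<zero>\<^bsub>K b\<^esub>"
      proof (cases "t \<in> fst b \<and> \<not> is_end b")
        case True
        then have "beta w b = \<zero>" using Lx b by (simp add: beta_def)
        moreover have "tau ` v (nxt b) \<in> carrier (K b)"
          using True b v nxt_facts(1)[OF b(1)] by (intro tau_from_nxt(1)) auto
        ultimately show ?thesis using True b by (simp add: Yop_at K_coset_simps)
      next
        case False
        then show ?thesis
          using v b nxt_facts(1)[OF b(1)] by (intro Yop_eq_zero) (auto simp: nxt_def)
      qed
    qed
    moreover have "single \<one>\<^bsub>K b1\<^esub> b1 \<in> ?H" using b1 by (auto intro!: single_closed)
    moreover have "single \<one>\<^bsub>K b1\<^esub> b1 \<noteq> \<one>\<^bsub>G\<^esub>"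
      using single_neq_one b1 by blast
    moreover have "single \<one>\<^bsub>K b0\<^esub> b0 \<in> carrier G - ?H"
      using b0 K_one_not_zero[OF B_orbit[OF b0(1)]] by (auto intro!: single_closed)
    ultimately show False by (rule contra)
  next
    case Ly
    \<comment> \<open>With first letter y the only arrow between levels 0 and 1 is Y going down:
      nothing leaves level 0.\<close>
    let ?H = "{v \<in> carrier G. \<forall>b\<in>B. snd b \<noteq> 0 \<longrightarrow> v b = \<zero>\<^bsub>K b\<^esub>}"
    have "?H = {\<one>\<^bsub>G\<^esub>} \<or> ?H = carrier G"
    proof (rule dich)
      fix v b assume v: "v \<in> carrier G" "\<forall>b\<in>B. snd b \<noteq> 0 \<longrightarrow> v b = \<zero>\<^bsub>K b\<^esub>" and b: "b \<in> B" "snd b \<noteq> 0"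
      have s: "\<not> is_start b" using b by (simp add: is_start_def)
      note p = prv_facts[OF b(1) s]
      show "Xop w v b = \<zero>\<^bsub>K b\<^esub>"
      proof (cases "snd (prv b) = 0")
        case True
        have "snd b = (if t \<in> fst (prv b) then Suc (snd (prv b)) else snd (prv b))"
          using arg_cong[OF p(3), of snd] by (simp add: nxt_def)
        then have "t \<in> fst (prv b)" using b True by (auto split: if_splits)
        then have "alpha w (prv b) = \<zero>" using Ly True by (simp add: alpha_def)
        moreover have "\<sigma> ` \<zero>\<^bsub>K (prv b)\<^esub> = \<zero>\<^bsub>K b\<^esub>"
          using sigma_tau_zero_one(1)[OF B_orbit[OF p(1)]] b(1) by simp
        ultimately show ?thesis
          using p v by (simp add: Xop_at[OF b(1) s] K_coset_simps del: sigma_tau_zero_one)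
      next
        case False
        then show ?thesis using v p b by (intro Xop_eq_zero) auto
      qed
      show "Yop w v b = \<zero>\<^bsub>K b\<^esub>"
        using v b nxt_facts(1)[OF b(1)] by (intro Yop_eq_zero) (auto simp: nxt_def)
    qed
    moreover have "single \<one>\<^bsub>K b0\<^esub> b0 \<in> ?H" using b0 by (auto intro!: single_closed)
    moreover have "single \<one>\<^bsub>K b0\<^esub> b0 \<noteq> \<one>\<^bsub>G\<^esub>"
      using single_neq_one b0 by blast
    moreover have "single \<one>\<^bsub>K b1\<^esub> b1 \<in> carrier G - ?H"
      using b1 K_one_not_zero[OF B_orbit[OF b1(1)]] by (auto intro!: single_closed)
    ultimately show False by (rule contra)
  qed
qed

lemma Ypow_ahead:
  assumes "v \<in> carrier G" "\<And>b. b \<in> B \<Longrightarrow> N < pos b \<Longrightarrow> v b = \<zero>\<^bsub>K b\<^esub>"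
  shows "b \<in> B \<Longrightarrow> N < pos b + p \<Longrightarrow> (Yop w ^^ p) v b = \<zero>\<^bsub>K b\<^esub>"
proof (induction p arbitrary: b)
  case 0
  then show ?case using assms by simp
next
  case (Suc p)
  have "Yop w ((Yop w ^^ p) v) b = \<zero>\<^bsub>K b\<^esub>"
  proof (rule Yop_eq_zero)
    assume e: "\<not> is_end b"
    show "(Yop w ^^ p) v (nxt b) = \<zero>\<^bsub>K (nxt b)\<^esub>"
      by (rule Suc.IH) (use Suc.prems nxt_facts[OF Suc.prems(1) e] pos_nxt[OF Suc.prems(1) e] in auto)
  qed (use Suc.prems assms in auto)
  then show ?case by simp
qed

text \<open>For \<open>n = 0\<close> a break can occur only at the end of the string, so Y has the
  scalar 1 at every step back and loses nothing before the start.\<close>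

lemma Ypow_nonzero:
  assumes "n = 0"
  shows "v \<in> carrier G \<Longrightarrow> b \<in> B \<Longrightarrow> b' \<in> B \<Longrightarrow> v b \<noteq> \<zero>\<^bsub>K b\<^esub> \<Longrightarrow> pos b = pos b' + p
    \<Longrightarrow> (Yop w ^^ p) v b' \<noteq> \<zero>\<^bsub>K b'\<^esub>"
proof (induction p arbitrary: v b)
  case 0
  then show ?case using pos_inj[of b b'] by simp
next
  case (Suc p)
  have s: "\<not> is_start b" using Suc.prems(5) pos_start[of b] by auto
  note p = prv_facts[OF Suc.prems(2) s]
  have "snd (prv b) = n" using B_snd[OF p(1)] assms by simp
  then have "t \<notin> fst (prv b)" using p(2) unfolding is_end_def by blast
  then have "beta w (prv b) = \<one>" by (simp add: beta_def)
  moreover have "tau ` v b \<in> carrier (K (prv b))" "tau ` v b \<noteq> \<zero>\<^bsub>K (prv b)\<^esub>"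
    using tau_from_nxt(1,4)[OF p(1,2), of "v b"] p Suc.prems by auto
  ultimately have "Yop w v (prv b) \<noteq> \<zero>\<^bsub>K (prv b)\<^esub>"
    using p by (simp add: Yop_at[OF p(1,2)] K_coset_simps)
  then have "(Yop w ^^ p) (Yop w v) b' \<noteq> \<zero>\<^bsub>K b'\<^esub>"
    using Suc.prems p pos_prv[OF Suc.prems(2) s] by (intro Suc.IH[of _ "prv b"]) auto
  then show ?case by (simp add: funpow_swap1)
qed

lemma Nil_imp_simple:
  assumes len: "length w = n" and n: "n = 0"
  shows "simple_module A (V_module w)"
proof -
  interpret V: gwa_rep R \<sigma> t G rho "VX w" "VY w" by (rule gwa_rep_V[OF len])
  have snd0: "snd b = 0" if "b \<in> B" for b using B_snd[OF that] n by simp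
  define b0 where "b0 = (bseq i, 0::nat)"
  have b0: "b0 \<in> B" using first_break_vec by (simp add: b0_def)
  have "single \<one>\<^bsub>K b0\<^esub> b0 \<noteq> \<one>\<^bsub>G\<^esub>"
    using single_neq_one[OF b0] .
  moreover have "single \<one>\<^bsub>K b0\<^esub> b0 \<in> carrier G" using b0 by (intro single_closed) auto
  ultimately have "carrier G \<noteq> {\<one>\<^bsub>G\<^esub>}" by (metis singletonD)
  moreover have "H = {\<one>\<^bsub>G\<^esub>} \<or> H = carrier G" if "submodule H A V.M" for H
  proof (cases "H = {\<one>\<^bsub>G\<^esub>}")
    case False
    note H = V.submoduleD[OF that]
    have HX: "Xop w v \<in> H" and HY: "Yop w v \<in> H" if "v \<in> H" for v
      using H(5,6)[OF that] H(1) that VX_eq[OF len, of v] VY_eq[OF len, of v] by auto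
    have HXp: "(Xop w ^^ q) v \<in> H" and HYp: "(Yop w ^^ q) v \<in> H" if "v \<in> H" for q v
      using that HX HY by (induction q) auto
    obtain v where v: "v \<in> H" "v \<noteq> \<one>\<^bsub>G\<^esub>" using False H(2) by blast
    have vG: "v \<in> carrier G" using v(1) H(1) by blast
    define S where "S = {b \<in> B. v b \<noteq> \<zero>\<^bsub>K b\<^esub>}"
    have "S \<noteq> {}" using v(2) G_eqI[OF vG G.one_closed] by (auto simp: S_def)
    moreover have "finite S" using finite_B by (simp add: S_def)
    ultimately obtain b where b: "b \<in> S" "pos b = Max (pos ` S)"
      using Max_in[of "pos ` S"] by (metis (no_types, lifting) empty_is_image finite_imageI imageE)
    have above: "v c = \<zero>\<^bsub>K c\<^esub>" if "c \<in> B" "pos b < pos c" for c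
    proof (rule ccontr)
      assume "v c \<noteq> \<zero>\<^bsub>K c\<^esub>"
      then have "pos c \<le> Max (pos ` S)" using that(1) \<open>finite S\<close> by (intro Max_ge) (auto simp: S_def)
      then show False using that(2) b(2) by simp
    qed
    \<comment> \<open>Exactly as many steps back as lie between the start and the last nonzero
      entry: that entry arrives at the start and all earlier ones drop off.\<close>
    define e where "e = (Yop w ^^ pos b) v"
    have e: "e \<in> H" "e \<in> carrier G" using HYp[OF v(1)] vG by (auto simp: e_def)
    have e_off: "e c = \<zero>\<^bsub>K c\<^esub>" if "c \<in> B" "\<not> is_start c" for c
      unfolding e_def using vG above that pos_eq_0[OF that(1)]
      by (intro Ypow_ahead[of v "pos b"]) auto
    have e_on: "e c \<noteq> \<zero>\<^bsub>K c\<^esub>" if "c \<in> B" "is_start c" for c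
      unfolding e_def using vG b(1) that pos_start[OF that(2)]
      by (intro Ypow_nonzero[OF n, of v b]) (auto simp: S_def)
    \<comment> \<open>From the start X reaches every index with a nonzero entry and has no other
      entries on arrival; \<open>K_div\<close> then adjusts the coefficient.\<close>
    have single_H: "single c d \<in> H" if d: "d \<in> B" "c \<in> carrier (K d)" for c d
    proof -
      let ?x = "(Xop w ^^ pos d) e"
      have x: "?x \<in> H" "?x \<in> carrier G" using HXp[OF e(1)] e(2) by auto
      have "?x d \<noteq> \<zero>\<^bsub>K d\<^esub>" using Xpow_start_on[OF e(2) e_on d(1) snd0[OF d(1)]] .
      then obtain r where r: "r \<in> carrier R" "(fst d +> r) \<otimes>\<^bsub>K d\<^esub> ?x d = c"
        using K_div[OF B_orbit[OF d(1)] d(2) G_at[OF x(2) d(1)]] by blast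
      have "rho r ?x = single c d"
      proof (rule G_eqI)
        fix b' assume b': "b' \<in> B"
        show "rho r ?x b' = single c d b'"
        proof (cases "b' = d")
          case True
          then show ?thesis using r d by (simp add: rho_at)
        next
          case False
          then have "pos b' \<noteq> pos d" using pos_inj[OF b' d(1)] by blast
          then have "?x b' = \<zero>\<^bsub>K b'\<^esub>" using Xpow_start_off[OF e(2) e_off b'] by blast
          then show ?thesis using False b' r(1) by (simp add: rho_at)
        qed
      qed (use r x d in auto)
      then show ?thesis using H(4)[OF r(1) x(1)] by simp
    qed
    have "u \<in> H" if "u \<in> carrier G" for u
      using that by (induction rule: G_generated) (auto simp: H single_H)
    then show ?thesis using H(1) by blast
  qed simp
  ultimately show ?thesis
    unfolding simple_module_def using V.left_module by simp
qed

end

theorem theorem5p8: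
  fixes R :: "('a, 'm) ring_scheme" and star \<sigma> :: "'a \<Rightarrow> 'a" and t :: 'a
    and \<omega> :: "'a set set" and \<mm>0 :: "'a set" and j :: nat and w :: "letter list"
  assumes "cring R"
    and "star \<in> ring_iso R R" and "\<And>r. r \<in> carrier R \<Longrightarrow> star (star r) = r"
    and "\<sigma> \<in> ring_iso R R" and "\<And>r. r \<in> carrier R \<Longrightarrow> \<sigma> (star r) = star (\<sigma> r)"
    and "t \<in> carrier R" and "star t = t"
    and "\<omega> \<in> ideal_orbits R \<sigma>" and "finite \<omega>" and "real_orbit star \<omega>"
    and "card (breaks t \<omega>) > 0"
    and "\<mm>0 \<in> breaks t \<omega>" and "j < card (breaks t \<omega>)"
  shows "isomorphic_modules (gwa R \<sigma> t)
           (finitistic_dual R star \<sigma> t \<omega> (V_mod R \<sigma> t \<omega> \<mm>0 j w))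
           (V_mod R \<sigma> t \<omega> \<mm>0 j (dagger w))
       \<and> (pseudo_unitarizable R star \<sigma> t \<omega> (V_mod R \<sigma> t \<omega> \<mm>0 j w) \<longleftrightarrow> w = [])
       \<and> (w = [] \<longleftrightarrow> simple_module (gwa R \<sigma> t) (V_mod R \<sigma> t \<omega> \<mm>0 j w))"
proof -
  interpret word_string R \<sigma> t \<omega> \<mm>0 j "length w" star w
    by (intro word_string.intro string.intro break_orbit.intro gwa_data.intro gwa_data_axioms.intro
        break_orbit_axioms.intro word_string_axioms.intro refl) (fact assms)+
  show ?thesis
    using dual_isomorphic pseudo_unitarizable_Nil pseudo_unitarizable_imp_Nil
      simple_imp_Nil[OF refl] Nil_imp_simple[OF refl]
    unfolding V_mod_eq[OF refl] by auto
qed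

end
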